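(* Let $d_0\ge1$, $\varepsilon>0$, and let $G$ be $GL(d_0,\mathbb R)$, $SL(d_0,\mathbb R)$ or (for $d_0$ even) $Sp(d_0,\mathbb R)$. Any periodic cocycle $(A_i)_{i\in\mathbb Z}$ in $G$ with period $\ell$ admits an $\varepsilon$-path of perturbations $(A_i(t))_{t\in[0,1]}$ in $G$ with the same period $\ell$ such that, writing $\mathcal A(t):=A_\ell(t)\cdots A_1(t)$, the matrix $\mathcal A(1)$ has $d_0$ distinct (complex) eigenvalues, and their arguments are in $\pi\mathbb Q$. If $G$ is $GL(d_0,\mathbb R)$ or $SL(d_0,\mathbb R)$, one can furthermore require that the moduli of the eigenvalues of $\mathcal A(t)$ are constant in $t\in[0,1]$.
   Context: Matrices carry the operator norm associated with the Euclidean norm. For a subgroup $G\subset GL(d_0,\mathbb R)$, a periodic cocycle in $G$ with period $\ell\ge1$ is the integer $\ell$ together with a sequence $(A_i)_{i\in\mathbb Z}$ in $G$ with $A_{i+\ell}=A_i$ for all $i$. An $\varepsilon$-path of perturbations of $(A_i)$ is a family of periodic cocycles $(A_i(t))_{i\in\mathbb Z}$, $t\in[0,1]$, in $G$, continuous in $t$, with $A_i(0)=A_i$ and $\max\{\|A_i-A_i(t)\|,\|A_i^{-1}-A_i(t)^{-1}\|\}<\varepsilon$ for all $i$ and all $t\in[0,1]$. *)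

theory Defs
  imports
    Complex_Main
    "Jordan_Normal_Form.Char_Poly"
    "Jordan_Normal_Form.Gauss_Jordan_Elimination"
    "Jordan_Normal_Form.Spectral_Radius"
begin

definition euclid_norm :: "real vec \<Rightarrow> real" where
  "euclid_norm v = sqrt (scalar_prod v v)"

definition op_norm :: "real mat \<Rightarrow> real" where
  "op_norm A = Sup {euclid_norm (A *\<^sub>v v) | v. v \<in> carrier_vec (dim_col A) \<and> euclid_norm v \<le> 1}"

text \<open>Unspecified unless \<open>A\<close> is invertible.\<close>

definition inv_mat :: "real mat \<Rightarrow> real mat" where
  "inv_mat A = the (mat_inverse A)"

definition general_linear :: "nat \<Rightarrow> real mat set" where
  "general_linear d = {A \<in> carrier_mat d d. invertible_mat A}"

definition special_linear :: "nat \<Rightarrow> real mat set" where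
  "special_linear d = {A \<in> carrier_mat d d. det A = 1}"

text \<open>The matrix of the standard symplectic form on \<open>\<real>\<^sup>2\<^sup>m\<close>, with the coordinates ordered as
  \<open>(x\<^sub>1, \<dots>, x\<^sub>m, y\<^sub>1, \<dots>, y\<^sub>m)\<close>.\<close>

definition symplectic_form :: "nat \<Rightarrow> real mat" where
  "symplectic_form m = four_block_mat (0\<^sub>m m m) (1\<^sub>m m) (- 1\<^sub>m m) (0\<^sub>m m m)"

text \<open>Meaningful only for even \<open>d\<close>.\<close>

definition symplectic :: "nat \<Rightarrow> real mat set" where
  "symplectic d = {A \<in> carrier_mat d d.
     transpose_mat A * symplectic_form (d div 2) * A = symplectic_form (d div 2)}"

definition periodic_cocycle :: "real mat set \<Rightarrow> nat \<Rightarrow> (int \<Rightarrow> real mat) \<Rightarrow> bool" where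
  "periodic_cocycle G l A \<longleftrightarrow>
     l \<ge> 1 \<and> (\<forall>i. A i \<in> G) \<and> (\<forall>i. A (i + int l) = A i)"

text \<open>\<open>P t i\<close> is the \<open>i\<close>-th matrix of the cocycle at time \<open>t\<close>. All cocycles of the path have the
  period \<open>l\<close>. Values of \<open>P t\<close> for \<open>t\<close> outside the unit interval are irrelevant.\<close>

definition perturbation_path ::
    "real mat set \<Rightarrow> nat \<Rightarrow> real \<Rightarrow> (int \<Rightarrow> real mat) \<Rightarrow> (real \<Rightarrow> int \<Rightarrow> real mat) \<Rightarrow> bool" where
  "perturbation_path G l \<epsilon> A P \<longleftrightarrow>
     (\<forall>t\<in>{0..1}. periodic_cocycle G l (P t)) \<and>
     (\<forall>i. \<forall>t\<in>{0..1}. ((\<lambda>s. op_norm (P s i - P t i)) \<longlongrightarrow> 0) (at t within {0..1})) \<and>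
     (\<forall>i. P 0 i = A i) \<and>
     (\<forall>i. \<forall>t\<in>{0..1}.
        max (op_norm (A i - P t i)) (op_norm (inv_mat (A i) - inv_mat (P t i))) < \<epsilon>)"

text \<open>\<open>cocycle_prod d A n\<close> is the product \<open>A n * \<dots> * A 2 * A 1\<close> of \<open>d \<times> d\<close> matrices.\<close>

primrec cocycle_prod :: "nat \<Rightarrow> (int \<Rightarrow> real mat) \<Rightarrow> nat \<Rightarrow> real mat" where
  "cocycle_prod d A 0 = 1\<^sub>m d"
| "cocycle_prod d A (Suc n) = A (int (Suc n)) * cocycle_prod d A n"

definition complex_eigenvalues :: "real mat \<Rightarrow> complex set" where
  "complex_eigenvalues A = spectrum (map_mat complex_of_real A)"

text \<open>The moduli of the complex eigenvalues, counted with algebraic multiplicity.\<close>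

definition eigenvalue_moduli :: "real mat \<Rightarrow> real multiset" where
  "eigenvalue_moduli A = image_mset cmod (proots (char_poly (map_mat complex_of_real A)))"

end

theory Submission
  imports
    Defs
    "HOL-Analysis.L2_Norm"
    "HOL-Computational_Algebra.Field_as_Ring"
    "Subresultants.Subresultant_Gcd"
begin

text \<open>
It suffices to perturb one factor. If \<open>M\<close> is the product of the cocycle over a period and \<open>\<gamma>\<close> is a
short path in the group that starts at \<open>M\<close>, then replacing the last factor \<open>A\<^sub>l\<close> by
\<open>\<gamma>(t) M\<^sup>-\<^sup>1 A\<^sub>l\<close> makes the product equal to \<open>\<gamma>(t)\<close>
(\<open>perturbation_path_of_deformation\<close>). So the statement is about a single matrix: arbitrarily
close to \<open>M\<close>, along a path in the group, there is a matrix with simple spectrum and rational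
arguments. The path is built in two stages, which are then concatenated.

Stage one makes the spectrum simple. In the linear groups the moduli must not move, so a multiple
eigenvalue \<open>\<lambda>\<close> can only be rotated. There is a real invariant plane on which the eigenvalues are
\<open>\<lambda>\<close> and its conjugate, and \<open>M\<close> is block triangular in a basis that extends a basis of the plane.
The \<open>2 \<times> 2\<close> block is moved so that its eigenvalues become \<open>\<lambda> cis \<eta>\<close> and its conjugate. Moduli and
determinant stay constant, and for all but finitely many small \<open>\<eta>\<close> the number of distinct
eigenvalues grows (\<open>split_multiple_eigenvalue\<close>); iterating ends with a simple spectrum.

In the symplectic group the moduli are free, and genericity is used instead. Transvections lie on
straight lines inside the group through the identity, and products of transvections carry the
standard symplectic basis to any other one. Hence a path with polynomial entries inside the group
joins \<open>M\<close> to a diagonal matrix with distinct entries (\<open>symplectic_joined_to_hyperbolic\<close>). The discriminant of the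
characteristic polynomial is a polynomial in the parameter and does not vanish at the end, so it
vanishes only finitely often, and arbitrarily short initial segments end at a simple spectrum.

Stage two is the same for all groups (\<open>rotate_to_rational_arguments\<close>). A matrix with simple
spectrum is \<open>P D P\<^sup>-\<^sup>1\<close> over the complex numbers, and every eigenvalue \<open>z\<close> is turned by a small angle
\<open>t \<psi>(z)\<close>, where \<open>\<psi>(z)\<close> takes the argument to a rational multiple of \<open>\<pi>\<close> and changes sign under
\<open>z \<mapsto> cnj z\<close> and under \<open>z \<mapsto> z\<^sup>-\<^sup>1\<close>. The first symmetry keeps the matrix real and its determinant constant,
the second one keeps every bilinear form that the original matrix preserves.
\<close>

text \<open>Linear factors keep the form \<open>[:- a, 1:]\<close>, on which the rules for their roots act.\<close>

declare pCons_one [simp del]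

section \<open>Entry sum norm and inverses\<close>

definition entry_norm :: "real mat \<Rightarrow> real" where
  "entry_norm A = (\<Sum>i<dim_row A. \<Sum>j<dim_col A. \<bar>A $$ (i,j)\<bar>)"

lemma entry_norm_carrier:
  "A \<in> carrier_mat n m \<Longrightarrow> entry_norm A = (\<Sum>i<n. \<Sum>j<m. \<bar>A $$ (i,j)\<bar>)"
  by (auto simp: entry_norm_def)

lemma entry_norm_nonneg [simp]: "0 \<le> entry_norm A"
  by (auto simp: entry_norm_def intro!: sum_nonneg)

lemma entry_norm_zero [simp]: "entry_norm (0\<^sub>m n m) = 0"
  by (simp add: entry_norm_def)

lemma entry_norm_add_le:
  assumes "A \<in> carrier_mat n m" "B \<in> carrier_mat n m"
  shows "entry_norm (A + B) \<le> entry_norm A + entry_norm B"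
proof -
  have "entry_norm (A + B) = (\<Sum>i<n. \<Sum>j<m. \<bar>A $$ (i,j) + B $$ (i,j)\<bar>)"
    using assms by (subst entry_norm_carrier[of _ n m]) auto
  also have "\<dots> \<le> (\<Sum>i<n. \<Sum>j<m. \<bar>A $$ (i,j)\<bar> + \<bar>B $$ (i,j)\<bar>)"
    by (intro sum_mono abs_triangle_ineq)
  finally show ?thesis
    using assms by (simp add: entry_norm_carrier[of _ n m] sum.distrib)
qed

lemma entry_norm_minus_commute:
  assumes "A \<in> carrier_mat n m" "B \<in> carrier_mat n m"
  shows "entry_norm (A - B) = entry_norm (B - A)"
  using assms by (auto simp: entry_norm_def abs_minus_commute intro!: sum.cong)

lemma entry_norm_mult_le:
  assumes "A \<in> carrier_mat n k" "B \<in> carrier_mat k m"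
  shows "entry_norm (A * B) \<le> entry_norm A * entry_norm B"
proof -
  have "entry_norm (A * B) = (\<Sum>i<n. \<Sum>j<m. \<bar>\<Sum>r<k. A $$ (i,r) * B $$ (r,j)\<bar>)"
    using assms
    by (subst entry_norm_carrier[of _ n m])
       (auto simp: scalar_prod_def atLeast0LessThan)
  also have "\<dots> \<le> (\<Sum>i<n. \<Sum>j<m. \<Sum>r<k. \<bar>A $$ (i,r)\<bar> * \<bar>B $$ (r,j)\<bar>)"
    by (intro sum_mono order_trans[OF sum_abs]) (simp add: abs_mult)
  also have "\<dots> = (\<Sum>i<n. \<Sum>r<k. \<bar>A $$ (i,r)\<bar> * (\<Sum>j<m. \<bar>B $$ (r,j)\<bar>))"
    unfolding sum_distrib_left by (rule sum.cong[OF refl], rule sum.swap)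
  also have "\<dots> \<le> (\<Sum>i<n. \<Sum>r<k. \<bar>A $$ (i,r)\<bar> * entry_norm B)"
  proof (intro sum_mono mult_left_mono)
    fix r assume r: "r \<in> {..<k}"
    show "(\<Sum>j<m. \<bar>B $$ (r,j)\<bar>) \<le> entry_norm B"
      unfolding entry_norm_carrier[OF assms(2)]
      by (rule member_le_sum[OF r, where f = "\<lambda>r. \<Sum>j<m. \<bar>B $$ (r,j)\<bar>"]) (auto intro: sum_nonneg)
  qed auto
  also have "\<dots> = entry_norm A * entry_norm B"
    by (simp add: entry_norm_carrier[OF assms(1)] sum_distrib_right)
  finally show ?thesis .
qed

text \<open>Estimates are made in the entry sum norm, which is visibly submultiplicative and continuous in the
entries; this inequality transfers them to the operator norm.\<close>

lemma op_norm_le_entry_norm: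
  assumes A: "A \<in> carrier_mat n m"
  shows "0 \<le> op_norm A" and "op_norm A \<le> entry_norm A"
proof -
  let ?S = "{euclid_norm (A *\<^sub>v v) | v. v \<in> carrier_vec (dim_col A) \<and> euclid_norm v \<le> 1}"
  have bound: "x \<le> entry_norm A" if "x \<in> ?S" for x
  proof -
    from that A obtain v where v: "v \<in> carrier_vec m" "euclid_norm v \<le> 1"
      and x: "x = euclid_norm (A *\<^sub>v v)" by auto
    have vj: "\<bar>v $ j\<bar> \<le> 1" if j: "j < m" for j
    proof -
      have "(v $ j)\<^sup>2 \<le> (\<Sum>j<m. (v $ j)\<^sup>2)"
        by (rule member_le_sum[where f = "\<lambda>j. (v $ j)\<^sup>2"]) (use j in auto)
      also have "\<dots> = scalar_prod v v"
        using v by (auto simp: scalar_prod_def power2_eq_square atLeast0LessThan)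
      finally have "\<bar>v $ j\<bar> \<le> euclid_norm v"
        unfolding euclid_norm_def by (metis real_sqrt_le_iff real_sqrt_abs)
      with v(2) show ?thesis by simp
    qed
    have row: "\<bar>(A *\<^sub>v v) $ i\<bar> \<le> (\<Sum>j<m. \<bar>A $$ (i,j)\<bar>)" if i: "i < n" for i
    proof -
      have "\<bar>(A *\<^sub>v v) $ i\<bar> = \<bar>\<Sum>j<m. A $$ (i,j) * v $ j\<bar>"
        using i A v by (auto simp: scalar_prod_def atLeast0LessThan)
      also have "\<dots> \<le> (\<Sum>j<m. \<bar>A $$ (i,j) * v $ j\<bar>)" by (rule sum_abs)
      also have "\<dots> \<le> (\<Sum>j<m. \<bar>A $$ (i,j)\<bar>)"
        by (intro sum_mono) (use vj in \<open>auto simp: abs_mult mult_left_le\<close>)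
      finally show ?thesis .
    qed
    have "x = L2_set (\<lambda>i. (A *\<^sub>v v) $ i) {..<n}"
      using A by (simp add: x euclid_norm_def L2_set_def scalar_prod_def power2_eq_square atLeast0LessThan)
    also have "\<dots> \<le> (\<Sum>i<n. \<bar>(A *\<^sub>v v) $ i\<bar>)" by (rule L2_set_le_sum_abs)
    also have "\<dots> \<le> entry_norm A"
      unfolding entry_norm_carrier[OF A] by (intro sum_mono row) auto
    finally show ?thesis .
  qed
  have "A *\<^sub>v 0\<^sub>v m = 0\<^sub>v n" using A by (intro eq_vecI) auto
  then have z: "0 \<in> ?S"
    using A by (intro CollectI exI[of _ "0\<^sub>v m"]) (auto simp: euclid_norm_def)
  show "op_norm A \<le> entry_norm A"
    unfolding op_norm_def by (rule cSup_least) (use z bound in blast)+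
  show "0 \<le> op_norm A"
    unfolding op_norm_def by (rule cSup_upper[OF z bdd_aboveI[OF bound]])
qed

lemma inv_mat_correct:
  assumes A: "A \<in> carrier_mat n n" and d: "det A \<noteq> 0"
  shows "inv_mat A \<in> carrier_mat n n" "A * inv_mat A = 1\<^sub>m n" "inv_mat A * A = 1\<^sub>m n"
proof -
  have "A \<in> Units (ring_mat TYPE(real) n ())" by (rule det_non_zero_imp_unit[OF A d])
  then obtain B where "mat_inverse A = Some B"
    using mat_inverse(1)[OF A, of "()"] by (cases "mat_inverse A") auto
  from this mat_inverse(2)[OF A this]
  show "inv_mat A \<in> carrier_mat n n" "A * inv_mat A = 1\<^sub>m n" "inv_mat A * A = 1\<^sub>m n"
    by (auto simp: inv_mat_def)
qed

lemma invertible_mat_iff_det: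
  assumes A: "(A :: real mat) \<in> carrier_mat n n"
  shows "invertible_mat A \<longleftrightarrow> det A \<noteq> 0"
proof
  assume "invertible_mat A"
  then obtain B where B: "A * B = 1\<^sub>m n" "B * A = 1\<^sub>m (dim_row B)"
    using A by (auto simp: invertible_mat_def inverts_mat_def)
  have "B \<in> carrier_mat n n"
    using arg_cong[OF B(1), of dim_col] arg_cong[OF B(2), of dim_col] A by auto
  then have "det A * det B = 1" using det_mult[OF A, of B] B(1) by simp
  then show "det A \<noteq> 0" by auto
next
  assume "det A \<noteq> 0"
  from inv_mat_correct[OF A this] A show "invertible_mat A"
    by (auto simp: invertible_mat_def inverts_mat_def)
qed

text \<open>Continuity of inversion, from \<open>B\<^sup>-\<^sup>1 - A\<^sup>-\<^sup>1 = B\<^sup>-\<^sup>1 (A - B) A\<^sup>-\<^sup>1\<close>: as soon as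
\<open>\<parallel>A - B\<parallel> \<parallel>A\<^sup>-\<^sup>1\<parallel> \<le> 1/2\<close>, this identity first bounds \<open>\<parallel>B\<^sup>-\<^sup>1\<parallel>\<close> by \<open>2 \<parallel>A\<^sup>-\<^sup>1\<parallel>\<close>.\<close>

lemma inv_mat_close:
  assumes A: "A \<in> carrier_mat n n" "det A \<noteq> 0" and e: "e > 0"
  shows "\<exists>\<delta>>0. \<forall>B\<in>carrier_mat n n. det B \<noteq> 0 \<longrightarrow> entry_norm (B - A) < \<delta> \<longrightarrow>
           entry_norm (inv_mat A - inv_mat B) < e"
proof -
  define Y where "Y = inv_mat A"
  define a where "a = entry_norm Y"
  note Y = inv_mat_correct[OF A, folded Y_def]
  have a0: "a \<ge> 0" by (simp add: a_def)
  \<comment> \<open>The first bound gives \<open>\<delta> a \<le> 1/2\<close>, the second one \<open>2 a\<^sup>2 \<delta> \<le> e\<close>; writing \<open>a + 1\<close> avoids the case \<open>a = 0\<close>.\<close>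
  define \<delta> where "\<delta> = min (1 / (2 * (a + 1))) (e / (2 * (a + 1)\<^sup>2))"
  have "\<delta> > 0" using a0 e by (auto simp: \<delta>_def)
  moreover have "entry_norm (Y - inv_mat B) < e"
    if B: "B \<in> carrier_mat n n" "det B \<noteq> 0" and close: "entry_norm (B - A) < \<delta>" for B
  proof -
    define X where "X = inv_mat B"
    note X = inv_mat_correct[OF B, folded X_def]
    define b where "b = entry_norm (A - B)"
    have b: "0 \<le> b" "b < \<delta>"
      using close entry_norm_minus_commute[OF A(1) B(1)] by (auto simp: b_def)
    have "X * (A - B) * Y = X * A * Y - X * B * Y"
      using X(1) Y(1) A(1) B(1)
      by (simp add: mult_minus_distrib_mat[of _ n n] minus_mult_distrib_mat[of _ n n])
    also have "X * A * Y = X" using X(1) Y A(1) by (simp add: assoc_mult_mat[of _ n n _ n _ n])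
    also have "X * B * Y = Y" using X Y(1) by simp
    finally have eq: "X - Y = X * (A - B) * Y" ..
    have AB: "A - B \<in> carrier_mat n n" using A(1) B(1) by (simp add: minus_carrier_mat)
    have "entry_norm (X - Y) \<le> entry_norm (X * (A - B)) * a"
      unfolding eq a_def by (rule entry_norm_mult_le[of _ n n _ n]) (use X(1) Y(1) AB in auto)
    also have "\<dots> \<le> (entry_norm X * b) * a"
      unfolding b_def by (intro mult_right_mono[OF _ a0] entry_norm_mult_le[OF X(1) AB])
    finally have 1: "entry_norm (X - Y) \<le> entry_norm X * b * a" .
    have "X = (X - Y) + Y" using X(1) Y(1) by auto
    then have 2: "entry_norm X \<le> entry_norm (X - Y) + a"
      using entry_norm_add_le[of "X - Y" n n Y] X(1) Y(1) by (auto simp: a_def minus_carrier_mat)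
    have "b * a \<le> 1 / (2 * (a + 1)) * (a + 1)"
      using b a0 by (intro mult_mono) (auto simp: \<delta>_def)
    also have "\<dots> = 1 / 2" using a0 by simp
    finally have "entry_norm X * (b * a) \<le> entry_norm X * (1 / 2)"
      by (intro mult_left_mono) auto
    with 1 2 have 3: "entry_norm X \<le> 2 * a" by (simp add: mult.assoc)
    have "entry_norm (X - Y) \<le> 2 * a * b * a"
      by (rule order_trans[OF 1]) (intro mult_right_mono 3 a0 b)
    also have "\<dots> \<le> b * (2 * (a + 1)\<^sup>2)"
    proof -
      have "a * a \<le> (a + 1)\<^sup>2" using a0 by (simp add: power2_eq_square algebra_simps)
      then have "b * (2 * (a * a)) \<le> b * (2 * (a + 1)\<^sup>2)" using b by (intro mult_left_mono) auto
      then show ?thesis by (simp add: algebra_simps)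
    qed
    also have "\<dots> < e"
    proof -
      have "b < e / (2 * (a + 1)\<^sup>2)" using b by (simp add: \<delta>_def)
      moreover have "2 * (a + 1)\<^sup>2 > 0" using a0 by auto
      ultimately show ?thesis by (simp add: pos_less_divide_eq)
    qed
    finally show ?thesis
      using entry_norm_minus_commute[OF X(1) Y(1)] by (simp add: X_def)
  qed
  ultimately show ?thesis unfolding Y_def by blast
qed

section \<open>Deformations of a single matrix\<close>

text \<open>A path from \<open>M\<close> to \<open>N\<close> that stays in \<open>H\<close> and within \<open>e\<close> of \<open>M\<close>. The set \<open>H\<close> carries all the
constraints on the path: membership in a group, and constant moduli of the eigenvalues.\<close>

definition deformable :: "nat \<Rightarrow> real mat set \<Rightarrow> real \<Rightarrow> real mat \<Rightarrow> real mat \<Rightarrow> bool" where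
  "deformable d H e M N \<longleftrightarrow> (\<exists>\<gamma>.
     (\<forall>t\<in>{0..1::real}. \<gamma> t \<in> H \<and> entry_norm (\<gamma> t - M) < e) \<and>
     (\<forall>i<d. \<forall>j<d. continuous_on {0..1} (\<lambda>t. \<gamma> t $$ (i,j))) \<and>
     \<gamma> 0 = M \<and> \<gamma> 1 = N)"

lemma deformableE:
  assumes "deformable d H e M N"
  obtains \<gamma> where "\<And>t. t \<in> {0..1} \<Longrightarrow> \<gamma> t \<in> H"
      "\<And>t. t \<in> {0..1} \<Longrightarrow> entry_norm (\<gamma> t - M) < e"
      "\<And>i j. i < d \<Longrightarrow> j < d \<Longrightarrow> continuous_on {0..1::real} (\<lambda>t. \<gamma> t $$ (i,j))"
      "\<gamma> 0 = M" "\<gamma> 1 = N"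
  using assms unfolding deformable_def by metis

lemma deformable_refl:
  assumes "M \<in> H" "M \<in> carrier_mat d d" "e > 0"
  shows "deformable d H e M M"
  unfolding deformable_def
  by (rule exI[of _ "\<lambda>_. M"]) (use assms in auto)

lemma deformable_endpoint: "deformable d H e M N \<Longrightarrow> N \<in> H"
  unfolding deformable_def by force

lemma deformable_trans:
  assumes MN: "deformable d H e M N" and NK: "deformable d H e' N K"
    and H: "H \<subseteq> carrier_mat d d"
  shows "deformable d H (e + e') M K"
proof -
  from MN obtain \<gamma> where \<gamma>: "\<And>t. t \<in> {0..1} \<Longrightarrow> \<gamma> t \<in> H"
      "\<And>t. t \<in> {0..1} \<Longrightarrow> entry_norm (\<gamma> t - M) < e"
      "\<And>i j. i < d \<Longrightarrow> j < d \<Longrightarrow> continuous_on {0..1::real} (\<lambda>t. \<gamma> t $$ (i,j))" "\<gamma> 0 = M" "\<gamma> 1 = N"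
    by (erule deformableE)
  from NK obtain \<eta> where \<eta>: "\<And>t. t \<in> {0..1} \<Longrightarrow> \<eta> t \<in> H"
      "\<And>t. t \<in> {0..1} \<Longrightarrow> entry_norm (\<eta> t - N) < e'"
      "\<And>i j. i < d \<Longrightarrow> j < d \<Longrightarrow> continuous_on {0..1::real} (\<lambda>t. \<eta> t $$ (i,j))" "\<eta> 0 = N" "\<eta> 1 = K"
    by (erule deformableE)
  have carr: "M \<in> carrier_mat d d" "N \<in> carrier_mat d d"
    using H \<gamma>(1)[of 0] \<eta>(1)[of 0] \<gamma>(4) \<eta>(4) by auto
  define \<sigma> where "\<sigma> t = (if t \<le> 1/2 then \<gamma> (2 * t) else \<eta> (2 * t - 1))" for t :: real
  have e': "e' > 0"
    using \<eta>(2)[of 0] by (auto intro: order_le_less_trans[OF entry_norm_nonneg])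
  have "\<sigma> t \<in> H \<and> entry_norm (\<sigma> t - M) < e + e'" if t: "t \<in> {0..1}" for t
  proof (cases "t \<le> 1/2")
    case True
    then show ?thesis using \<gamma>(1,2)[of "2 * t"] t e' by (auto simp: \<sigma>_def)
  next
    case False
    then have s: "2 * t - 1 \<in> {0..1}" using t by auto
    have c: "\<eta> (2 * t - 1) \<in> carrier_mat d d" using \<eta>(1)[OF s] H by auto
    have "\<eta> (2 * t - 1) - M = (\<eta> (2 * t - 1) - N) + (N - M)"
      using c carr by (intro eq_matI) auto
    then have "entry_norm (\<eta> (2 * t - 1) - M) \<le> entry_norm (\<eta> (2 * t - 1) - N) + entry_norm (N - M)"
      using entry_norm_add_le[of "\<eta> (2 * t - 1) - N" d d "N - M"] c carr
      by (simp add: minus_carrier_mat)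
    then show ?thesis using \<eta>(1,2)[OF s] \<gamma>(2)[of 1] \<gamma>(5) False by (auto simp: \<sigma>_def)
  qed
  moreover have "continuous_on {0..1} (\<lambda>t. \<sigma> t $$ (i,j))" if ij: "i < d" "j < d" for i j
  proof -
    have "continuous_on ({0..1/2} \<union> {1/2..1})
        (\<lambda>t. if t \<le> 1/2 then \<gamma> (2 * t) $$ (i,j) else \<eta> (2 * t - 1) $$ (i,j))"
    proof (rule continuous_on_If)
      show "continuous_on {0..1/2} (\<lambda>t. \<gamma> (2 * t) $$ (i,j))"
        by (rule continuous_on_compose2[OF \<gamma>(3)[OF ij]]) (auto intro!: continuous_intros)
      show "continuous_on {1/2..1} (\<lambda>t. \<eta> (2 * t - 1) $$ (i,j))"
        by (rule continuous_on_compose2[OF \<eta>(3)[OF ij]]) (auto intro!: continuous_intros)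
      fix t :: real
      assume "t \<in> {1/2..1}" "t \<le> 1/2"
      then have "2 * t = 1" "2 * t - 1 = 0" by auto
      then show "\<gamma> (2 * t) $$ (i,j) = \<eta> (2 * t - 1) $$ (i,j)"
        using \<gamma>(5) \<eta>(4) by (simp only:)
    qed (auto simp: not_le)
    moreover have "{0..1/2} \<union> {1/2..1} = {0..1::real}" by auto
    ultimately show ?thesis by (simp add: \<sigma>_def if_distrib[of "\<lambda>A. A $$ (i,j)"])
  qed
  ultimately show ?thesis
    unfolding deformable_def using \<gamma>(4) \<eta>(5) by (intro exI[of _ \<sigma>]) (auto simp: \<sigma>_def)
qed

lemma entry_norm_diff_tendsto:
  fixes \<gamma> :: "real \<Rightarrow> real mat"
  assumes c: "\<And>t. t \<in> T \<Longrightarrow> \<gamma> t \<in> carrier_mat n m"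
    and cont: "\<And>i j. i < n \<Longrightarrow> j < m \<Longrightarrow> continuous_on T (\<lambda>t. \<gamma> t $$ (i,j))"
    and t: "t \<in> T"
  shows "((\<lambda>s. entry_norm (\<gamma> s - \<gamma> t)) \<longlongrightarrow> 0) (at t within T)"
proof -
  have "((\<lambda>s. \<Sum>i<n. \<Sum>j<m. \<bar>\<gamma> s $$ (i,j) - \<gamma> t $$ (i,j)\<bar>) \<longlongrightarrow>
         (\<Sum>i<n. \<Sum>j<m. \<bar>\<gamma> t $$ (i,j) - \<gamma> t $$ (i,j)\<bar>)) (at t within T)"
    by (intro tendsto_intros) (use cont t in \<open>auto simp: continuous_on_def\<close>)
  moreover have "\<forall>\<^sub>F s in at t within T.
      (\<Sum>i<n. \<Sum>j<m. \<bar>\<gamma> s $$ (i,j) - \<gamma> t $$ (i,j)\<bar>) = entry_norm (\<gamma> s - \<gamma> t)"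
    unfolding eventually_at_filter
    by (rule always_eventually) (use c c[OF t] in \<open>auto simp: entry_norm_def\<close>)
  ultimately show ?thesis by (auto elim: Lim_transform_eventually)
qed

text \<open>Initial segments of any path are short, so every point close enough to the start can be reached.
The endpoint may then be picked freely in an interval, which leaves room to avoid finitely many bad
parameters.\<close>

lemma deformable_of_germ:
  fixes \<Gamma> :: "real \<Rightarrow> real mat"
  assumes a: "a > 0" and e: "e > 0" and H: "H \<subseteq> carrier_mat d d"
    and \<Gamma>: "\<And>s. s \<in> {0..a} \<Longrightarrow> \<Gamma> s \<in> H" "\<Gamma> 0 = M"
    and cont: "\<And>i j. i < d \<Longrightarrow> j < d \<Longrightarrow> continuous_on {0..a} (\<lambda>s. \<Gamma> s $$ (i,j))"
  shows "\<exists>b\<in>{0<..a}. \<forall>s\<in>{0<..b}. deformable d H e M (\<Gamma> s)"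
proof -
  have "((\<lambda>s. entry_norm (\<Gamma> s - \<Gamma> 0)) \<longlongrightarrow> 0) (at 0 within {0..a})"
    by (rule entry_norm_diff_tendsto[of _ _ d d]) (use \<Gamma>(1) H cont a in auto)
  from order_tendstoD(2)[OF this e] obtain r
    where r: "r > 0" "\<And>s. s \<in> {0..a} \<Longrightarrow> s \<noteq> 0 \<Longrightarrow> \<bar>s\<bar> < r \<Longrightarrow> entry_norm (\<Gamma> s - \<Gamma> 0) < e"
    unfolding eventually_at by (auto simp: dist_real_def)
  define b where "b = min a (r / 2)"
  have M: "M \<in> carrier_mat d d" using \<Gamma> H a by force
  have "deformable d H e M (\<Gamma> s)" if s: "s \<in> {0<..b}" for s
    unfolding deformable_def
  proof (intro exI[of _ "\<lambda>t. \<Gamma> (t * s)"] conjI ballI allI impI)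
    fix t :: real assume t: "t \<in> {0..1}"
    have "t * s \<le> s" "0 \<le> t * s" using t s by (auto simp: mult_left_le_one_le)
    moreover have "s \<le> a" "s < r" using s r(1) by (auto simp: b_def)
    ultimately have ts: "t * s \<in> {0..a}" "\<bar>t * s\<bar> < r" unfolding atLeastAtMost_iff by linarith+
    show "\<Gamma> (t * s) \<in> H" using \<Gamma>(1) ts by auto
    have "M - M = 0\<^sub>m d d" using M by auto
    then show "entry_norm (\<Gamma> (t * s) - M) < e"
      using r(2)[of "t * s"] ts \<Gamma>(2) e by (cases "t * s = 0") auto
  next
    fix i j assume ij: "i < d" "j < d"
    show "continuous_on {0..1} (\<lambda>t. \<Gamma> (t * s) $$ (i,j))"
    proof (rule continuous_on_compose2[OF cont[OF ij]])
      show "(\<lambda>t. t * s) ` {0..1} \<subseteq> {0..a}"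
      proof (clarsimp, intro conjI)
        fix t :: real assume t: "0 \<le> t" "t \<le> 1"
        then show "0 \<le> t * s" using s by auto
        have "t * s \<le> 1 * a" using t s by (intro mult_mono) (auto simp: b_def)
        then show "t * s \<le> a" by simp
      qed
    qed (auto intro!: continuous_intros)
  qed (use \<Gamma>(2) in auto)
  then show ?thesis using a r(1) by (intro bexI[of _ b]) (auto simp: b_def)
qed

section \<open>Reduction of the cocycle to its product\<close>

lemma cocycle_prod_mem:
  assumes "\<And>X Y. X \<in> G \<Longrightarrow> Y \<in> G \<Longrightarrow> X * Y \<in> G" "\<And>i. A i \<in> G" "1\<^sub>m d \<in> G"
  shows "cocycle_prod d A n \<in> G"
  by (induction n) (use assms in auto)

lemma cocycle_prod_cong:
  "(\<And>i. 1 \<le> i \<Longrightarrow> i \<le> int n \<Longrightarrow> A i = B i) \<Longrightarrow> cocycle_prod d A n = cocycle_prod d B n"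
  by (induction n) auto

lemma periodic_cocycle_multiple:
  assumes "\<And>i. A (i + int l) = A i" "int l dvd i"
  shows "A i = A (int l)"
proof -
  have step: "A (i + int k * int l) = A i" for i k
  proof (induction k)
    case (Suc k)
    have "A (i + int (Suc k) * int l) = A ((i + int k * int l) + int l)"
      by (simp add: algebra_simps)
    with Suc show ?case using assms(1) by simp
  qed simp
  from assms(2) obtain q where q: "i = int l * q" by blast
  show ?thesis
  proof (cases "q \<ge> 1")
    case True
    then show ?thesis using step[of "int l" "nat (q - 1)"] by (simp add: q algebra_simps)
  next
    case False
    then show ?thesis using step[of i "nat (1 - q)"] by (simp add: q algebra_simps)
  qed
qed

text \<open>Only the factors whose index is a multiple of the period are changed, from \<open>L = A\<^sub>l\<close> to
\<open>\<gamma>(t) M\<^sup>-\<^sup>1 L\<close>. One such factor occurs in the product over a period, at its left end, so that the product becomes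
\<open>\<gamma>(t)\<close>.\<close>

lemma perturbation_path_of_deformation:
  fixes A :: "int \<Rightarrow> real mat"
  assumes G: "G \<subseteq> general_linear d" "1\<^sub>m d \<in> G"
      "\<And>X Y. X \<in> G \<Longrightarrow> Y \<in> G \<Longrightarrow> X * Y \<in> G" "\<And>X. X \<in> G \<Longrightarrow> inv_mat X \<in> G"
    and A: "periodic_cocycle G l A" and e: "\<epsilon> > 0" and HG: "H \<subseteq> G"
    and near: "\<And>e. e > 0 \<Longrightarrow> \<exists>K. deformable d H e (cocycle_prod d A l) K \<and> good K"
  shows "\<exists>P. perturbation_path G l \<epsilon> A P \<and> good (cocycle_prod d (P 1) l) \<and>
             (\<forall>t\<in>{0..1}. cocycle_prod d (P t) l \<in> H)"
proof -
  from A have l: "l \<ge> 1" and AG: "\<And>i. A i \<in> G" and per: "\<And>i. A (i + int l) = A i"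
    by (auto simp: periodic_cocycle_def)
  have det0: "det X \<noteq> 0" and car: "X \<in> carrier_mat d d" if "X \<in> G" for X
    using that G(1) invertible_mat_iff_det[of X d] by (auto simp: general_linear_def)
  define M where "M = cocycle_prod d A l"
  define L where "L = A (int l)"
  have MG: "M \<in> G" unfolding M_def by (rule cocycle_prod_mem) (use G AG in auto)
  have LG: "L \<in> G" unfolding L_def by (rule AG)
  define C where "C = inv_mat M * L"
  have CG: "C \<in> G" unfolding C_def using G MG LG by auto
  note cM = car[OF MG] and cL = car[OF LG] and cC = car[OF CG]
  note iM = inv_mat_correct[OF cM det0[OF MG]]
  have MC: "M * C = L"
    unfolding C_def using cM cL iM by (simp flip: assoc_mult_mat[of _ d d _ d _ d])
  obtain \<delta> where \<delta>: "\<delta> > 0" "\<And>B. B \<in> carrier_mat d d \<Longrightarrow> det B \<noteq> 0 \<Longrightarrow>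
      entry_norm (B - L) < \<delta> \<Longrightarrow> entry_norm (inv_mat L - inv_mat B) < \<epsilon>"
    using inv_mat_close[OF cL det0[OF LG] e] by blast
  \<comment> \<open>The changed factor is \<open>\<gamma>(t) C\<close>, so distances grow at most by the factor \<open>c\<close>.\<close>
  define c where "c = entry_norm C + 1"
  have c: "c > 0" unfolding c_def by (rule add_nonneg_pos) auto
  have "min \<delta> \<epsilon> / c > 0" using \<delta>(1) e c by auto
  from near[OF this, folded M_def] obtain K
    where K: "deformable d H (min \<delta> \<epsilon> / c) M K" "good K" by blast
  from K(1) obtain \<gamma> where \<gamma>: "\<And>t. t \<in> {0..1} \<Longrightarrow> \<gamma> t \<in> H"
      "\<And>t. t \<in> {0..1} \<Longrightarrow> entry_norm (\<gamma> t - M) < min \<delta> \<epsilon> / c"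
      "\<And>i j. i < d \<Longrightarrow> j < d \<Longrightarrow> continuous_on {0..1::real} (\<lambda>t. \<gamma> t $$ (i,j))" "\<gamma> 0 = M" "\<gamma> 1 = K"
    by (erule deformableE)
  define P where "P t i = (if int l dvd i then \<gamma> t * C else A i)" for t :: real and i
  have \<gamma>G: "\<gamma> t \<in> G" if "t \<in> {0..1}" for t using \<gamma>(1)[OF that] HG by auto
  have \<gamma>c: "\<gamma> t \<in> carrier_mat d d" if "t \<in> {0..1}" for t using car[OF \<gamma>G[OF that]] .
  have AL: "A i = L" if "int l dvd i" for i
    unfolding L_def using per that by (rule periodic_cocycle_multiple[where A = A])
  have prod: "cocycle_prod d (P t) l = \<gamma> t" if t: "t \<in> {0..1}" for t
  proof -
    obtain n where n: "l = Suc n" using l by (cases l) auto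
    define R where "R = cocycle_prod d A n"
    have R: "R \<in> carrier_mat d d"
      using car[OF cocycle_prod_mem[of G A d n]] G AG by (auto simp: R_def)
    have "cocycle_prod d (P t) n = R"
      unfolding R_def by (rule cocycle_prod_cong) (auto simp: P_def n dest: zdvd_imp_le)
    then have "cocycle_prod d (P t) l = (\<gamma> t * C) * R" by (simp add: n P_def)
    also have "\<dots> = \<gamma> t * (inv_mat M * (L * R))"
      unfolding C_def using \<gamma>c[OF t] iM cL R by (simp add: assoc_mult_mat[of _ d d _ d _ d])
    also have "L * R = M" by (simp add: L_def M_def R_def n)
    also have "\<gamma> t * (inv_mat M * M) = \<gamma> t" using iM \<gamma>c[OF t] by simp
    finally show ?thesis .
  qed
  have diff_le: "entry_norm (P s i - P t i) \<le> entry_norm (\<gamma> s - \<gamma> t) * c"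
    if st: "s \<in> {0..1}" "t \<in> {0..1}" for s t i
  proof (cases "int l dvd i")
    case True
    have "P s i - P t i = (\<gamma> s - \<gamma> t) * C"
      using True \<gamma>c[OF st(1)] \<gamma>c[OF st(2)] cC by (simp add: P_def minus_mult_distrib_mat[of _ d d])
    also have "entry_norm \<dots> \<le> entry_norm (\<gamma> s - \<gamma> t) * entry_norm C"
      by (rule entry_norm_mult_le[of _ d d _ d]) (use \<gamma>c[OF st(2)] cC in \<open>auto simp: minus_carrier_mat\<close>)
    also have "\<dots> \<le> entry_norm (\<gamma> s - \<gamma> t) * c" by (intro mult_left_mono) (auto simp: c_def)
    finally show ?thesis .
  next
    case False
    have "A i - A i = 0\<^sub>m d d" using car[OF AG[of i]] by auto
    then show ?thesis using c False by (simp add: P_def)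
  qed
  have P0: "P 0 i = A i" for i using AL[of i] MC by (simp add: P_def \<gamma>(4))
  have PG: "P t i \<in> G" if "t \<in> {0..1}" for t i using \<gamma>G[OF that] CG AG G by (simp add: P_def)
  have "perturbation_path G l \<epsilon> A P"
    unfolding perturbation_path_def
  proof (intro conjI allI ballI)
    fix t :: real assume "t \<in> {0..1}"
    then show "periodic_cocycle G l (P t)"
      using l PG per by (auto simp: periodic_cocycle_def P_def)
  next
    fix i t assume t: "t \<in> {0..1::real}"
    have b: "((\<lambda>s. entry_norm (\<gamma> s - \<gamma> t) * c) \<longlongrightarrow> 0) (at t within {0..1})"
      by (rule tendsto_mult_left_zero, rule entry_norm_diff_tendsto[OF \<gamma>c \<gamma>(3) t])
    show "((\<lambda>s. op_norm (P s i - P t i)) \<longlongrightarrow> 0) (at t within {0..1})"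
    proof (rule tendsto_sandwich[OF _ _ tendsto_const b])
      show "\<forall>\<^sub>F s in at t within {0..1}. 0 \<le> op_norm (P s i - P t i)"
        unfolding eventually_at_filter
        by (rule always_eventually)
           (use car[OF PG[OF t]] in \<open>auto intro!: op_norm_le_entry_norm(1)[of _ d d] minus_carrier_mat\<close>)
      show "\<forall>\<^sub>F s in at t within {0..1}. op_norm (P s i - P t i) \<le> entry_norm (\<gamma> s - \<gamma> t) * c"
        unfolding eventually_at_filter
      proof (rule always_eventually, intro allI impI)
        fix s :: real assume s: "s \<in> {0..1}"
        show "op_norm (P s i - P t i) \<le> entry_norm (\<gamma> s - \<gamma> t) * c"
          using op_norm_le_entry_norm(2)[of "P s i - P t i" d d] diff_le[OF s t, of i]
            car[OF PG[OF s]] car[OF PG[OF t]] by (force simp: minus_carrier_mat)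
      qed
    qed
  next
    fix i show "P 0 i = A i" by (rule P0)
  next
    fix i t assume t: "t \<in> {0..1::real}"
    note cP = car[OF PG[OF t, of i]] det0[OF PG[OF t, of i]]
    have cA: "A i \<in> carrier_mat d d" "det (A i) \<noteq> 0" using car[OF AG] det0[OF AG] by auto
    have z: "(0::real) \<in> {0..1}" by simp
    have "entry_norm (P t i - A i) \<le> entry_norm (\<gamma> t - M) * c"
      using diff_le[OF t z, of i] by (simp add: P0 \<gamma>(4))
    also have "\<dots> < min \<delta> \<epsilon>" using \<gamma>(2)[OF t] c by (simp add: pos_less_divide_eq)
    finally have 1: "entry_norm (P t i - A i) < min \<delta> \<epsilon>" .
    then have "op_norm (A i - P t i) < \<epsilon>"
      using op_norm_le_entry_norm(2)[of "A i - P t i" d d] cP cA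
        entry_norm_minus_commute[of "A i" d d "P t i"] by (auto simp: minus_carrier_mat)
    moreover have "entry_norm (inv_mat (A i) - inv_mat (P t i)) < \<epsilon>"
    proof (cases "int l dvd i")
      case True
      then show ?thesis using \<delta>(2)[OF cP] 1 AL by simp
    next
      case False
      have "inv_mat (A i) - inv_mat (A i) = 0\<^sub>m d d" using inv_mat_correct[OF cA] by auto
      then show ?thesis using False e by (simp add: P_def)
    qed
    then have "op_norm (inv_mat (A i) - inv_mat (P t i)) < \<epsilon>"
      using op_norm_le_entry_norm(2)[of "inv_mat (A i) - inv_mat (P t i)" d d]
        inv_mat_correct[OF cA] inv_mat_correct[OF cP] by (force simp: minus_carrier_mat)
    ultimately show "max (op_norm (A i - P t i)) (op_norm (inv_mat (A i) - inv_mat (P t i))) < \<epsilon>"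
      by simp
  qed
  then show ?thesis using prod \<gamma>(1) \<gamma>(5) K(2) by (intro exI[of _ P]) auto
qed

section \<open>Block form on an invariant plane\<close>

text \<open>The identity matrix with column \<open>q\<close> replaced by \<open>z\<close> has determinant \<open>z\<^sub>q\<close>; exchanging the columns
\<open>k\<close> and \<open>q\<close> puts \<open>z\<close> in place and leaves the columns before \<open>k\<close> alone, since \<open>k \<le> q\<close>.\<close>

lemma ex_invertible_with_column:
  fixes z :: "real vec"
  assumes z: "z \<in> carrier_vec n" and q: "k \<le> q" "q < n" "z $ q \<noteq> 0"
  shows "\<exists>S\<in>carrier_mat n n. det S \<noteq> 0 \<and> col S k = z \<and> (\<forall>j<k. col S j = unit_vec n j)"
proof -
  define R where "R = replace_col (1\<^sub>m n) z q"
  have R: "R \<in> carrier_mat n n" by (simp add: R_def replace_col_def)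
  have dR: "det R \<noteq> 0"
    using cramer_lemma_mat[of "1\<^sub>m n" n z q] z q by (simp add: R_def)
  define S where "S = (if k = q then R else swapcols k q R)"
  have "det S \<noteq> 0" using det_swapcols[of k n q R] dR q R by (auto simp: S_def)
  moreover have "col S k = z"
    using z q by (intro eq_vecI) (auto simp: S_def R_def replace_col_def)
  moreover have "col S j = unit_vec n j" if "j < k" for j
    using that q by (intro eq_vecI) (auto simp: S_def R_def replace_col_def unit_vec_def)
  ultimately show ?thesis using R by (intro bexI[of _ S]) (auto simp: S_def)
qed

lemma mult_mat_vec_unit:
  assumes "(A :: 'a :: semiring_1 mat) \<in> carrier_mat n m" "j < m"
  shows "A *\<^sub>v unit_vec m j = col A j"
  using assms by (intro eq_vecI) auto

lemma col_mult3:
  fixes A B C :: "'a :: semiring_1 mat"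
  assumes A: "A \<in> carrier_mat n n" and B: "B \<in> carrier_mat n n" and C: "C \<in> carrier_mat n n" and j: "j < n"
  shows "col (A * B * C) j = A *\<^sub>v (B *\<^sub>v col C j)"
proof -
  have c: "col C j \<in> carrier_vec n" using col_dim[of C j] C by (simp only: carrier_matD(1))
  have "col (A * B * C) j = (A * B) *\<^sub>v col C j" by (rule col_mult2[OF mult_carrier_mat[OF A B] C j])
  also have "\<dots> = A *\<^sub>v (B *\<^sub>v col C j)" by (rule assoc_mult_mat_vec[OF A B c])
  finally show ?thesis .
qed

lemma inv_mat_mult_vec:
  assumes S: "S \<in> carrier_mat n n" "det S \<noteq> 0" and v: "v \<in> carrier_vec n"
  shows "inv_mat S *\<^sub>v (S *\<^sub>v v) = v" "S *\<^sub>v (inv_mat S *\<^sub>v v) = v"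
  using inv_mat_correct[OF S] S v by (simp_all flip: assoc_mult_mat_vec[of _ n n _ n])

text \<open>One column at a time: in coordinates where \<open>x\<close> is the first basis vector, \<open>y\<close> has a nonzero later
coordinate, so a second matrix can send the second basis vector to \<open>y\<close> and fix the first one.\<close>

lemma ex_invertible_with_two_columns:
  fixes x y :: "real vec"
  assumes x: "x \<in> carrier_vec n" "x \<noteq> 0\<^sub>v n" and y: "y \<in> carrier_vec n"
    and indep: "\<And>c. y \<noteq> c \<cdot>\<^sub>v x"
  shows "n \<ge> 2 \<and> (\<exists>S\<in>carrier_mat n n. det S \<noteq> 0 \<and> col S 0 = x \<and> col S 1 = y)"
proof -
  obtain p where p: "p < n" "x $ p \<noteq> 0" using x by (metis eq_vecI carrier_vecD index_zero_vec)
  obtain S1 where S1: "S1 \<in> carrier_mat n n" "det S1 \<noteq> 0" "col S1 0 = x"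
    using ex_invertible_with_column[OF x(1) _ p, of 0] by auto
  note i1 = inv_mat_correct[OF S1(1,2)]
  define z where "z = inv_mat S1 *\<^sub>v y"
  have z: "z \<in> carrier_vec n" "S1 *\<^sub>v z = y"
    using inv_mat_mult_vec[OF S1(1,2) y] i1 y by (auto simp: z_def)
  have "\<exists>q. 1 \<le> q \<and> q < n \<and> z $ q \<noteq> 0"
  proof (rule ccontr)
    assume a: "\<nexists>q. 1 \<le> q \<and> q < n \<and> z $ q \<noteq> 0"
    have "z = z $ 0 \<cdot>\<^sub>v unit_vec n 0"
    proof (rule eq_vecI)
      fix i assume "i < dim_vec (z $ 0 \<cdot>\<^sub>v unit_vec n 0)"
      then show "z $ i = (z $ 0 \<cdot>\<^sub>v unit_vec n 0) $ i"
        using a p by (cases "i = 0") (auto simp: unit_vec_def)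
    qed (use z in auto)
    then have "y = S1 *\<^sub>v (z $ 0 \<cdot>\<^sub>v unit_vec n 0)" using z(2) by simp
    also have "\<dots> = z $ 0 \<cdot>\<^sub>v x"
      using S1 p by (simp add: mult_mat_vec[of _ n n] mult_mat_vec_unit[of _ n n])
    finally show False using indep by blast
  qed
  then obtain q where q: "1 \<le> q" "q < n" "z $ q \<noteq> 0" by blast
  obtain S2 where S2: "S2 \<in> carrier_mat n n" "det S2 \<noteq> 0" "col S2 1 = z" "col S2 0 = unit_vec n 0"
    using ex_invertible_with_column[OF z(1) q] by auto
  have "col (S1 * S2) 0 = x" "col (S1 * S2) 1 = y"
    using S1 S2 q z(2) by (auto simp: col_mult2[of _ n n _ n] mult_mat_vec_unit[of _ n n])
  moreover have "det (S1 * S2) \<noteq> 0" using det_mult[OF S1(1) S2(1)] S1 S2 by simp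
  ultimately show ?thesis using S1(1) S2(1) q
    by (intro conjI bexI[of _ "S1 * S2"]) auto
qed

lemma block_upper_triangular:
  assumes N: "N \<in> carrier_mat (k + m) (k + m)"
    and z: "\<And>i j. k \<le> i \<Longrightarrow> i < k + m \<Longrightarrow> j < k \<Longrightarrow> N $$ (i,j) = 0"
  shows "N = four_block_mat (mat k k (\<lambda>(i,j). N $$ (i,j))) (mat k m (\<lambda>(i,j). N $$ (i,j + k)))
               (0\<^sub>m m k) (mat m m (\<lambda>(i,j). N $$ (i + k,j + k)))"
  using assms by (intro eq_matI) auto

lemma char_poly_four_block_upper:
  assumes A: "(A :: 'a :: idom mat) \<in> carrier_mat k k" and B: "B \<in> carrier_mat k m"
    and D: "D \<in> carrier_mat m m"
  shows "char_poly (four_block_mat A B (0\<^sub>m m k) D) = char_poly A * char_poly D"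
proof -
  let ?cm = "\<lambda>A. [:0, 1:] \<cdot>\<^sub>m 1\<^sub>m (dim_row A) + map_mat (\<lambda>a. [:- a:]) A"
  have "?cm (four_block_mat A B (0\<^sub>m m k) D) =
      four_block_mat (?cm A) (map_mat (\<lambda>a. [:- a:]) B) (0\<^sub>m m k) (?cm D)"
    by (rule eq_matI) (use A B D in \<open>auto simp: one_poly_def\<close>)
  moreover have "det (four_block_mat (?cm A) (map_mat (\<lambda>a. [:- a:]) B) (0\<^sub>m m k) (?cm D)) =
      det (?cm A) * det (?cm D)"
    by (rule det_four_block_mat_lower_left_zero[of _ k _ m]) (use A B D in auto)
  ultimately show ?thesis unfolding char_poly_defs using A D by simp
qed

lemma det_2:
  assumes A: "(A :: 'a :: comm_ring_1 mat) \<in> carrier_mat 2 2"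
  shows "det A = A $$ (0,0) * A $$ (1,1) - A $$ (0,1) * A $$ (1,0)"
proof -
  have d: "det (mat_delete A i 0) = A $$ (1 - i, 1)" if "i < 2" for i
  proof -
    have "mat_delete A i 0 \<in> carrier_mat 1 1" using A that by (auto simp: mat_delete_def)
    then show ?thesis using A that by (subst det_single) (auto simp: mat_delete_def less_2_cases_iff)
  qed
  have "det A = (\<Sum>i<2. A $$ (i,0) * cofactor A i 0)"
    by (rule laplace_expansion_column[OF A]) auto
  also have "\<dots> = A $$ (0,0) * A $$ (1,1) - A $$ (0,1) * A $$ (1,0)"
    using d by (simp add: numeral_2_eq_2 cofactor_def algebra_simps)
  finally show ?thesis .
qed

lemma char_poly_2:
  assumes A: "(A :: 'a :: comm_ring_1 mat) \<in> carrier_mat 2 2"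
  shows "char_poly A = [:A $$ (0,0) * A $$ (1,1) - A $$ (0,1) * A $$ (1,0), - (A $$ (0,0) + A $$ (1,1)), 1:]"
proof -
  have "char_poly_matrix A \<in> carrier_mat 2 2" using A by simp
  then show ?thesis
    unfolding char_poly_def by (subst det_2) (use A in \<open>auto simp: char_poly_matrix_def\<close>)
qed

lemma char_poly_complexify:
  "A \<in> carrier_mat n n \<Longrightarrow>
    char_poly (map_mat complex_of_real A) = map_poly complex_of_real (char_poly A)"
  by (rule of_real_hom.char_poly_hom)

lemma det_conjugate:
  assumes "S \<in> carrier_mat n n" "F \<in> carrier_mat n n" "T \<in> carrier_mat n n" "S * T = (1\<^sub>m n :: real mat)"
  shows "det (S * F * T) = det F"
proof -
  have "det S * det T = 1" using det_mult[of S n T] assms by simp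
  then show ?thesis using assms by (simp add: det_mult[of _ n])
qed

lemma char_poly_conjugate:
  assumes "S \<in> carrier_mat n n" "F \<in> carrier_mat n n" "T \<in> carrier_mat n n"
    "S * T = (1\<^sub>m n :: real mat)" "T * S = 1\<^sub>m n"
  shows "char_poly (S * F * T) = char_poly F"
proof (rule char_poly_similar)
  have "similar_mat_wit (S * F * T) F S T"
    using assms by (auto simp: similar_mat_wit_def Let_def)
  then show "similar_mat (S * F * T) F" unfolding similar_mat_def by blast
qed

lemma mult_inverse_cancel:
  assumes "S * T = (1\<^sub>m n :: 'a :: semiring_1 mat)" "S \<in> carrier_mat n n" "T \<in> carrier_mat n n" "X \<in> carrier_mat n m"
  shows "S * (T * X) = X"
  using assms assoc_mult_mat[of S n n T n X m] by simp

text \<open>Completing \<open>x, y\<close> to a basis makes \<open>M\<close> block triangular. Any other \<open>2 \<times> 2\<close> block can then be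
substituted for \<open>B\<close>, and the characteristic polynomial changes only in the factor of \<open>B\<close>.\<close>

lemma ex_invariant_plane_form:
  fixes x y :: "real vec"
  assumes M: "M \<in> carrier_mat n n" and x: "x \<in> carrier_vec n" "x \<noteq> 0\<^sub>v n" and y: "y \<in> carrier_vec n"
    and indep: "\<And>c. y \<noteq> c \<cdot>\<^sub>v x"
    and Mx: "M *\<^sub>v x = a \<cdot>\<^sub>v x + e \<cdot>\<^sub>v y" and My: "M *\<^sub>v y = c \<cdot>\<^sub>v x + a' \<cdot>\<^sub>v y"
  shows "\<exists>m S T B C E. n = 2 + m \<and> S \<in> carrier_mat n n \<and> T \<in> carrier_mat n n \<and>
     S * T = 1\<^sub>m n \<and> T * S = 1\<^sub>m n \<and> B \<in> carrier_mat 2 2 \<and> C \<in> carrier_mat 2 m \<and> E \<in> carrier_mat m m \<and>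
     B $$ (0,0) = a \<and> B $$ (1,0) = e \<and> B $$ (0,1) = c \<and> B $$ (1,1) = a' \<and>
     M = S * four_block_mat B C (0\<^sub>m m 2) E * T"
proof -
  obtain S where n: "n \<ge> 2" and S: "S \<in> carrier_mat n n" "det S \<noteq> 0" "col S 0 = x" "col S 1 = y"
    using ex_invertible_with_two_columns[OF x y indep] by blast
  define T where "T = inv_mat S"
  note T = inv_mat_correct[OF S(1,2), folded T_def]
  define N where "N = T * M * S"
  have N: "N \<in> carrier_mat n n" using T S M by (simp add: N_def)
  have Tx: "T *\<^sub>v x = unit_vec n 0" "T *\<^sub>v y = unit_vec n 1"
    using inv_mat_mult_vec(1)[OF S(1,2), of "unit_vec n 0"]
      inv_mat_mult_vec(1)[OF S(1,2), of "unit_vec n 1"] S n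
    by (auto simp: mult_mat_vec_unit[of _ n n] T_def)
  have colN: "col N j = T *\<^sub>v (M *\<^sub>v col S j)" if "j < n" for j
    unfolding N_def by (rule col_mult3[OF T(1) M S(1) that])
  have c0: "col N 0 = a \<cdot>\<^sub>v unit_vec n 0 + e \<cdot>\<^sub>v unit_vec n 1"
    using colN[of 0] n S T x y
    by (simp add: Mx mult_add_distrib_mat_vec[of _ n n] mult_mat_vec[of _ n n] Tx)
  have c1: "col N 1 = c \<cdot>\<^sub>v unit_vec n 0 + a' \<cdot>\<^sub>v unit_vec n 1"
    using colN[of 1] n S T x y
    by (simp add: My mult_add_distrib_mat_vec[of _ n n] mult_mat_vec[of _ n n] Tx)
  have e0: "N $$ (i,0) = a * of_bool (i = 0) + e * of_bool (i = 1)" if "i < n" for i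
    using arg_cong[OF c0, of "\<lambda>v. v $ i"] that n N by (auto simp: unit_vec_def split: if_splits)
  have e1: "N $$ (i,1) = c * of_bool (i = 0) + a' * of_bool (i = 1)" if "i < n" for i
    using arg_cong[OF c1, of "\<lambda>v. v $ i"] that n N by (auto simp: unit_vec_def split: if_splits)
  obtain m where m: "n = 2 + m" using n le_Suc_ex by blast
  let ?B = "mat 2 2 (\<lambda>(i,j). N $$ (i,j))" and ?C = "mat 2 m (\<lambda>(i,j). N $$ (i,j + 2))"
    and ?E = "mat m m (\<lambda>(i,j). N $$ (i + 2,j + 2))"
  have NB: "N = four_block_mat ?B ?C (0\<^sub>m m 2) ?E"
  proof (rule block_upper_triangular)
    fix i j assume "2 \<le> i" "i < 2 + m" "j < (2::nat)"
    then show "N $$ (i,j) = 0" using e0[of i] e1[of i] m by (auto simp: less_2_cases_iff)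
  qed (use N m in simp)
  have MN: "M = S * N * T"
    using S T M by (simp add: N_def mult_inverse_cancel[OF T(2) S(1) T(1), where m = n])
  show ?thesis
    by (rule exI[of _ m], rule exI[of _ S], rule exI[of _ T], rule exI[of _ ?B],
        rule exI[of _ ?C], rule exI[of _ ?E])
       (use m S T MN NB e0[of 0] e0[of 1] e1[of 0] e1[of 1] in auto)
qed

lemma map_mat_of_real_mult_vec:
  assumes "A \<in> carrier_mat n m" "v \<in> carrier_vec m"
  shows "map_vec Re (map_mat complex_of_real A *\<^sub>v v) = A *\<^sub>v map_vec Re v"
    and "map_vec Im (map_mat complex_of_real A *\<^sub>v v) = A *\<^sub>v map_vec Im v"
  using assms by (auto intro!: eq_vecI sum.cong simp: scalar_prod_def)

lemma eigenvalue_iff_root: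
  assumes M: "M \<in> carrier_mat n n"
  shows "z \<in> complex_eigenvalues M \<longleftrightarrow> poly (map_poly complex_of_real (char_poly M)) z = 0"
  using spectrum_root_char_poly[of "map_mat complex_of_real M" n] M
  by (simp add: complex_eigenvalues_def char_poly_complexify)

text \<open>The plane is spanned by the real and the imaginary part of a complex eigenvector. They are linearly
independent, because otherwise \<open>M\<close> would have a real eigenvector with a nonreal eigenvalue.\<close>

lemma invariant_plane_nonreal:
  assumes M: "M \<in> carrier_mat n n" and l: "l \<in> complex_eigenvalues M" "Im l \<noteq> 0"
  shows "\<exists>x y. x \<in> carrier_vec n \<and> x \<noteq> 0\<^sub>v n \<and> y \<in> carrier_vec n \<and> (\<forall>c. y \<noteq> c \<cdot>\<^sub>v x) \<and>
     M *\<^sub>v x = Re l \<cdot>\<^sub>v x + - Im l \<cdot>\<^sub>v y \<and> M *\<^sub>v y = Im l \<cdot>\<^sub>v x + Re l \<cdot>\<^sub>v y"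
proof -
  from l(1) obtain v where v: "v \<in> carrier_vec n" "v \<noteq> 0\<^sub>v n"
      "map_mat complex_of_real M *\<^sub>v v = l \<cdot>\<^sub>v v"
    using M by (auto simp: complex_eigenvalues_def spectrum_def eigenvalue_def eigenvector_def)
  define x where "x = map_vec Re v"
  define y where "y = map_vec Im v"
  have x: "x \<in> carrier_vec n" and y: "y \<in> carrier_vec n" using v by (auto simp: x_def y_def)
  have Mx: "M *\<^sub>v x = Re l \<cdot>\<^sub>v x + - Im l \<cdot>\<^sub>v y"
    unfolding x_def map_mat_of_real_mult_vec(1)[OF M v(1), symmetric] v(3)
    by (rule eq_vecI) (use v(1) in \<open>auto simp: x_def y_def\<close>)
  have My: "M *\<^sub>v y = Im l \<cdot>\<^sub>v x + Re l \<cdot>\<^sub>v y"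
    unfolding y_def map_mat_of_real_mult_vec(2)[OF M v(1), symmetric] v(3)
    by (rule eq_vecI) (use v(1) in \<open>auto simp: x_def y_def\<close>)
  have x0: "x \<noteq> 0\<^sub>v n"
  proof
    assume a: "x = 0\<^sub>v n"
    have "y $ i = 0" if "i < n" for i
      using arg_cong[OF Mx, of "\<lambda>w. w $ i"] that y l(2) M unfolding a by simp
    moreover have "x $ i = 0" if "i < n" for i using a that by simp
    ultimately have "v = 0\<^sub>v n" using v(1)
      by (intro eq_vecI) (auto simp: x_def y_def complex_eq_iff)
    with v(2) show False by simp
  qed
  have "y \<noteq> c \<cdot>\<^sub>v x" for c
  proof
    assume c: "y = c \<cdot>\<^sub>v x"
    have "x $ i = 0" if i: "i < n" for i
    proof -
      have "M *\<^sub>v y = c \<cdot>\<^sub>v (M *\<^sub>v x)" using M x by (simp add: c mult_mat_vec[of _ n n])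
      from arg_cong[OF this, of "\<lambda>w. w $ i"]
      have "Im l * x $ i + Re l * (c * x $ i) = c * (Re l * x $ i - Im l * (c * x $ i))"
        unfolding Mx My using i x by (simp add: c)
      then have "Im l * (1 + c * c) * x $ i = 0" by (simp add: algebra_simps)
      moreover have "1 + c * c \<noteq> 0" using zero_le_square[of c] by linarith
      ultimately show ?thesis using l(2) by simp
    qed
    then show False using x x0 by (auto intro!: eq_vecI)
  qed
  with x y x0 Mx My show ?thesis by blast
qed

lemma order_mult_linear:
  assumes "p \<noteq> (0 :: 'a :: idom poly)"
  shows "order a ([:-a, 1:] * p) = Suc (order a p)"
proof -
  have "[:-a, 1:] * p \<noteq> 0" using assms by (metis mult_eq_0_iff one_neq_zero pCons_eq_0_iff)
  then show ?thesis using order_mult[of "[:-a, 1:]" p a] order_power_n_n[of a 1] by simp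
qed

lemma map_poly_of_real_mult:
  "map_poly complex_of_real (p * q) = map_poly complex_of_real p * map_poly complex_of_real q"
proof -
  interpret map_poly_comm_ring_hom "of_real :: real \<Rightarrow> complex" ..
  show ?thesis by (rule hom_mult)
qed

text \<open>Deflation: splitting off one eigenvector leaves a quotient matrix \<open>E\<close>, whose characteristic
polynomial still vanishes at \<open>a\<close> because the root is multiple. An eigenvector of \<open>E\<close>, lifted back, is
the second basis vector of the plane. The coefficient \<open>c\<close> is zero exactly when the lift is an eigenvector
itself.\<close>

lemma invariant_plane_real:
  assumes M: "M \<in> carrier_mat n n"
    and l: "order (complex_of_real a) (map_poly complex_of_real (char_poly M)) \<ge> 2"
  shows "\<exists>x y c. x \<in> carrier_vec n \<and> x \<noteq> 0\<^sub>v n \<and> y \<in> carrier_vec n \<and> (\<forall>c. y \<noteq> c \<cdot>\<^sub>v x) \<and>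
     M *\<^sub>v x = a \<cdot>\<^sub>v x + 0 \<cdot>\<^sub>v y \<and> M *\<^sub>v y = c \<cdot>\<^sub>v x + a \<cdot>\<^sub>v y"
proof -
  have "poly (map_poly complex_of_real (char_poly M)) (complex_of_real a) = 0"
    using l order_0I[of "map_poly complex_of_real (char_poly M)" "complex_of_real a"] by fastforce
  then have "poly (char_poly M) a = 0" by simp
  then have "eigenvalue M a" using eigenvalue_root_char_poly[OF M] by simp
  then obtain x where x: "x \<in> carrier_vec n" "x \<noteq> 0\<^sub>v n" "M *\<^sub>v x = a \<cdot>\<^sub>v x"
    using M by (auto simp: eigenvalue_def eigenvector_def)
  obtain p where p: "p < n" "x $ p \<noteq> 0" using x by (metis eq_vecI carrier_vecD index_zero_vec)
  obtain S where S: "S \<in> carrier_mat n n" "det S \<noteq> 0" "col S 0 = x"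
    using ex_invertible_with_column[OF x(1) _ p, of 0] by auto
  define T where "T = inv_mat S"
  note T = inv_mat_correct[OF S(1,2), folded T_def]
  have Tx: "T *\<^sub>v x = unit_vec n 0"
    using inv_mat_mult_vec(1)[OF S(1,2), of "unit_vec n 0"] S p
    by (auto simp: mult_mat_vec_unit[of _ n n] T_def)
  define N where "N = T * M * S"
  have N: "N \<in> carrier_mat n n" using T S M by (simp add: N_def)
  have "col N 0 = T *\<^sub>v (M *\<^sub>v x)"
    using col_mult3[OF T(1) M S(1), of 0] p S(3) by (simp only: N_def)
  also have "\<dots> = a \<cdot>\<^sub>v unit_vec n 0" using T x by (simp add: x(3) mult_mat_vec[of _ n n] Tx)
  finally have c0: "col N 0 = a \<cdot>\<^sub>v unit_vec n 0" .
  have e0: "N $$ (i,0) = a * of_bool (i = 0)" if "i < n" for i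
    using arg_cong[OF c0, of "\<lambda>v. v $ i"] that N by (auto simp: unit_vec_def split: if_splits)
  obtain m where m: "n = 1 + m" using p by (cases n) auto
  let ?B = "mat 1 1 (\<lambda>(i,j). N $$ (i,j))" and ?C = "mat 1 m (\<lambda>(i,j). N $$ (i,j + 1))"
  define E where "E = mat m m (\<lambda>(i,j). N $$ (i + 1,j + 1))"
  have NB: "N = four_block_mat ?B ?C (0\<^sub>m m 1) E"
    unfolding E_def
  proof (rule block_upper_triangular)
    fix i j assume "1 \<le> i" "i < 1 + m" "j < (1::nat)"
    then show "N $$ (i,j) = 0" using e0[of i] m by auto
  qed (use N m in simp)
  have MN: "M = S * N * T"
    using S T M by (simp add: N_def mult_inverse_cancel[OF T(2) S(1) T(1), where m = n])
  have "char_poly M = char_poly N"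
    using char_poly_conjugate[of S n N T] S T N by (simp add: MN[symmetric])
  also have "\<dots> = char_poly ?B * char_poly E"
    by (subst NB) (rule char_poly_four_block_upper, auto simp: E_def)
  also have "char_poly ?B = [:-a, 1:]"
    using e0[of 0] p by (simp add: char_poly_def char_poly_matrix_def det_single)
  finally have "char_poly M = [:-a, 1:] * char_poly E" .
  then have "map_poly complex_of_real (char_poly M) =
      [:- complex_of_real a, 1:] * map_poly complex_of_real (char_poly E)"
    by (simp only: map_poly_of_real_mult) simp
  moreover have nz: "map_poly complex_of_real (char_poly E) \<noteq> 0"
    using degree_monic_char_poly[of E m] by (auto simp: E_def)
  ultimately have "order (complex_of_real a) (map_poly complex_of_real (char_poly E)) \<noteq> 0"
    using l order_mult_linear[OF nz, of "complex_of_real a"] by simp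
  then have "poly (char_poly E) a = 0"
    using order_root[of "map_poly complex_of_real (char_poly E)" "complex_of_real a"] by simp
  then have "eigenvalue E a" using eigenvalue_root_char_poly[of E m] by (simp add: E_def)
  then obtain u where u: "u \<in> carrier_vec m" "u \<noteq> 0\<^sub>v m" "E *\<^sub>v u = a \<cdot>\<^sub>v u"
    by (auto simp: eigenvalue_def eigenvector_def E_def)
  define z where "z = 0\<^sub>v 1 @\<^sub>v u"
  have z: "z \<in> carrier_vec n" unfolding z_def m using u(1) by (intro append_carrier_vec) auto
  define c where "c = (?C *\<^sub>v u) $ 0"
  have Nz: "N *\<^sub>v z = c \<cdot>\<^sub>v unit_vec n 0 + a \<cdot>\<^sub>v z"
  proof -
    have "N *\<^sub>v z = (?B *\<^sub>v 0\<^sub>v 1 + ?C *\<^sub>v u) @\<^sub>v (0\<^sub>m m 1 *\<^sub>v 0\<^sub>v 1 + E *\<^sub>v u)"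
      unfolding z_def by (subst NB, rule four_block_mat_mult_vec) (use u in \<open>auto simp: E_def\<close>)
    also have "\<dots> = c \<cdot>\<^sub>v unit_vec n 0 + a \<cdot>\<^sub>v z"
      using u(1) m by (intro eq_vecI) (auto simp: u(3) z_def c_def unit_vec_def scalar_prod_def)
    finally show ?thesis .
  qed
  define y where "y = S *\<^sub>v z"
  have y: "y \<in> carrier_vec n" using S z by (auto simp: y_def)
  have "M *\<^sub>v y = S *\<^sub>v (N *\<^sub>v (T *\<^sub>v y))"
    using y S T N by (simp add: MN assoc_mult_mat_vec[of _ n n _ n])
  also have "T *\<^sub>v y = z" unfolding y_def T_def by (rule inv_mat_mult_vec[OF S(1,2) z])
  also have "S *\<^sub>v (N *\<^sub>v z) = c \<cdot>\<^sub>v x + a \<cdot>\<^sub>v y"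
    unfolding Nz using S z p
    by (simp add: y_def mult_add_distrib_mat_vec[of _ n n] mult_mat_vec[of _ n n] mult_mat_vec_unit[of _ n n])
  finally have My: "M *\<^sub>v y = c \<cdot>\<^sub>v x + a \<cdot>\<^sub>v y" .
  have "y \<noteq> b \<cdot>\<^sub>v x" for b
  proof
    assume b: "y = b \<cdot>\<^sub>v x"
    have "z = T *\<^sub>v y" unfolding y_def T_def by (rule inv_mat_mult_vec(1)[OF S(1,2) z, symmetric])
    also have "\<dots> = b \<cdot>\<^sub>v unit_vec n 0" unfolding b using T x by (simp add: mult_mat_vec[of _ n n] Tx)
    finally have zb: "z = b \<cdot>\<^sub>v unit_vec n 0" .
    have "u $ i = 0" if "i < m" for i
      using arg_cong[OF zb, of "\<lambda>w. w $ (Suc i)"] that u(1) m by (auto simp: z_def unit_vec_def)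
    then show False using u by (auto intro!: eq_vecI)
  qed
  moreover have "M *\<^sub>v x = a \<cdot>\<^sub>v x + 0 \<cdot>\<^sub>v y" using x y by (auto simp: x(3) intro!: eq_vecI)
  ultimately show ?thesis using x y My by blast
qed

section \<open>Splitting multiple eigenvalues at constant moduli\<close>

text \<open>A real \<open>2 \<times> 2\<close> matrix with the eigenvalues \<open>l cis \<eta>\<close> and its conjugate. Keeping the upper right
entry \<open>c\<close> constant makes this family start at a prescribed block, a Jordan block included; for \<open>c = 0\<close> the
prescribed block is a real multiple of the identity, and the usual rotation serves.\<close>

definition rotated_block :: "complex \<Rightarrow> real \<Rightarrow> real \<Rightarrow> real mat" where
  "rotated_block l c \<eta> = mat 2 2 (\<lambda>(i,j).
     if i = j then Re (l * cis \<eta>)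
     else if i = 0 then (if c = 0 then Im (l * cis \<eta>) else c)
     else (if c = 0 then - Im (l * cis \<eta>) else - (Im (l * cis \<eta>))\<^sup>2 / c))"

lemma rotated_block_carrier [simp]: "rotated_block l c \<eta> \<in> carrier_mat 2 2"
  by (simp add: rotated_block_def)

lemma rotated_block_0:
  assumes "B \<in> carrier_mat 2 2" "B $$ (0,0) = Re l" "B $$ (1,1) = Re l" "B $$ (0,1) = c"
    "B $$ (1,0) * c = - (Im l)\<^sup>2" "c = 0 \<Longrightarrow> B $$ (1,0) = 0"
  shows "rotated_block l c 0 = B"
  using assms by (intro eq_matI) (auto simp: rotated_block_def less_2_cases_iff field_simps)

lemma char_poly_rotated_block:
  "map_poly complex_of_real (char_poly (rotated_block l c \<eta>)) =
     [:- (l * cis \<eta>), 1:] * [:- cnj (l * cis \<eta>), 1:]"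
proof -
  define \<mu> where "\<mu> = l * cis \<eta>"
  have "char_poly (rotated_block l c \<eta>) = [:(Re \<mu>)\<^sup>2 + (Im \<mu>)\<^sup>2, - (2 * Re \<mu>), 1:]"
    by (subst char_poly_2) (auto simp: rotated_block_def \<mu>_def[symmetric] power2_eq_square)
  then show ?thesis
    unfolding \<mu>_def[symmetric]
    by (auto simp: complex_eq_iff power2_eq_square map_poly_pCons)
qed

lemma det_rotated_block: "det (rotated_block l c \<eta>) = (cmod l)\<^sup>2"
proof -
  define \<mu> where "\<mu> = l * cis \<eta>"
  have "det (rotated_block l c \<eta>) = (Re \<mu>)\<^sup>2 + (Im \<mu>)\<^sup>2"
    by (subst det_2) (auto simp: rotated_block_def \<mu>_def[symmetric] power2_eq_square)
  also have "\<dots> = (cmod \<mu>)\<^sup>2" by (rule cmod_power2[symmetric])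
  finally show ?thesis by (simp add: norm_mult \<mu>_def)
qed

lemma continuous_on_rotated_block:
  assumes "i < 2" "j < 2"
  shows "continuous_on T (\<lambda>\<eta>. rotated_block l c \<eta> $$ (i,j))"
  using assms
  by (cases "c = 0"; cases "i = j"; cases "i = 0")
     (auto simp: rotated_block_def divide_inverse intro!: continuous_intros)

definition same_moduli :: "nat \<Rightarrow> real mat \<Rightarrow> real mat set" where
  "same_moduli n M =
     {B \<in> carrier_mat n n. det B = det M \<and> eigenvalue_moduli B = eigenvalue_moduli M}"

lemma eigenvalue_moduli_char_poly:
  "M \<in> carrier_mat n n \<Longrightarrow>
    eigenvalue_moduli M = image_mset cmod (proots (map_poly complex_of_real (char_poly M)))"
  by (simp add: eigenvalue_moduli_def char_poly_complexify)

lemma complex_char_poly_props: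
  assumes "M \<in> carrier_mat n n"
  shows "map_poly complex_of_real (char_poly M) \<noteq> 0"
    "size (proots (map_poly complex_of_real (char_poly M))) = n"
    "set_mset (proots (map_poly complex_of_real (char_poly M))) = complex_eigenvalues M"
    "finite (complex_eigenvalues M)"
proof -
  show nz: "map_poly complex_of_real (char_poly M) \<noteq> 0"
    using degree_monic_char_poly[OF assms] by auto
  show "size (proots (map_poly complex_of_real (char_poly M))) = n"
    using degree_monic_char_poly[OF assms] by (simp add: size_proots_complex)
  show eq: "set_mset (proots (map_poly complex_of_real (char_poly M))) = complex_eigenvalues M"
    using eigenvalue_iff_root[OF assms] set_count_proots[OF nz] by auto
  show "finite (complex_eigenvalues M)" by (metis eq finite_set_mset)
qed

lemma zero_not_eigenvalue:
  assumes M: "M \<in> carrier_mat n n" "det M \<noteq> 0"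
  shows "0 \<notin> complex_eigenvalues M"
proof
  assume "0 \<in> complex_eigenvalues M"
  then obtain v where "v \<in> carrier_vec n" "v \<noteq> 0\<^sub>v n" "map_mat complex_of_real M *\<^sub>v v = 0 \<cdot>\<^sub>v v"
    using M by (auto simp: complex_eigenvalues_def spectrum_def eigenvalue_def eigenvector_def)
  then have "det (map_mat complex_of_real M) = 0"
    using M by (subst det_0_iff_vec_prod_zero[of _ n]) (auto intro!: exI[of _ v])
  then show False using M by (simp add: of_real_hom.hom_det)
qed

lemma ex_multiple_of_small_support:
  assumes "card (set_mset X) < size X"
  shows "\<exists>x. count X x \<ge> 2"
proof (rule ccontr)
  assume "\<nexists>x. count X x \<ge> 2"
  then have "count X x \<le> 1" for x by (metis not_less_eq_eq numeral_2_eq_2 One_nat_def)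
  then have "sum (count X) (set_mset X) \<le> sum (\<lambda>_. 1) (set_mset X)" by (intro sum_mono)
  with assms show False by (simp add: size_multiset_overloaded_eq)
qed

text \<open>Let \<open>l\<close> have multiplicity at least two. Rotating the pair \<open>l, cnj l\<close> of an invariant plane adds
two eigenvalues \<open>\<mu>, cnj \<mu>\<close> and loses at most one: if \<open>l\<close> is not real, then one copy of \<open>l\<close> survives, and if
\<open>l\<close> is real, then \<open>l = cnj l\<close>.\<close>

lemma split_multiple_eigenvalue:
  assumes M: "M \<in> carrier_mat n n" "det M \<noteq> 0" and few: "card (complex_eigenvalues M) < n" and e: "e > 0"
  shows "\<exists>N. deformable n (same_moduli n M) e M N \<and>
             card (complex_eigenvalues M) < card (complex_eigenvalues N)"
proof -
  define p where "p X = map_poly complex_of_real (char_poly X)" for X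
  note pM = complex_char_poly_props[OF M(1), folded p_def]
  obtain l where l: "count (proots (p M)) l \<ge> 2"
    using ex_multiple_of_small_support[of "proots (p M)"] pM few by auto
  then have lM: "l \<in> complex_eigenvalues M" using pM(3) by (metis count_eq_zero_iff not_numeral_le_zero)
  have l0: "l \<noteq> 0" using zero_not_eigenvalue[OF M] lM by auto
  have ord: "order l (p M) \<ge> 2" using l pM(1) by simp
  have "\<exists>x y a c. x \<in> carrier_vec n \<and> x \<noteq> 0\<^sub>v n \<and> y \<in> carrier_vec n \<and> (\<forall>b. y \<noteq> b \<cdot>\<^sub>v x) \<and>
     M *\<^sub>v x = Re l \<cdot>\<^sub>v x + a \<cdot>\<^sub>v y \<and> M *\<^sub>v y = c \<cdot>\<^sub>v x + Re l \<cdot>\<^sub>v y \<and>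
     a * c = - (Im l)\<^sup>2 \<and> (c = 0 \<longrightarrow> a = 0)"
  proof (cases "Im l = 0")
    case True
    then have lr: "complex_of_real (Re l) = l" by (simp add: complex_eq_iff)
    have "order (complex_of_real (Re l)) (map_poly complex_of_real (char_poly M)) \<ge> 2"
      unfolding lr using ord by (simp add: p_def)
    from invariant_plane_real[OF M(1) this] obtain x y c where
      "x \<in> carrier_vec n \<and> x \<noteq> 0\<^sub>v n \<and> y \<in> carrier_vec n \<and> (\<forall>b. y \<noteq> b \<cdot>\<^sub>v x) \<and>
       M *\<^sub>v x = Re l \<cdot>\<^sub>v x + 0 \<cdot>\<^sub>v y \<and> M *\<^sub>v y = c \<cdot>\<^sub>v x + Re l \<cdot>\<^sub>v y" by blast
    then show ?thesis using True by (intro exI[of _ x] exI[of _ y] exI[of _ 0] exI[of _ c]) simp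
  next
    case False
    from invariant_plane_nonreal[OF M(1) lM this] obtain x y where
      "x \<in> carrier_vec n \<and> x \<noteq> 0\<^sub>v n \<and> y \<in> carrier_vec n \<and> (\<forall>b. y \<noteq> b \<cdot>\<^sub>v x) \<and>
       M *\<^sub>v x = Re l \<cdot>\<^sub>v x + - Im l \<cdot>\<^sub>v y \<and> M *\<^sub>v y = Im l \<cdot>\<^sub>v x + Re l \<cdot>\<^sub>v y" by blast
    then show ?thesis using False
      by (intro exI[of _ x] exI[of _ y] exI[of _ "- Im l"] exI[of _ "Im l"]) (simp add: power2_eq_square)
  qed
  then obtain x y a c where xy: "x \<in> carrier_vec n" "x \<noteq> 0\<^sub>v n" "y \<in> carrier_vec n" "\<And>b. y \<noteq> b \<cdot>\<^sub>v x"
      "M *\<^sub>v x = Re l \<cdot>\<^sub>v x + a \<cdot>\<^sub>v y" "M *\<^sub>v y = c \<cdot>\<^sub>v x + Re l \<cdot>\<^sub>v y"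
    and ac: "a * c = - (Im l)\<^sup>2" "c = 0 \<longrightarrow> a = 0" by blast
  from ex_invariant_plane_form[OF M(1) xy] obtain m S T B C E where n: "n = 2 + m"
    and S: "S \<in> carrier_mat n n" and T: "T \<in> carrier_mat n n" "S * T = 1\<^sub>m n" "T * S = 1\<^sub>m n"
    and BCE: "B \<in> carrier_mat 2 2" "C \<in> carrier_mat 2 m" "E \<in> carrier_mat m m"
    and B: "B $$ (0,0) = Re l" "B $$ (1,0) = a" "B $$ (0,1) = c" "B $$ (1,1) = Re l"
    and MB: "M = S * four_block_mat B C (0\<^sub>m m 2) E * T" by blast
  define F where "F \<eta> = four_block_mat (rotated_block l c \<eta>) C (0\<^sub>m m 2) E" for \<eta>
  have F: "F \<eta> \<in> carrier_mat n n" for \<eta> unfolding F_def n by (rule four_block_carrier_mat) (use BCE in auto)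
  define \<Gamma> where "\<Gamma> \<eta> = S * F \<eta> * T" for \<eta>
  have \<Gamma>: "\<Gamma> \<eta> \<in> carrier_mat n n" for \<eta> using S F T by (auto simp: \<Gamma>_def)
  have \<Gamma>0: "\<Gamma> 0 = M"
    unfolding \<Gamma>_def F_def MB by (subst rotated_block_0[of B]) (use BCE B ac in auto)
  have det\<Gamma>: "det (\<Gamma> \<eta>) = (cmod l)\<^sup>2 * det E" for \<eta>
    unfolding \<Gamma>_def det_conjugate[OF S F T(1,2)] unfolding F_def
    by (subst det_four_block_mat_lower_left_zero[of _ 2 _ m]) (use BCE in \<open>auto simp: det_rotated_block\<close>)
  have pE: "p E \<noteq> 0" unfolding p_def by (rule complex_char_poly_props(1)[OF BCE(3)])
  have "p (\<Gamma> \<eta>) = ([:- (l * cis \<eta>), 1:] * [:- cnj (l * cis \<eta>), 1:]) * p E" for \<eta>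
    unfolding p_def \<Gamma>_def char_poly_conjugate[OF S F T] char_poly_rotated_block[symmetric, of l \<eta> c]
    unfolding F_def
    by (subst char_poly_four_block_upper[of _ 2 _ m]) (use BCE in \<open>simp_all add: map_poly_of_real_mult\<close>)
  moreover have "[:- \<mu>, 1:] * [:- cnj \<mu>, 1:] \<noteq> 0" for \<mu>
    by (metis mult_eq_0_iff one_neq_zero pCons_eq_0_iff)
  ultimately have roots: "proots (p (\<Gamma> \<eta>)) = {#l * cis \<eta>, cnj (l * cis \<eta>)#} + proots (p E)" for \<eta>
    using pE by (simp add: proots_mult del: mult_pCons_left mult_pCons_right)
  have "image_mset cmod (proots (p (\<Gamma> \<eta>))) = {#cmod l, cmod l#} + image_mset cmod (proots (p E))" for \<eta>
    by (simp add: roots norm_mult)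
  then have H: "\<Gamma> \<eta> \<in> same_moduli n M" for \<eta>
    using det\<Gamma>[of \<eta>] det\<Gamma>[of 0] \<Gamma> \<Gamma>0 eigenvalue_moduli_char_poly[OF \<Gamma>[of \<eta>]]
      eigenvalue_moduli_char_poly[OF \<Gamma>[of 0]]
    by (auto simp: same_moduli_def p_def)
  have cont: "continuous_on U (\<lambda>\<eta>. \<Gamma> \<eta> $$ (i,j))" if ij: "i < n" "j < n" for U i j
  proof -
    have "\<Gamma> \<eta> $$ (i,j) = (\<Sum>r<n. \<Sum>q<n. S $$ (i,q) * F \<eta> $$ (q,r) * T $$ (r,j))" for \<eta>
      using ij S F[of \<eta>] T(1)
      by (simp add: \<Gamma>_def scalar_prod_def atLeast0LessThan sum_distrib_right sum_distrib_left mult.assoc del: assoc_mult_mat)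
    moreover have "continuous_on U (\<lambda>\<eta>. F \<eta> $$ (q,r))" if "q < n" "r < n" for q r
      using that BCE n
      by (cases "q < 2"; cases "r < 2") (auto simp: F_def carrier_matD[OF rotated_block_carrier] intro: continuous_on_rotated_block)
    ultimately show ?thesis by (auto intro!: continuous_intros)
  qed
  obtain b where b: "b > 0" "\<And>\<eta>. \<eta> \<in> {0<..b} \<Longrightarrow> deformable n (same_moduli n M) e M (\<Gamma> \<eta>)"
    using deformable_of_germ[of 1 e "same_moduli n M" n \<Gamma> M] e H \<Gamma>0 cont
    by (auto simp: same_moduli_def)
  \<comment> \<open>Outside this finite set \<open>\<mu>\<close> is a nonreal number such that neither \<open>\<mu>\<close> nor its conjugate was an eigenvalue.\<close>
  define Bad where "Bad = complex_eigenvalues M \<union> cnj ` complex_eigenvalues M \<union>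
      {complex_of_real (cmod l), - complex_of_real (cmod l)}"
  have finB: "finite Bad" using pM(4) by (simp add: Bad_def)
  have inj: "inj_on (\<lambda>\<eta>. l * cis \<eta>) {0<..min b 1}"
  proof (rule inj_onI)
    fix s t assume st: "s \<in> {0<..min b 1}" "t \<in> {0<..min b 1}" and "l * cis s = l * cis t"
    then have "cis s = cis t" using l0 by simp
    then show "s = t"
      using st pi_ge_two cos_inj_pi[of s t] by (auto simp: complex_eq_iff)
  qed
  have "infinite {0<..min b 1}" using b(1) by (simp add: infinite_Ioc)
  moreover have "finite {\<eta>\<in>{0<..min b 1}. l * cis \<eta> \<in> Bad}"
    using finite_vimage_IntI[OF finB inj] by (simp add: vimage_def Int_def conj_commute)
  ultimately have "{0<..min b 1} - {\<eta>\<in>{0<..min b 1}. l * cis \<eta> \<in> Bad} \<noteq> {}"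
    by (metis Diff_infinite_finite finite.emptyI)
  then obtain \<eta> where \<eta>: "\<eta> \<in> {0<..min b 1}" "l * cis \<eta> \<notin> Bad" by blast
  define \<mu> where "\<mu> = l * cis \<eta>"
  have \<mu>: "\<mu> \<notin> complex_eigenvalues M" "cnj \<mu> \<notin> complex_eigenvalues M"
    using \<eta>(2) unfolding Bad_def \<mu>_def[symmetric] by (auto simp: image_iff)
  have "\<mu> \<noteq> cnj \<mu>"
  proof
    assume "\<mu> = cnj \<mu>"
    then have im: "Im \<mu> = 0" by (simp add: complex_eq_iff)
    then have "\<bar>Re \<mu>\<bar> = cmod \<mu>" by (simp add: cmod_eq_Re)
    then have "\<bar>Re \<mu>\<bar> = cmod l" by (simp add: \<mu>_def norm_mult)
    with im have "\<mu> = complex_of_real (cmod l) \<or> \<mu> = - complex_of_real (cmod l)"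
      by (auto simp: complex_eq_iff)
    with \<eta>(2) show False by (auto simp: Bad_def \<mu>_def)
  qed
  note pN = complex_char_poly_props[OF \<Gamma>[of \<eta>], folded p_def]
  have "(complex_eigenvalues M - {cnj l}) \<union> {\<mu>, cnj \<mu>} \<subseteq> complex_eigenvalues (\<Gamma> \<eta>)"
  proof -
    have "z \<in># proots (p E)" if z: "z \<in> complex_eigenvalues M" "z \<noteq> cnj l" for z
    proof (cases "z = l")
      case True
      then have "count (proots (p M)) l = 1 + count (proots (p E)) l"
        using roots[of 0] z by (simp add: \<Gamma>0)
      with l True show ?thesis by (simp add: count_greater_zero_iff[symmetric] del: count_greater_zero_iff)
    next
      case False
      then show ?thesis using z roots[of 0] pM(3) by (auto simp: \<Gamma>0)
    qed
    then show ?thesis unfolding pN(3)[symmetric] roots by (auto simp: \<mu>_def)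
  qed
  then have "card ((complex_eigenvalues M - {cnj l}) \<union> {\<mu>, cnj \<mu>}) \<le> card (complex_eigenvalues (\<Gamma> \<eta>))"
    by (rule card_mono[OF pN(4)])
  moreover have "card ((complex_eigenvalues M - {cnj l}) \<union> {\<mu>, cnj \<mu>}) =
      card (complex_eigenvalues M - {cnj l}) + 2"
    using \<mu> \<open>\<mu> \<noteq> cnj \<mu>\<close> pM(4) by (subst card_Un_disjoint) auto
  moreover have "card (complex_eigenvalues M) \<le> card (complex_eigenvalues M - {cnj l}) + 1"
    by (simp add: card_Diff_singleton_if) linarith
  ultimately have "card (complex_eigenvalues M) < card (complex_eigenvalues (\<Gamma> \<eta>))" by linarith
  with b(2)[of \<eta>] \<eta>(1) show ?thesis by auto
qed

lemma same_moduli_eq: "N \<in> same_moduli n M \<Longrightarrow> same_moduli n N = same_moduli n M"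
  by (auto simp: same_moduli_def)

text \<open>Induction on the number of missing eigenvalues, with the distance allowed halved in every step.\<close>

lemma deformable_to_simple_spectrum:
  assumes "M \<in> carrier_mat n n" "det M \<noteq> 0" "e > 0"
  shows "\<exists>N. deformable n (same_moduli n M) e M N \<and> card (complex_eigenvalues N) = n"
  using assms
proof (induction "n - card (complex_eigenvalues M)" arbitrary: M e rule: less_induct)
  case less
  have le: "card (complex_eigenvalues X) \<le> n" if "X \<in> carrier_mat n n" for X
    using card_finite_spectrum(2)[of "map_mat complex_of_real X" n] that
    by (simp add: complex_eigenvalues_def)
  show ?case
  proof (cases "card (complex_eigenvalues M) = n")
    case True
    have "M \<in> same_moduli n M" using less.prems by (simp add: same_moduli_def)
    with True show ?thesis using deformable_refl less.prems by blast
  next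
    case False
    then have "card (complex_eigenvalues M) < n" using le less.prems(1) by (simp add: order_less_le)
    then obtain N where N: "deformable n (same_moduli n M) (e / 2) M N"
        "card (complex_eigenvalues M) < card (complex_eigenvalues N)"
      using split_multiple_eigenvalue[of M n "e / 2"] less.prems by auto
    have NM: "N \<in> same_moduli n M" using deformable_endpoint[OF N(1)] .
    then have Nc: "N \<in> carrier_mat n n" "det N \<noteq> 0" using less.prems by (auto simp: same_moduli_def)
    have "n - card (complex_eigenvalues N) < n - card (complex_eigenvalues M)"
      using N(2) le[OF Nc(1)] by linarith
    from less.hyps[OF this Nc, of "e / 2"] less.prems(3) obtain K
      where K: "deformable n (same_moduli n N) (e / 2) N K" "card (complex_eigenvalues K) = n" by auto
    have "deformable n (same_moduli n M) (e / 2 + e / 2) M K"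
      by (rule deformable_trans[OF N(1) K(1)[unfolded same_moduli_eq[OF NM]]]) (auto simp: same_moduli_def)
    with K(2) show ?thesis by auto
  qed
qed

section \<open>Functional calculus of a diagonalizable matrix\<close>

definition spectral_map :: "complex mat \<Rightarrow> complex mat \<Rightarrow> nat \<Rightarrow> (nat \<Rightarrow> complex) \<Rightarrow> (complex \<Rightarrow> complex) \<Rightarrow> complex mat" where
  "spectral_map P Q n ls g = P * mat_diag n (\<lambda>i. g (ls i)) * Q"

lemma spectral_map_carrier:
  "P \<in> carrier_mat n n \<Longrightarrow> Q \<in> carrier_mat n n \<Longrightarrow> spectral_map P Q n ls g \<in> carrier_mat n n"
  using mat_diag_dim[of n "\<lambda>i. g (ls i)"] by (simp add: spectral_map_def del: mat_diag_dim)

text \<open>Suppose \<open>P c = 0\<close> with \<open>c\<^sub>k \<noteq> 0\<close>. Since the kernel of \<open>P\<close> is stable under the diagonal matrix \<open>D\<close>,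
the vector \<open>(D - ls k) c\<close> also lies in it, and it has fewer nonzero coordinates. Inductively it is
zero, so \<open>c\<close> is a multiple of the \<open>k\<close>-th basis vector, and then column \<open>k\<close> of \<open>P\<close> is zero.\<close>

lemma eigenvectors_independent:
  fixes P :: "complex mat"
  assumes A: "A \<in> carrier_mat n n" and P: "P \<in> carrier_mat n n"
    and inj: "inj_on ls {..<n}"
    and ev: "\<And>j. j < n \<Longrightarrow> col P j \<noteq> 0\<^sub>v n" and AP: "A * P = P * mat_diag n ls"
  shows "det P \<noteq> 0"
proof -
  have "c = 0\<^sub>v n" if "c \<in> carrier_vec n" "P *\<^sub>v c = 0\<^sub>v n" for c
    using that
  proof (induction "card {j. j < n \<and> c $ j \<noteq> 0}" arbitrary: c rule: less_induct)
    case less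
    show ?case
    proof (rule ccontr)
      assume "c \<noteq> 0\<^sub>v n"
      then obtain k where k: "k < n" "c $ k \<noteq> 0"
        using less.prems(1) by (metis eq_vecI carrier_vecD index_zero_vec)
      define c' where "c' = mat_diag n ls *\<^sub>v c - ls k \<cdot>\<^sub>v c"
      have D: "(mat_diag n ls *\<^sub>v c) $ j = ls j * c $ j" if "j < n" for j
      proof -
        have "(mat_diag n ls *\<^sub>v c) $ j = (\<Sum>i<n. (if j = i then ls i else 0) * c $ i)"
          using that less.prems(1) by (simp add: mat_diag_def scalar_prod_def atLeast0LessThan)
        also have "\<dots> = (\<Sum>i<n. if j = i then ls i * c $ i else 0)"
          by (rule sum.cong) auto
        finally show ?thesis using that by simp
      qed
      have Dc: "mat_diag n ls *\<^sub>v c \<in> carrier_vec n"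
        by (rule mult_mat_vec_carrier[OF mat_diag_dim less.prems(1)])
      have c': "c' \<in> carrier_vec n" "\<And>j. j < n \<Longrightarrow> c' $ j = (ls j - ls k) * c $ j"
        using less.prems(1) D Dc unfolding c'_def by (auto simp: algebra_simps simp del: index_mult_mat_vec)
      have "P *\<^sub>v (mat_diag n ls *\<^sub>v c) = (A * P) *\<^sub>v c"
        unfolding AP using P less.prems(1) by (simp add: assoc_mult_mat_vec[of _ n n _ n])
      also have "\<dots> = A *\<^sub>v (P *\<^sub>v c)" using A P less.prems(1) by (simp add: assoc_mult_mat_vec[of _ n n _ n])
      also have "\<dots> = 0\<^sub>v n" unfolding less.prems(2) using A by (intro eq_vecI) auto
      finally have 1: "P *\<^sub>v (mat_diag n ls *\<^sub>v c) = 0\<^sub>v n" .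
      have "P *\<^sub>v c' = 0\<^sub>v n - ls k \<cdot>\<^sub>v 0\<^sub>v n"
        unfolding c'_def using P less.prems Dc
        by (simp add: mult_minus_distrib_mat_vec[of _ n n] mult_mat_vec[of _ n n] 1)
      also have "\<dots> = 0\<^sub>v n" by (intro eq_vecI) auto
      finally have "P *\<^sub>v c' = 0\<^sub>v n" .
      moreover have "card {j. j < n \<and> c' $ j \<noteq> 0} < card {j. j < n \<and> c $ j \<noteq> 0}"
      proof (rule psubset_card_mono)
        have "{j. j < n \<and> c' $ j \<noteq> 0} \<subseteq> {j. j < n \<and> c $ j \<noteq> 0}" using c'(2) by auto
        moreover have "c' $ k = 0" using c'(2) k by simp
        ultimately show "{j. j < n \<and> c' $ j \<noteq> 0} \<subset> {j. j < n \<and> c $ j \<noteq> 0}"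
          using k by blast
      qed simp
      ultimately have "c' = 0\<^sub>v n" by (rule less.hyps[OF _ c'(1), rotated])
      then have z: "c $ j = 0" if "j < n" "j \<noteq> k" for j
        using c'(2)[OF that(1)] that k(1) inj by (auto simp: inj_on_def)
      have "c = c $ k \<cdot>\<^sub>v unit_vec n k"
        using z less.prems(1) k(1) by (intro eq_vecI) (auto simp: unit_vec_def)
      then have "P *\<^sub>v c = c $ k \<cdot>\<^sub>v col P k"
        using P k(1) mult_mat_vec[of P n n "unit_vec n k" "c $ k"] mult_mat_vec_unit[of P n n k] by simp
      then have "c $ k \<cdot>\<^sub>v col P k = 0\<^sub>v n" using less.prems(2) by simp
      moreover have "c $ k \<cdot>\<^sub>v col P k \<noteq> 0\<^sub>v n"
      proof
        assume a: "c $ k \<cdot>\<^sub>v col P k = 0\<^sub>v n"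
        have "col P k $ i = 0" if "i < n" for i
          using arg_cong[OF a, of "\<lambda>v. v $ i"] that k P by simp
        then show False using ev[OF k(1)] P by (auto intro!: eq_vecI)
      qed
      ultimately show False by simp
    qed
  qed
  then show ?thesis by (subst det_0_iff_vec_prod_zero[OF P]) blast
qed

lemma ex_inverse_of_det:
  fixes P :: "'a :: field mat"
  assumes P: "P \<in> carrier_mat n n" "det P \<noteq> 0"
  shows "\<exists>Q\<in>carrier_mat n n. P * Q = 1\<^sub>m n \<and> Q * P = 1\<^sub>m n"
  using det_non_zero_imp_unit[OF P, of "()"] unfolding Units_def ring_mat_def by auto

lemma simple_spectrum_diagonalizable:
  assumes A: "A \<in> carrier_mat n n" and card: "card (spectrum A) = n"
  shows "\<exists>P Q ls. P \<in> carrier_mat n n \<and> Q \<in> carrier_mat n n \<and> P * Q = 1\<^sub>m n \<and> Q * P = 1\<^sub>m n \<and>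
     inj_on ls {..<n} \<and> ls ` {..<n} = spectrum A \<and> A = spectral_map P Q n ls (\<lambda>z. z :: complex)"
proof -
  from ex_bij_betw_nat_finite[OF card_finite_spectrum(1)[OF A]] obtain ls
    where ls: "bij_betw ls {..<n} (spectrum A)" unfolding card atLeast0LessThan by blast
  have "\<exists>v. v \<in> carrier_vec n \<and> v \<noteq> 0\<^sub>v n \<and> A *\<^sub>v v = ls j \<cdot>\<^sub>v v" if "j < n" for j
  proof -
    have "ls j \<in> spectrum A" using ls that by (auto simp: bij_betw_def)
    then show ?thesis using A by (auto simp: spectrum_def eigenvalue_def eigenvector_def)
  qed
  then obtain v where v: "\<And>j. j < n \<Longrightarrow> v j \<in> carrier_vec n \<and> v j \<noteq> 0\<^sub>v n \<and> A *\<^sub>v v j = ls j \<cdot>\<^sub>v v j"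
    by metis
  define P where "P = mat n n (\<lambda>(i,j). v j $ i)"
  have P: "P \<in> carrier_mat n n" by (simp add: P_def)
  have colP: "col P j = v j" if "j < n" for j using that v[OF that] by (intro eq_vecI) (auto simp: P_def)
  have AP: "A * P = P * mat_diag n ls"
  proof (rule eq_matI)
    fix i j assume "i < dim_row (P * mat_diag n ls)" "j < dim_col (P * mat_diag n ls)"
    then have ij: "i < n" "j < n" using P by (auto simp: mat_diag_def)
    have dv: "dim_vec (v j) = n" using v[OF ij(2)] by auto
    have "(A * P) $$ (i,j) = (A *\<^sub>v v j) $ i" using ij A P colP by simp
    also have "\<dots> = ls j * v j $ i" using v[OF ij(2)] ij(1) dv by (metis index_smult_vec(1))
    also have "\<dots> = (P * mat_diag n ls) $$ (i,j)"
      using ij P by (simp add: mat_diag_mult_right[of _ n] P_def)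
    finally show "(A * P) $$ (i,j) = (P * mat_diag n ls) $$ (i,j)" .
  qed (use A P in \<open>auto simp: mat_diag_def\<close>)
  have "det P \<noteq> 0"
    by (rule eigenvectors_independent[OF A P _ _ AP]) (use ls v colP in \<open>auto simp: bij_betw_def\<close>)
  then obtain Q where Q: "Q \<in> carrier_mat n n" "P * Q = 1\<^sub>m n" "Q * P = 1\<^sub>m n"
    using ex_inverse_of_det[OF P] by blast
  have "P * mat_diag n ls * Q = A * P * Q" by (simp add: AP)
  also have "\<dots> = A" using A P Q by simp
  finally have "A = spectral_map P Q n ls (\<lambda>z. z)" by (simp add: spectral_map_def)
  then show ?thesis using P Q ls unfolding bij_betw_def by blast
qed

text \<open>\<open>F g\<close> below is \<open>g(A)\<close> for \<open>A = P D P\<^sup>-\<^sup>1\<close> with \<open>D\<close> the diagonal matrix of \<open>ls\<close>; the matrix \<open>A\<close>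
itself is \<open>F (\<lambda>z. z)\<close>.\<close>

locale diagonalization =
  fixes n :: nat and P Q :: "complex mat" and ls :: "nat \<Rightarrow> complex"
  assumes P: "P \<in> carrier_mat n n" and Q: "Q \<in> carrier_mat n n"
    and PQ: "P * Q = 1\<^sub>m n" and QP: "Q * P = 1\<^sub>m n"
begin

abbreviation F :: "(complex \<Rightarrow> complex) \<Rightarrow> complex mat" where "F \<equiv> spectral_map P Q n ls"

lemma F_carrier: "F g \<in> carrier_mat n n"
  using P Q by (rule spectral_map_carrier)

lemma F_mult_P: "F g * P = P * mat_diag n (\<lambda>i. g (ls i))"
  using P Q QP mat_diag_dim[of n "\<lambda>i. g (ls i)"]
  by (simp add: spectral_map_def assoc_mult_mat[of _ n n _ n _ n] del: mat_diag_dim)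

lemma F_entry:
  assumes "i < n" "j < n"
  shows "F g $$ (i,j) = (\<Sum>k<n. P $$ (i,k) * g (ls k) * Q $$ (k,j))"
  using assms P Q
  by (simp add: spectral_map_def mat_diag_mult_right[of _ n] scalar_prod_def atLeast0LessThan del: assoc_mult_mat)

lemma char_poly_F: "char_poly (F g) = (\<Prod>i<n. [:- g (ls i), 1:])"
proof -
  have "similar_mat_wit (F g) (mat_diag n (\<lambda>i. g (ls i))) P Q"
    using P Q PQ QP F_carrier[of g] unfolding spectral_map_def similar_mat_wit_def Let_def by auto
  then have "char_poly (F g) = char_poly (mat_diag n (\<lambda>i. g (ls i)))"
    using char_poly_similar unfolding similar_mat_def by blast
  also have "\<dots> = (\<Prod>a\<leftarrow>diag_mat (mat_diag n (\<lambda>i. g (ls i))). [:- a, 1:])"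
    by (rule char_poly_upper_triangular[of _ n]) (auto simp: mat_diag_def)
  also have "\<dots> = (\<Prod>i<n. [:- g (ls i), 1:])"
    by (simp add: diag_mat_def mat_diag_def prod.list_conv_set_nth atLeast0LessThan)
  finally show ?thesis .
qed

lemma proots_F: "proots (char_poly (F g)) = image_mset (\<lambda>i. g (ls i)) (mset_set {..<n})"
proof -
  have "proots (char_poly (F g)) = (\<Sum>i<n. {#g (ls i)#})"
    unfolding char_poly_F by (subst proots_prod) auto
  then show ?thesis by (simp add: sum_unfold_sum_mset)
qed

lemma det_F: "det (F g) = (\<Prod>i<n. g (ls i))"
proof -
  have "det P * det Q = 1" using det_mult[OF P Q] PQ by simp
  moreover have "det (mat_diag n (\<lambda>i. g (ls i))) = (\<Prod>i<n. g (ls i))"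
    by (subst det_upper_triangular[of _ n])
       (auto simp: mat_diag_def diag_mat_def prod.list_conv_set_nth atLeast0LessThan)
  ultimately show ?thesis using P Q by (simp add: spectral_map_def det_mult[of _ n] del: assoc_mult_mat)
qed

text \<open>In the coordinates \<open>w = Q v\<close> the hypothesis says that \<open>w\<^sub>i \<noteq> 0\<close> only where \<open>ls i = l\<close>. This
characterizes \<open>F g\<close> without reference to the chosen eigenbasis.\<close>

lemma F_eigenvector:
  assumes v: "v \<in> carrier_vec n" and ev: "F (\<lambda>z. z) *\<^sub>v v = l \<cdot>\<^sub>v v"
  shows "F g *\<^sub>v v = g l \<cdot>\<^sub>v v"
proof -
  define w where "w = Q *\<^sub>v v"
  have w: "w \<in> carrier_vec n" using Q v by (simp add: w_def)
  have vw: "v = P *\<^sub>v w"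
    using P Q v PQ unfolding w_def by (simp flip: assoc_mult_mat_vec[of _ n n _ n])
  have diag: "(mat_diag n f *\<^sub>v w) $ i = f i * w $ i" if "i < n" for f i
  proof -
    have "(mat_diag n f *\<^sub>v w) $ i = (\<Sum>j<n. (if i = j then f j else 0) * w $ j)"
      using that w by (simp add: mat_diag_def scalar_prod_def atLeast0LessThan)
    also have "\<dots> = (\<Sum>j<n. if i = j then f j * w $ j else 0)" by (rule sum.cong) auto
    finally show ?thesis using that by simp
  qed
  have FP: "F h *\<^sub>v v = P *\<^sub>v (mat_diag n (\<lambda>i. h (ls i)) *\<^sub>v w)" for h
    using P w F_mult_P[of h] F_carrier[of h]
    by (simp add: vw flip: assoc_mult_mat_vec[of _ n n _ n])
  have Dw: "mat_diag n f *\<^sub>v w \<in> carrier_vec n" for f by (rule mult_mat_vec_carrier[OF mat_diag_dim w])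
  have "P *\<^sub>v (mat_diag n ls *\<^sub>v w) = P *\<^sub>v (l \<cdot>\<^sub>v w)"
    using FP[of "\<lambda>z. z"] ev P w by (simp add: vw mult_mat_vec[of _ n n])
  then have "Q *\<^sub>v (P *\<^sub>v (mat_diag n ls *\<^sub>v w)) = Q *\<^sub>v (P *\<^sub>v (l \<cdot>\<^sub>v w))" by simp
  moreover have "Q *\<^sub>v (P *\<^sub>v u) = u" if "u \<in> carrier_vec n" for u
    using assoc_mult_mat_vec[OF Q P that] QP that by simp
  ultimately have lw: "mat_diag n ls *\<^sub>v w = l \<cdot>\<^sub>v w" using w Dw[of ls] by simp
  have "mat_diag n (\<lambda>i. g (ls i)) *\<^sub>v w = g l \<cdot>\<^sub>v w"
  proof (rule eq_vecI)
    fix i assume "i < dim_vec (g l \<cdot>\<^sub>v w)"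
    then have i: "i < n" using w by simp
    have "ls i * w $ i = l * w $ i" using arg_cong[OF lw, of "\<lambda>u. u $ i"] diag[OF i] i w by simp
    then show "(mat_diag n (\<lambda>i. g (ls i)) *\<^sub>v w) $ i = (g l \<cdot>\<^sub>v w) $ i"
      using diag[OF i] i w by auto
  qed (use w in \<open>auto simp: mat_diag_def\<close>)
  then show ?thesis unfolding FP using P w by (simp add: vw mult_mat_vec[of _ n n])
qed

text \<open>If \<open>v\<close> is an eigenvector for \<open>l\<close>, then \<open>cnj v\<close> is one for \<open>cnj l\<close>, as \<open>M\<close> is real. Since \<open>g\<close>
commutes with conjugation, \<open>F g\<close> and its complex conjugate agree on the eigenbasis.\<close>

lemma F_real:
  assumes M: "M \<in> carrier_mat n n" "map_mat complex_of_real M = F (\<lambda>z. z)"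
    and g: "\<And>z. g (cnj z) = cnj (g z)"
  shows "map_mat complex_of_real (map_mat Re (F g)) = F g"
proof -
  interpret cnj: comm_ring_hom cnj by unfold_locales auto
  have cM: "map_mat cnj (map_mat complex_of_real M) = map_mat complex_of_real M" by (intro eq_matI) auto
  have "map_mat cnj (F g) *\<^sub>v col P j = F g *\<^sub>v col P j" if j: "j < n" for j
  proof -
    define v where "v = col P j"
    have v: "v \<in> carrier_vec n" using col_dim[of P j] P by (simp only: v_def carrier_matD(1))
    have cc: "map_vec cnj (map_vec cnj u) = u" for u by (intro eq_vecI) auto
    have Fv: "F h *\<^sub>v v = h (ls j) \<cdot>\<^sub>v v" for h
    proof -
      have "F h *\<^sub>v v = col (F h * P) j"
        unfolding v_def by (rule col_mult2[OF F_carrier P j, symmetric])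
      also have "\<dots> = h (ls j) \<cdot>\<^sub>v v"
        unfolding F_mult_P mat_diag_mult_right[OF P] using j P by (intro eq_vecI) (auto simp: v_def)
      finally show ?thesis .
    qed
    have "map_mat cnj (F (\<lambda>z. z)) *\<^sub>v map_vec cnj v = cnj (ls j) \<cdot>\<^sub>v map_vec cnj v"
      using cnj.mult_mat_vec_hom[OF F_carrier v, of "\<lambda>z. z"] Fv[of "\<lambda>z. z"] by (simp add: cnj.vec_hom_smult)
    then have "F (\<lambda>z. z) *\<^sub>v map_vec cnj v = cnj (ls j) \<cdot>\<^sub>v map_vec cnj v"
      using cM M(2) by simp
    from F_eigenvector[OF _ this, of g] v
    have "F g *\<^sub>v map_vec cnj v = cnj (g (ls j)) \<cdot>\<^sub>v map_vec cnj v" by (simp add: g)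
    from arg_cong[OF this, of "map_vec cnj"]
    have "map_mat cnj (F g) *\<^sub>v v = g (ls j) \<cdot>\<^sub>v v"
      using cnj.mult_mat_vec_hom[OF F_carrier, of "map_vec cnj v" g] v by (simp add: cnj.vec_hom_smult cc)
    then show ?thesis using Fv[of g] by (simp add: v_def)
  qed
  then have "map_mat cnj (F g) * P = F g * P"
    using P F_carrier[of g] by (intro eq_matI) (auto dest!: fun_cong[where x = i for i] simp: vec_eq_iff)
  then have "map_mat cnj (F g) * P * Q = F g * P * Q" by simp
  then have "map_mat cnj (F g) = F g"
    using P Q PQ F_carrier[of g] by (simp add: assoc_mult_mat[of _ n n _ n _ n])
  then have "cnj (F g $$ (i,j)) = F g $$ (i,j)" if "i < n" "j < n" for i j
    using that F_carrier[of g] by (metis index_map_mat(1) carrier_matD)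
  then show ?thesis using F_carrier[of g] by (intro eq_matI) (auto simp: complex_eq_iff)
qed

text \<open>In the eigenbasis the form has the matrix \<open>X = P\<^sup>T J P\<close>, and invariance under \<open>F (\<lambda>z. z)\<close> means that
\<open>X\<close> has a nonzero entry only where the product of the two eigenvalues is \<open>1\<close>. The same
condition gives invariance under \<open>F g\<close>.\<close>

lemma F_preserves_form:
  assumes J: "J \<in> carrier_mat n n"
    and M: "transpose_mat (F (\<lambda>z. z)) * J * F (\<lambda>z. z) = J"
    and g: "\<And>z w. z * w = 1 \<Longrightarrow> g z * g w = 1"
  shows "transpose_mat (F g) * J * F g = J"
proof -
  define X where "X = transpose_mat P * J * P"
  have X: "X \<in> carrier_mat n n" using P J by (simp add: X_def)
  let ?D = "\<lambda>h. mat_diag n (\<lambda>i. h (ls i))"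
  have tD: "transpose_mat (?D h) = ?D h" for h by (intro eq_matI) (auto simp: mat_diag_def)
  have conj: "transpose_mat P * (transpose_mat (F h) * J * F h) * P = ?D h * X * ?D h" for h
  proof -
    have "transpose_mat P * (transpose_mat (F h) * J * F h) * P =
        transpose_mat (F h * P) * J * (F h * P)"
      using P J F_carrier[of h]
      by (simp add: transpose_mult[of _ n n _ n] assoc_mult_mat[of _ n n _ n _ n])
    also have "\<dots> = ?D h * X * ?D h"
      unfolding F_mult_P X_def using P J
      by (simp add: transpose_mult[of _ n n _ n] tD assoc_mult_mat[of _ n n _ n _ n])
    finally show ?thesis .
  qed
  have "?D (\<lambda>z. z) * X * ?D (\<lambda>z. z) = X" using conj[of "\<lambda>z. z"] M by (simp add: X_def)
  have DXD: "(?D h * X * ?D h) $$ (i,j) = h (ls i) * X $$ (i,j) * h (ls j)" if "i < n" "j < n" for h i j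
    using that X by (simp add: mat_diag_mult_left[of _ n n] mat_diag_mult_right[of _ n n] del: assoc_mult_mat)
  have "?D g * X * ?D g = X"
  proof (rule eq_matI)
    fix i j assume "i < dim_row X" "j < dim_col X"
    then have ij: "i < n" "j < n" using X by auto
    have "ls i * X $$ (i,j) * ls j = X $$ (i,j)"
      using DXD[OF ij, of "\<lambda>z. z"] conj[of "\<lambda>z. z"] M by (simp add: X_def)
    then have "X $$ (i,j) = 0 \<or> ls i * ls j = 1" by (auto simp: algebra_simps)
    then have "g (ls i) * X $$ (i,j) * g (ls j) = X $$ (i,j)" using g[of "ls i" "ls j"] by (auto simp: algebra_simps)
    then show "(?D g * X * ?D g) $$ (i,j) = X $$ (i,j)" using DXD[OF ij, of g] by simp
  qed (use X in \<open>auto simp: mat_diag_def\<close>)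
  then have eq: "transpose_mat P * (transpose_mat (F g) * J * F g) * P = transpose_mat P * J * P"
    using conj[of g] by (simp add: X_def)
  have tQP: "transpose_mat Q * transpose_mat P = 1\<^sub>m n"
    using transpose_mult[OF P Q] PQ by simp
  have cancel: "transpose_mat Q * (transpose_mat P * Y * P) * Q = Y" if Y: "Y \<in> carrier_mat n n" for Y
  proof -
    have "transpose_mat Q * (transpose_mat P * Y * P) * Q = (transpose_mat Q * (transpose_mat P * Y)) * (P * Q)"
      using P Q Y by (simp add: assoc_mult_mat[of _ n n _ n _ n])
    also have "\<dots> = Y" using P Q Y PQ by (simp add: mult_inverse_cancel[OF tQP, where m = n])
    finally show ?thesis .
  qed
  have "transpose_mat (F g) * J * F g \<in> carrier_mat n n" using J F_carrier[of g] by simp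
  from cancel[OF this] cancel[OF J] show ?thesis unfolding eq by simp
qed

end

section \<open>Rational arguments\<close>

definition rational_angle :: "real \<Rightarrow> real \<Rightarrow> real" where
  "rational_angle h \<alpha> = pi * (SOME q. q \<in> \<rat> \<and> \<bar>pi * q - \<alpha>\<bar> < h)"

lemma rational_angle:
  assumes h: "h > 0"
  shows "\<exists>q\<in>\<rat>. rational_angle h \<alpha> = pi * q" "\<bar>rational_angle h \<alpha> - \<alpha>\<bar> < h"
proof -
  have "(\<alpha> - h) / pi < (\<alpha> + h) / pi" using h by (simp add: divide_strict_right_mono)
  then obtain q where q: "q \<in> \<rat>" "(\<alpha> - h) / pi < q" "q < (\<alpha> + h) / pi"
    using Rats_dense_in_real by blast
  then have "\<bar>pi * q - \<alpha>\<bar> < h" by (auto simp: field_simps abs_less_iff)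
  with q(1) have "\<exists>q. q \<in> \<rat> \<and> \<bar>pi * q - \<alpha>\<bar> < h" by blast
  from someI_ex[OF this]
  show "\<exists>q\<in>\<rat>. rational_angle h \<alpha> = pi * q" "\<bar>rational_angle h \<alpha> - \<alpha>\<bar> < h"
    by (auto simp: rational_angle_def)
qed

text \<open>The angle by which \<open>z\<close> has to be turned so that its argument becomes rational in units of \<open>\<pi>\<close>. It is
computed from the absolute value of the argument and given the sign of \<open>Im z\<close>, so that it is odd under
conjugation and inversion; real numbers have the argument \<open>0\<close> or \<open>\<pi>\<close> and are not turned.\<close>

definition turn :: "real \<Rightarrow> complex \<Rightarrow> real" where
  "turn h z = sgn (Im z) * (rational_angle h \<bar>Arg z\<bar> - \<bar>Arg z\<bar>)"

lemma turn_bound: "h > 0 \<Longrightarrow> \<bar>turn h z\<bar> < h"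
  using rational_angle(2)[of h "\<bar>Arg z\<bar>"] by (auto simp: turn_def abs_mult sgn_if)

lemma sgn_Im_eq_sgn_Arg:
  assumes "Im z \<noteq> 0"
  shows "sgn (Im z) = sgn (Arg z)"
proof -
  have z: "z \<noteq> 0" using assms by auto
  have s: "sin (Arg z) = Im z / cmod z" using sin_Arg[OF z] .
  have b: "- pi < Arg z" "Arg z \<le> pi" using Arg_bounded by auto
  have ne: "Arg z \<noteq> 0" "Arg z \<noteq> pi" using s assms z by auto
  show ?thesis
  proof (cases "Arg z > 0")
    case True
    then have "sin (Arg z) > 0" using b ne by (intro sin_gt_zero) auto
    then show ?thesis using True s z by (simp add: zero_less_divide_iff)
  next
    case False
    then have "sin (- Arg z) > 0" using b ne by (intro sin_gt_zero) auto
    then have "Im z < 0" using s z by (simp add: divide_less_0_iff)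
    then show ?thesis using False ne by simp
  qed
qed

lemma Arg_cnj_nonreal:
  assumes "Im z \<noteq> 0"
  shows "Arg (cnj z) = - Arg z"
proof (rule cis_Arg_unique)
  have z: "z \<noteq> 0" using assms by auto
  show "sgn (cnj z) = cis (- Arg z)"
    using cis_Arg[OF z] by (simp add: sgn_div_norm flip: cis_cnj)
  have "Arg z \<noteq> pi" using sin_Arg[OF z] assms z by auto
  then show "- pi < - Arg z" "- Arg z \<le> pi" using Arg_bounded[of z] by auto
qed

lemma turn_cnj: "turn h (cnj z) = - turn h z"
  by (cases "Im z = 0") (simp_all add: turn_def Arg_cnj_nonreal sgn_minus)

text \<open>Inverse and conjugate differ by a positive factor, so they have the same argument.\<close>

lemma turn_inverse: "turn h (inverse z) = - turn h z"
proof (cases "Im z = 0")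
  case True
  then show ?thesis by (simp add: turn_def)
next
  case False
  then have z: "z \<noteq> 0" by auto
  have n: "(cmod z)\<^sup>2 > 0" using z by simp
  have eq: "inverse z = cnj z / complex_of_real ((cmod z)\<^sup>2)"
    using complex_div_cnj[of 1 z] z by (simp add: divide_inverse)
  have "sgn (inverse z) = sgn (cnj z)"
    unfolding eq using z n by (simp add: sgn_div_norm norm_divide norm_mult field_simps scaleR_conv_of_real power2_eq_square)
  then have "Arg (inverse z) = Arg (cnj z)" using z by (simp add: Arg_def)
  moreover have "sgn (Im (inverse z)) = sgn (Im (cnj z))"
    unfolding eq using n by (simp add: Im_divide_of_real sgn_divide)
  ultimately have "turn h (inverse z) = turn h (cnj z)" by (simp add: turn_def)
  then show ?thesis by (simp add: turn_cnj)
qed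

lemma Arg_rational:
  assumes r: "r > 0" and q: "q \<in> \<rat>"
  shows "\<exists>q'\<in>\<rat>. Arg (rcis r (pi * q)) = pi * q'"
proof -
  define k where "k = \<lceil>(q - 1) / 2\<rceil>"
  define q' where "q' = q - 2 * of_int k"
  have k: "-1 < q'" "q' \<le> 1" 
  proof -
    have "of_int k - 1 < (q - 1) / 2 \<and> (q - 1) / 2 \<le> of_int k"
      unfolding k_def by (rule ceiling_correct)
    then show "-1 < q'" "q' \<le> 1" by (simp_all add: q'_def field_simps)
  qed
  have "Arg (rcis r (pi * q)) = pi * q'"
  proof (rule cis_Arg_unique)
    have "sgn (rcis r (pi * q)) = cis (pi * q)"
      using r by (simp add: rcis_def sgn_div_norm scaleR_conv_of_real norm_mult)
    also have "\<dots> = cis (pi * q') * cis (2 * pi * of_int k)"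
      by (simp only: cis_mult) (simp add: q'_def algebra_simps)
    finally show "sgn (rcis r (pi * q)) = cis (pi * q')" by simp
    have "pi * (-1) < pi * q'" using k by (intro mult_strict_left_mono) auto
    then show "- pi < pi * q'" by simp
    have "pi * q' \<le> pi * 1" using k by (intro mult_left_mono) auto
    then show "pi * q' \<le> pi" by simp
  qed
  then show ?thesis using q by (auto simp: q'_def)
qed

lemma Arg_turned_rational:
  assumes h: "h > 0" and z: "z \<noteq> 0"
  shows "\<exists>q\<in>\<rat>. Arg (z * cis (turn h z)) = pi * q"
proof -
  have "\<exists>q\<in>\<rat>. Arg z + turn h z = pi * q"
  proof (cases "Im z = 0")
    case True
    then have "sin (Arg z) = 0" using sin_Arg[OF z] by simp
    then obtain i :: int where i: "Arg z = of_int i * pi" using sin_zero_iff_int2 by blast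
    then show ?thesis using True by (intro bexI[of _ "of_int i"]) (auto simp: turn_def)
  next
    case False
    obtain q where q: "q \<in> \<rat>" "rational_angle h \<bar>Arg z\<bar> = pi * q" using rational_angle(1)[OF h] by blast
    have "Arg z = sgn (Im z) * \<bar>Arg z\<bar>"
      unfolding sgn_Im_eq_sgn_Arg[OF False] by (simp add: sgn_if)
    then have "Arg z + turn h z = sgn (Im z) * (pi * q)"
      unfolding turn_def q(2) by (simp add: algebra_simps)
    moreover have "sgn (Im z) * q \<in> \<rat>" using q(1) by (auto simp: sgn_if)
    ultimately show ?thesis by (intro bexI[of _ "sgn (Im z) * q"]) (auto simp: algebra_simps)
  qed
  then obtain q where q: "q \<in> \<rat>" "Arg z + turn h z = pi * q" by blast
  have "z * cis (turn h z) = rcis (cmod z) (Arg z) * cis (turn h z)" by (simp only: rcis_cmod_Arg)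
  also have "\<dots> = rcis (cmod z) (pi * q)" by (simp add: rcis_def cis_mult q(2) flip: mult.assoc)
  finally show ?thesis using Arg_rational[of "cmod z" q] z q(1) by auto
qed

lemma spectrum_cnj_closed:
  assumes M: "M \<in> carrier_mat n n" and z: "z \<in> complex_eigenvalues M"
  shows "cnj z \<in> complex_eigenvalues M"
proof -
  have "poly (map_poly complex_of_real (char_poly M)) (cnj z) =
      cnj (poly (map_poly complex_of_real (char_poly M)) z)"
    by (simp add: poly_altdef coeff_map_poly)
  then show ?thesis using z eigenvalue_iff_root[OF M] by simp
qed

lemma cis_close_to_1:
  assumes "e > 0"
  shows "\<exists>h>0. \<forall>x. \<bar>x\<bar> < h \<longrightarrow> cmod (cis x - 1) < e"
proof -
  have "continuous_on UNIV cis" using continuous_on_cis[OF continuous_on_id] by (simp add: id_def)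
  then have "isCont cis 0" by (simp add: continuous_on_eq_continuous_at)
  then obtain h where h: "h > 0" "\<And>x. x \<noteq> 0 \<Longrightarrow> \<bar>x\<bar> < h \<Longrightarrow> cmod (cis x - 1) < e"
    using LIM_D[of cis "cis 0" 0 e] assms by (auto simp: isCont_def)
  have "cmod (cis x - 1) < e" if "\<bar>x\<bar> < h" for x
    using h(2)[of x] that assms by (cases "x = 0") auto
  with h(1) show ?thesis by blast
qed

text \<open>The path is \<open>t \<mapsto> F (g t)\<close> with \<open>g t z = z cis (t \<psi>(z))\<close> and \<open>\<psi> = turn h\<close>. The set \<open>H\<close> stands for either of the two
kinds of constraint that the path respects: constant moduli and determinant, and invariance of
bilinear forms.\<close>

lemma rotate_to_rational_arguments:
  fixes M :: "real mat"
  assumes M: "M \<in> carrier_mat n n" "det M \<noteq> 0" and simple: "card (complex_eigenvalues M) = n"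
    and e: "e > 0"
    and H: "\<And>N. N \<in> same_moduli n M \<Longrightarrow>
        (\<And>J. J \<in> carrier_mat n n \<Longrightarrow> transpose_mat M * J * M = J \<Longrightarrow> transpose_mat N * J * N = J) \<Longrightarrow> N \<in> H"
  shows "\<exists>N. deformable n H e M N \<and> card (complex_eigenvalues N) = n \<and>
             (\<forall>z\<in>complex_eigenvalues N. \<exists>q\<in>\<rat>. Arg z = pi * q)"
proof -
  let ?C = "map_mat complex_of_real"
  define S where "S = complex_eigenvalues M"
  have finS: "finite S" using complex_char_poly_props(4)[OF M(1)] by (simp add: S_def)
  have cM: "?C M \<in> carrier_mat n n" using M by simp
  obtain P Q ls where PQ: "P \<in> carrier_mat n n" "Q \<in> carrier_mat n n" "P * Q = 1\<^sub>m n" "Q * P = 1\<^sub>m n"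
    and ls: "inj_on ls {..<n}" "ls ` {..<n} = S" and MF: "?C M = spectral_map P Q n ls (\<lambda>z. z)"
    using simple_spectrum_diagonalizable[OF cM] simple unfolding S_def complex_eigenvalues_def by blast
  interpret diagonalization n P Q ls by unfold_locales (use PQ in auto)
  have lsS: "ls k \<in> S" if "k < n" for k using ls(2) that by auto
  have nz: "z \<noteq> 0" if "z \<in> S" for z using that zero_not_eigenvalue[OF M] by (auto simp: S_def)
  \<comment> \<open>The displacement of \<open>F g\<close> is at most \<open>W\<close> times the largest relative displacement of an eigenvalue.\<close>
  define W where "W = (\<Sum>i<n. \<Sum>j<n. \<Sum>k<n. cmod (P $$ (i,k)) * cmod (ls k) * cmod (Q $$ (k,j)))"
  \<comment> \<open>A relative displacement \<open>r\<close> so small that the path is short and distinct eigenvalues stay distinct.\<close>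
  have "\<forall>\<^sub>F r in at_right 0. r > 0 \<and> W * r < e \<and>
      (\<forall>p\<in>S \<times> S. fst p \<noteq> snd p \<longrightarrow> (cmod (fst p) + cmod (snd p)) * r < cmod (fst p - snd p))"
  proof (intro eventually_conj eventually_ball_finite ballI)
    have small: "\<forall>\<^sub>F r in at_right 0. c * r < b" if "b > 0" for b c :: real
    proof -
      have "((\<lambda>r. c * r) \<longlongrightarrow> c * 0) (at_right 0)" by (intro tendsto_intros)
      then show ?thesis using order_tendstoD(2)[of _ "c * 0" _ b] that by simp
    qed
    show "\<forall>\<^sub>F r in at_right 0. (0::real) < r" by (rule eventually_at_right_less)
    show "\<forall>\<^sub>F r in at_right 0. W * r < e" by (rule small[OF e])
    show "finite (S \<times> S)" using finS by simp
    fix p assume "p \<in> S \<times> S"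
    show "\<forall>\<^sub>F r in at_right 0. fst p \<noteq> snd p \<longrightarrow> (cmod (fst p) + cmod (snd p)) * r < cmod (fst p - snd p)"
      by (cases "fst p = snd p") (auto intro!: small)
  qed
  from eventually_happens'[OF trivial_limit_at_right_real this]
  obtain r where r: "r > 0" "W * r < e"
    and sep: "\<And>p. p \<in> S \<times> S \<Longrightarrow> fst p \<noteq> snd p \<Longrightarrow> (cmod (fst p) + cmod (snd p)) * r < cmod (fst p - snd p)"
    by blast
  obtain h where h: "h > 0" "\<And>x. \<bar>x\<bar> < h \<Longrightarrow> cmod (cis x - 1) < r"
    using cis_close_to_1[OF r(1)] by blast
  define g where "g t z = z * cis (t * turn h z)" for t z
  have g_cnj: "g t (cnj z) = cnj (g t z)" for t z by (simp add: g_def turn_cnj cis_cnj)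
  have g_inv: "g t z * g t w = 1" if "z * w = 1" for t z w
  proof -
    have "w = inverse z" using that by (metis inverse_unique)
    then have "g t z * g t w = z * w * (cis (t * turn h z) * cis (- (t * turn h z)))"
      by (simp add: g_def turn_inverse)
    also have "\<dots> = 1" unfolding cis_mult by (simp add: that)
    finally show ?thesis .
  qed
  have g_close: "cmod (g t z - z) \<le> cmod z * r" if t: "t \<in> {0..1}" for t z
  proof -
    have "\<bar>t * turn h z\<bar> \<le> \<bar>turn h z\<bar>" using t by (auto simp: abs_mult mult_left_le_one_le)
    then have "cmod (cis (t * turn h z) - 1) < r" using h(2) turn_bound[OF h(1), of z] by (meson le_less_trans)
    moreover have "g t z - z = z * (cis (t * turn h z) - 1)" by (simp add: g_def algebra_simps)
    ultimately show ?thesis by (simp add: norm_mult mult_left_mono)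
  qed
  define \<Gamma> where "\<Gamma> t = map_mat Re (F (g t))" for t
  have \<Gamma>c: "\<Gamma> t \<in> carrier_mat n n" for t using F_carrier[of "g t"] by (simp add: \<Gamma>_def)
  have \<Gamma>F: "?C (\<Gamma> t) = F (g t)" for t
    unfolding \<Gamma>_def by (rule F_real[OF M(1) MF]) (rule g_cnj)
  have C_inj: "A = B" if "?C A = ?C B" for A B by (rule of_real_hom.mat_hom_inj[OF that])
  have g0: "g 0 = (\<lambda>z. z)" by (auto simp: g_def)
  have \<Gamma>0: "\<Gamma> 0 = M" by (rule C_inj) (simp add: \<Gamma>F MF g0)
  have roots: "proots (map_poly complex_of_real (char_poly (\<Gamma> t))) =
      image_mset (\<lambda>i. g t (ls i)) (mset_set {..<n})" for t
    using proots_F[of "g t"] char_poly_complexify[OF \<Gamma>c[of t]] by (simp add: \<Gamma>F)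
  have eig: "complex_eigenvalues (\<Gamma> t) = g t ` S" for t
    using complex_char_poly_props(3)[OF \<Gamma>c[of t]] by (simp add: roots ls(2)[symmetric] image_image)
  have moduli: "eigenvalue_moduli (\<Gamma> t) = image_mset (\<lambda>i. cmod (ls i)) (mset_set {..<n})" for t
    unfolding eigenvalue_moduli_char_poly[OF \<Gamma>c] roots
    by (simp add: g_def norm_mult multiset.map_comp comp_def)
  \<comment> \<open>The spectrum is closed under conjugation and \<open>turn\<close> is odd, so the total angle is zero. This fixes the determinant.\<close>
  have turn0: "(\<Sum>i<n. turn h (ls i)) = 0"
  proof -
    have "(\<Sum>i<n. turn h (ls i)) = (\<Sum>z\<in>S. turn h z)"
      unfolding ls(2)[symmetric] by (simp add: sum.reindex[OF ls(1)])
    moreover have "(\<Sum>z\<in>S. turn h z) = (\<Sum>z\<in>S. turn h (cnj z))"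
      by (rule sum.reindex_bij_witness[of _ cnj cnj]) (auto simp: S_def spectrum_cnj_closed[OF M(1)])
    moreover have "(\<Sum>z\<in>S. turn h (cnj z)) = - (\<Sum>z\<in>S. turn h z)" by (simp add: turn_cnj sum_negf)
    ultimately show ?thesis by linarith
  qed
  have cis_sum: "(\<Prod>i\<in>I. cis (f i)) = cis (\<Sum>i\<in>I. f i)" if "finite I" for I :: "nat set" and f
    using that by induction (auto simp: cis_mult)
  have det\<Gamma>: "det (\<Gamma> t) = det M" for t
  proof -
    have "complex_of_real (det (\<Gamma> t)) = det (F (g t))" by (simp flip: \<Gamma>F add: of_real_hom.hom_det)
    also have "\<dots> = (\<Prod>i<n. ls i) * (\<Prod>i<n. cis (t * turn h (ls i)))"
      unfolding det_F g_def by (rule prod.distrib)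
    also have "(\<Prod>i<n. cis (t * turn h (ls i))) = 1"
      by (simp add: cis_sum turn0 flip: sum_distrib_left)
    also have "(\<Prod>i<n. ls i) * 1 = complex_of_real (det M)"
      using det_F[of "\<lambda>z. z"] MF by (simp flip: of_real_hom.hom_det)
    finally show ?thesis by simp
  qed
  have "\<Gamma> t \<in> same_moduli n M" for t
    using \<Gamma>c det\<Gamma> moduli[of t] moduli[of 0] by (simp add: same_moduli_def \<Gamma>0)
  moreover have "transpose_mat (\<Gamma> t) * J * \<Gamma> t = J"
    if J: "J \<in> carrier_mat n n" "transpose_mat M * J * M = J" for J t
  proof (rule C_inj)
    have hom: "?C (transpose_mat X * J * X) = transpose_mat (?C X) * ?C J * ?C X"
      if "X \<in> carrier_mat n n" for X
      using that J(1) by (simp add: of_real_hom.mat_hom_mult[of _ n n _ n] map_mat_transpose)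
    have "transpose_mat (F (g t)) * ?C J * F (g t) = ?C J"
    proof (rule F_preserves_form)
      show "transpose_mat (F (\<lambda>z. z)) * ?C J * F (\<lambda>z. z) = ?C J"
        unfolding MF[symmetric] using hom[OF M(1)] J(2) by simp
    qed (use J(1) g_inv in auto)
    then show "?C (transpose_mat (\<Gamma> t) * J * \<Gamma> t) = ?C J"
      using hom[OF \<Gamma>c[of t]] by (simp add: \<Gamma>F)
  qed
  ultimately have \<Gamma>H: "\<Gamma> t \<in> H" for t using H by blast
  have entry: "\<Gamma> t $$ (i,j) = Re (\<Sum>k<n. P $$ (i,k) * g t (ls k) * Q $$ (k,j))"
    if "i < n" "j < n" for t i j
    using that F_entry[OF that, of "g t"] F_carrier[of "g t"] by (simp add: \<Gamma>_def)
  have close: "entry_norm (\<Gamma> t - M) < e" if t: "t \<in> {0..1}" for t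
  proof -
    have "\<bar>(\<Gamma> t - M) $$ (i,j)\<bar> \<le> (\<Sum>k<n. cmod (P $$ (i,k)) * cmod (ls k) * cmod (Q $$ (k,j))) * r"
      if ij: "i < n" "j < n" for i j
    proof -
      have "(\<Gamma> t - M) $$ (i,j) = \<Gamma> t $$ (i,j) - \<Gamma> 0 $$ (i,j)" using ij M \<Gamma>c \<Gamma>0 by simp
      also have "\<dots> = Re (\<Sum>k<n. P $$ (i,k) * (g t (ls k) - ls k) * Q $$ (k,j))"
        unfolding entry[OF ij] g0 by (simp add: algebra_simps sum_subtractf)
      finally have "\<bar>(\<Gamma> t - M) $$ (i,j)\<bar> \<le> cmod (\<Sum>k<n. P $$ (i,k) * (g t (ls k) - ls k) * Q $$ (k,j))"
        by (simp only: abs_Re_le_cmod)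
      also have "\<dots> \<le> (\<Sum>k<n. cmod (P $$ (i,k)) * cmod (g t (ls k) - ls k) * cmod (Q $$ (k,j)))"
        by (rule order_trans[OF norm_sum]) (simp add: norm_mult)
      also have "\<dots> \<le> (\<Sum>k<n. cmod (P $$ (i,k)) * (cmod (ls k) * r) * cmod (Q $$ (k,j)))"
        by (intro sum_mono mult_right_mono mult_left_mono g_close t) auto
      finally show ?thesis unfolding sum_distrib_right by (simp add: mult_ac)
    qed
    then have "entry_norm (\<Gamma> t - M) \<le> (\<Sum>i<n. \<Sum>j<n. (\<Sum>k<n. cmod (P $$ (i,k)) * cmod (ls k) * cmod (Q $$ (k,j))) * r)"
      unfolding entry_norm_carrier[OF minus_carrier_mat[OF M(1)]] by (intro sum_mono) auto
    also have "\<dots> = W * r" by (simp add: W_def sum_distrib_right)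
    finally show ?thesis using r(2) by simp
  qed
  have cont: "continuous_on {0..1} (\<lambda>t. \<Gamma> t $$ (i,j))" if ij: "i < n" "j < n" for i j
    unfolding entry[OF ij] g_def by (intro continuous_intros)
  have "deformable n H e M (\<Gamma> 1)"
    unfolding deformable_def using \<Gamma>H close cont \<Gamma>0 by (intro exI[of _ \<Gamma>]) auto
  moreover have "inj_on (g 1) S"
  proof (rule inj_onI, rule ccontr)
    fix z w assume zw: "z \<in> S" "w \<in> S" "g 1 z = g 1 w" "z \<noteq> w"
    have "z - w = (g 1 w - w) - (g 1 z - z)" using zw(3) by simp
    then have "cmod (z - w) \<le> cmod (g 1 w - w) + cmod (g 1 z - z)" by (metis norm_triangle_ineq4)
    also have "\<dots> \<le> (cmod z + cmod w) * r"
      using g_close[of 1 z] g_close[of 1 w] by (simp add: algebra_simps)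
    finally show False using sep[of "(z, w)"] zw by simp
  qed
  then have "card (complex_eigenvalues (\<Gamma> 1)) = n"
    unfolding eig using simple by (simp add: card_image S_def)
  moreover have "\<exists>q\<in>\<rat>. Arg z = pi * q" if "z \<in> complex_eigenvalues (\<Gamma> 1)" for z
    using that Arg_turned_rational[OF h(1)] nz unfolding eig by (auto simp: g_def)
  ultimately show ?thesis by blast
qed

section \<open>Transvections join symplectic matrices to the identity\<close>

text \<open>The matrix \<open>R\<close> of polynomials is a path in \<open>G\<close> with polynomial entries, from the identity to \<open>X\<close>.\<close>

definition polynomially_joined :: "nat \<Rightarrow> real mat set \<Rightarrow> real mat \<Rightarrow> bool" where
  "polynomially_joined d G X \<longleftrightarrow> (\<exists>R\<in>carrier_mat d d.
     (\<forall>s. map_mat (\<lambda>p. poly p s) R \<in> G) \<and>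
     map_mat (\<lambda>p. poly p 0) R = 1\<^sub>m d \<and> map_mat (\<lambda>p. poly p 1) R = X)"

lemma polynomially_joined_mem: "polynomially_joined d G X \<Longrightarrow> X \<in> G"
  unfolding polynomially_joined_def by blast

lemma polynomially_joined_one:
  assumes "1\<^sub>m d \<in> G"
  shows "polynomially_joined d G (1\<^sub>m d)"
proof -
  have "map_mat (\<lambda>p. poly p s) (1\<^sub>m d) = (1\<^sub>m d :: real mat)" for s by (intro eq_matI) auto
  then show ?thesis unfolding polynomially_joined_def using assms by (intro bexI[of _ "1\<^sub>m d"]) auto
qed

lemma polynomially_joined_mult:
  assumes G: "\<And>X Y. X \<in> G \<Longrightarrow> Y \<in> G \<Longrightarrow> X * Y \<in> G"
    and X: "polynomially_joined d G X" and Y: "polynomially_joined d G Y"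
  shows "polynomially_joined d G (X * Y)"
proof -
  from X obtain R where R: "R \<in> carrier_mat d d" "\<And>s. map_mat (\<lambda>p. poly p s) R \<in> G"
      "map_mat (\<lambda>p. poly p 0) R = 1\<^sub>m d" "map_mat (\<lambda>p. poly p 1) R = X"
    unfolding polynomially_joined_def by blast
  from Y obtain R' where R': "R' \<in> carrier_mat d d" "\<And>s. map_mat (\<lambda>p. poly p s) R' \<in> G"
      "map_mat (\<lambda>p. poly p 0) R' = 1\<^sub>m d" "map_mat (\<lambda>p. poly p 1) R' = Y"
    unfolding polynomially_joined_def by blast
  have "map_mat (\<lambda>p. poly p s) (R * R') = map_mat (\<lambda>p. poly p s) R * map_mat (\<lambda>p. poly p s) R'" for s
  proof -
    have "semiring_hom (\<lambda>p :: real poly. poly p s)" by unfold_locales auto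
    then show ?thesis by (rule semiring_hom.mat_hom_mult[OF _ R(1) R'(1)])
  qed
  then show ?thesis
    unfolding polynomially_joined_def using R R' G by (intro bexI[of _ "R * R'"]) auto
qed

locale symplectic_space =
  fixes d :: nat and J :: "real mat"
  assumes J: "J \<in> carrier_mat d d" and skew: "transpose_mat J = - J"
begin

definition form :: "real vec \<Rightarrow> real vec \<Rightarrow> real" where
  "form u v = u \<bullet> (J *\<^sub>v v)"

definition Sp :: "real mat set" where
  "Sp = {A \<in> carrier_mat d d. transpose_mat A * J * A = J}"

lemma form_add_left:
  "u \<in> carrier_vec d \<Longrightarrow> v \<in> carrier_vec d \<Longrightarrow> w \<in> carrier_vec d \<Longrightarrow> form (u + v) w = form u w + form v w"
  unfolding form_def using J by (intro add_scalar_prod_distrib[of _ d]) auto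

lemma form_add_right:
  "u \<in> carrier_vec d \<Longrightarrow> v \<in> carrier_vec d \<Longrightarrow> w \<in> carrier_vec d \<Longrightarrow> form u (v + w) = form u v + form u w"
  unfolding form_def using J
  by (simp add: mult_add_distrib_mat_vec[of _ d d] scalar_prod_add_distrib[of _ d])

lemma form_smult_left:
  "u \<in> carrier_vec d \<Longrightarrow> v \<in> carrier_vec d \<Longrightarrow> form (c \<cdot>\<^sub>v u) v = c * form u v"
  unfolding form_def using J by simp

lemma form_smult_right:
  "u \<in> carrier_vec d \<Longrightarrow> v \<in> carrier_vec d \<Longrightarrow> form u (c \<cdot>\<^sub>v v) = c * form u v"
  unfolding form_def using J by (simp add: mult_mat_vec[of _ d d])

lemma form_swap:
  assumes "u \<in> carrier_vec d" "v \<in> carrier_vec d"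
  shows "form v u = - form u v"
proof -
  have "form u v = (transpose_mat J *\<^sub>v u) \<bullet> v"
    unfolding form_def using J assms by (simp add: transpose_vec_mult_scalar[of J d d])
  also have "transpose_mat J *\<^sub>v u = - (J *\<^sub>v u)"
    unfolding skew using J assms by (intro eq_vecI) auto
  also have "- (J *\<^sub>v u) \<bullet> v = - form v u"
    unfolding form_def using J assms by (simp add: comm_scalar_prod[of v d])
  finally show ?thesis by simp
qed

lemma form_self: "u \<in> carrier_vec d \<Longrightarrow> form u u = 0"
  using form_swap[of u u] by simp

lemma form_minus_left:
  "u \<in> carrier_vec d \<Longrightarrow> v \<in> carrier_vec d \<Longrightarrow> w \<in> carrier_vec d \<Longrightarrow> form (u - v) w = form u w - form v w"
  unfolding form_def using J by (simp add: minus_scalar_prod_distrib[of _ d])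

lemma Sp_carrier: "A \<in> Sp \<Longrightarrow> A \<in> carrier_mat d d"
  by (simp add: Sp_def)

lemma form_pullback:
  assumes A: "A \<in> carrier_mat d d" and u: "u \<in> carrier_vec d" and v: "v \<in> carrier_vec d"
  shows "form (A *\<^sub>v u) (A *\<^sub>v v) = u \<bullet> ((transpose_mat A * J * A) *\<^sub>v v)"
proof -
  have c: "J *\<^sub>v (A *\<^sub>v v) \<in> carrier_vec d" using A J v by simp
  have "form (A *\<^sub>v u) (A *\<^sub>v v) = (J *\<^sub>v (A *\<^sub>v v)) \<bullet> (A *\<^sub>v u)"
    unfolding form_def using A u c by (intro comm_scalar_prod[of _ d]) auto
  also have "\<dots> = (transpose_mat A *\<^sub>v (J *\<^sub>v (A *\<^sub>v v))) \<bullet> u"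
    using transpose_vec_mult_scalar[OF A u c] by simp
  also have "transpose_mat A *\<^sub>v (J *\<^sub>v (A *\<^sub>v v)) = (transpose_mat A * J * A) *\<^sub>v v"
    using A J v by (simp add: assoc_mult_mat_vec[of _ d d _ d])
  also have "\<dots> \<bullet> u = u \<bullet> ((transpose_mat A * J * A) *\<^sub>v v)"
    using A J u v by (intro comm_scalar_prod[of _ d] mult_mat_vec_carrier[of _ d d]) auto
  finally show ?thesis .
qed

lemma Sp_iff:
  "A \<in> Sp \<longleftrightarrow> A \<in> carrier_mat d d \<and>
     (\<forall>u\<in>carrier_vec d. \<forall>v\<in>carrier_vec d. form (A *\<^sub>v u) (A *\<^sub>v v) = form u v)"
proof (cases "A \<in> carrier_mat d d")
  case A: True
  have "transpose_mat A * J * A = J"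
    if h: "\<forall>u\<in>carrier_vec d. \<forall>v\<in>carrier_vec d. form (A *\<^sub>v u) (A *\<^sub>v v) = form u v"
  proof (rule eq_matI)
    fix i j assume "i < dim_row J" "j < dim_col J"
    then have ij: "i < d" "j < d" using J by auto
    have entry: "unit_vec d i \<bullet> (B *\<^sub>v unit_vec d j) = B $$ (i,j)" if "B \<in> carrier_mat d d" for B :: "real mat"
      using that ij by (simp add: mult_mat_vec_unit[of _ d d])
    have c: "transpose_mat A * J * A \<in> carrier_mat d d" using A J by simp
    have "(transpose_mat A * J * A) $$ (i,j) = form (A *\<^sub>v unit_vec d i) (A *\<^sub>v unit_vec d j)"
      using entry[OF c] form_pullback[OF A] by simp
    also have "\<dots> = form (unit_vec d i) (unit_vec d j)" using h by simp
    also have "\<dots> = J $$ (i,j)" unfolding form_def by (rule entry[OF J])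
    finally show "(transpose_mat A * J * A) $$ (i,j) = J $$ (i,j)" .
  qed (use A J in auto)
  then show ?thesis using A form_pullback[OF A] by (auto simp: Sp_def form_def)
qed (simp add: Sp_def)

lemma Sp_form:
  "A \<in> Sp \<Longrightarrow> u \<in> carrier_vec d \<Longrightarrow> v \<in> carrier_vec d \<Longrightarrow> form (A *\<^sub>v u) (A *\<^sub>v v) = form u v"
  by (simp add: Sp_iff)

lemma Sp_mult: "A \<in> Sp \<Longrightarrow> B \<in> Sp \<Longrightarrow> A * B \<in> Sp"
  unfolding Sp_iff by (auto simp: assoc_mult_mat_vec[of _ d d _ d])

lemma Sp_one: "1\<^sub>m d \<in> Sp"
  unfolding Sp_iff by auto

text \<open>The matrix of \<open>v \<mapsto> v + c \<omega>(u,v) u\<close>, where \<open>\<omega>\<close> is the form.\<close>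

definition transvection :: "real \<Rightarrow> real vec \<Rightarrow> real mat" where
  "transvection c u = mat d d (\<lambda>(i,j). of_bool (i = j) + c * (u $ i * (transpose_mat J *\<^sub>v u) $ j))"

lemma transvection_mult_vec:
  assumes u: "u \<in> carrier_vec d" and v: "v \<in> carrier_vec d"
  shows "transvection c u *\<^sub>v v = v + (c * form u v) \<cdot>\<^sub>v u"
proof (rule eq_vecI)
  fix i assume "i < dim_vec (v + (c * form u v) \<cdot>\<^sub>v u)"
  then have i: "i < d" using u by simp
  define w where "w = transpose_mat J *\<^sub>v u"
  have w: "w \<in> carrier_vec d" using J u by (simp add: w_def)
  have "form u v = w \<bullet> v"
    unfolding form_def w_def using transpose_vec_mult_scalar[OF J v u] by simp
  then have form: "form u v = (\<Sum>j<d. w $ j * v $ j)"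
    using v by (simp add: scalar_prod_def atLeast0LessThan)
  have "(transvection c u *\<^sub>v v) $ i = (\<Sum>j<d. (of_bool (i = j) + c * (u $ i * w $ j)) * v $ j)"
    using i v by (simp add: transvection_def w_def scalar_prod_def atLeast0LessThan)
  also have "\<dots> = (\<Sum>j<d. (if i = j then v $ j else 0) + c * u $ i * (w $ j * v $ j))"
    by (intro sum.cong) (auto simp: algebra_simps)
  also have "\<dots> = v $ i + c * u $ i * form u v"
    using i by (simp add: sum.distrib form sum_distrib_left)
  finally show "(transvection c u *\<^sub>v v) $ i = (v + (c * form u v) \<cdot>\<^sub>v u) $ i"
    using i u v by simp
qed (use u v in \<open>auto simp: transvection_def\<close>)

lemma transvection_Sp:
  assumes u: "u \<in> carrier_vec d"
  shows "transvection c u \<in> Sp"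
  unfolding Sp_iff
proof (intro conjI ballI)
  show "transvection c u \<in> carrier_mat d d" by (simp add: transvection_def)
  fix x y :: "real vec" assume x: "x \<in> carrier_vec d" and y: "y \<in> carrier_vec d"
  show "form (transvection c u *\<^sub>v x) (transvection c u *\<^sub>v y) = form x y"
    unfolding transvection_mult_vec[OF u x] transvection_mult_vec[OF u y]
    using u x y form_swap[OF u x] form_self[OF u]
    by (simp add: form_add_left form_add_right form_smult_left form_smult_right)
qed

text \<open>The entries are affine in \<open>c\<close>, so scaling \<open>c\<close> is a path to the identity.\<close>

lemma transvection_joined:
  assumes u: "u \<in> carrier_vec d"
  shows "polynomially_joined d Sp (transvection c u)"
proof -
  define R where "R = mat d d (\<lambda>(i,j). [: of_bool (i = j), c * (u $ i * (transpose_mat J *\<^sub>v u) $ j) :])"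
  have R: "map_mat (\<lambda>p. poly p s) R = transvection (s * c) u" for s
    by (intro eq_matI) (auto simp: R_def transvection_def)
  have Rc: "R \<in> carrier_mat d d" by (simp add: R_def)
  have "transvection 0 u = 1\<^sub>m d" by (intro eq_matI) (auto simp: transvection_def)
  then show ?thesis
    unfolding polynomially_joined_def using transvection_Sp[OF u] Rc
    by (intro bexI[of _ R]) (auto simp: R)
qed

text \<open>The transvection along \<open>u = v - w\<close> with \<open>c = - 1 / \<omega>(u,v)\<close> sends \<open>v\<close> to \<open>v - u = w\<close>, and it fixes
everything orthogonal to \<open>u\<close>.\<close>

lemma move_vector:
  assumes v: "v \<in> carrier_vec d" and w: "w \<in> carrier_vec d" and vw: "form v w \<noteq> 0"
    and F: "\<And>f. f \<in> F \<Longrightarrow> f \<in> carrier_vec d \<and> form v f = form w f"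
  shows "\<exists>T. polynomially_joined d Sp T \<and> T *\<^sub>v v = w \<and> (\<forall>f\<in>F. T *\<^sub>v f = f)"
proof -
  define u where "u = v - w"
  have u: "u \<in> carrier_vec d" using v w by (simp add: u_def)
  have uv: "form u v = form v w"
    unfolding u_def using form_minus_left[OF v w v] form_self[OF v] form_swap[OF v w] by simp
  define T where "T = transvection (- 1 / form u v) u"
  have "T *\<^sub>v v = w"
    unfolding T_def transvection_mult_vec[OF u v] uv using vw v w
    by (intro eq_vecI) (auto simp: u_def)
  moreover have "T *\<^sub>v f = f" if "f \<in> F" for f
  proof -
    have f: "f \<in> carrier_vec d" "form u f = 0"
      using F[OF that] form_minus_left[OF v w, of f] by (auto simp: u_def)
    show ?thesis unfolding T_def transvection_mult_vec[OF u f(1)] using f u by (intro eq_vecI) auto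
  qed
  ultimately show ?thesis using transvection_joined[OF u] unfolding T_def by blast
qed

text \<open>A detour through \<open>z\<close> for the case that \<open>v\<close> and \<open>w\<close> are orthogonal.\<close>

lemma move_vector_via:
  assumes v: "v \<in> carrier_vec d" and z: "z \<in> carrier_vec d" and w: "w \<in> carrier_vec d"
    and "form v z \<noteq> 0" "form z w \<noteq> 0"
    and F: "\<And>f. f \<in> F \<Longrightarrow> f \<in> carrier_vec d \<and> form v f = form w f \<and> form z f = form w f"
  shows "\<exists>T. polynomially_joined d Sp T \<and> T *\<^sub>v v = w \<and> (\<forall>f\<in>F. T *\<^sub>v f = f)"
proof -
  obtain T where T: "polynomially_joined d Sp T" "T *\<^sub>v v = z" "\<forall>f\<in>F. T *\<^sub>v f = f"
    using move_vector[OF v z assms(4), of F] F by auto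
  obtain T' where T': "polynomially_joined d Sp T'" "T' *\<^sub>v z = w" "\<forall>f\<in>F. T' *\<^sub>v f = f"
    using move_vector[OF z w assms(5), of F] F by auto
  have c: "T \<in> carrier_mat d d" "T' \<in> carrier_mat d d"
    using T(1) T'(1) by (auto dest: polynomially_joined_mem Sp_carrier)
  have "polynomially_joined d Sp (T' * T)"
    using polynomially_joined_mult[OF Sp_mult T'(1) T(1)] .
  moreover have "(T' * T) *\<^sub>v v = w" using c v T T' by (simp add: assoc_mult_mat_vec[of _ d d _ d])
  moreover have "(T' * T) *\<^sub>v f = f" if "f \<in> F" for f
    using c F[OF that] that T T' by (simp add: assoc_mult_mat_vec[of _ d d _ d])
  ultimately show ?thesis by blast
qed

text \<open>First \<open>N e\<close> is moved back to \<open>e\<close>, then the image of \<open>f\<close> to \<open>f\<close>, each time by transvections that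
fix the vectors treated before. Where a detour is needed, an intermediate vector is at hand.\<close>

lemma fix_hyperbolic_pair:
  assumes N: "N \<in> Sp" and e: "e \<in> carrier_vec d" and f: "f \<in> carrier_vec d" and ef: "form e f = 1"
    and F: "\<And>g. g \<in> F \<Longrightarrow> g \<in> carrier_vec d \<and> N *\<^sub>v g = g \<and> form e g = 0 \<and> form f g = 0"
  shows "\<exists>T. polynomially_joined d Sp T \<and> (\<forall>g\<in>F \<union> {e, f}. (T * N) *\<^sub>v g = g)"
proof -
  note cN = Sp_carrier[OF N]
  define v where "v = N *\<^sub>v e"
  define z where "z = N *\<^sub>v f"
  have c: "v \<in> carrier_vec d" "z \<in> carrier_vec d" using cN e f by (auto simp: v_def z_def)
  have vz: "form v z = 1" unfolding v_def z_def using Sp_form[OF N e f] ef by simp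
  have vF: "form v g = 0" "form z g = 0" if "g \<in> F" for g
    using Sp_form[OF N e, of g] Sp_form[OF N f, of g] F[OF that] by (auto simp: v_def z_def)
  have fe: "form f e = - 1" using form_swap[OF e f] ef by simp
  have "\<exists>T. polynomially_joined d Sp T \<and> T *\<^sub>v v = e \<and> (\<forall>g\<in>F. T *\<^sub>v g = g)"
  proof (cases "form v e = 0")
    case False
    then show ?thesis using move_vector[OF c(1) e, of F] vF F by auto
  next
    case ve: True
    \<comment> \<open>The vector \<open>z = N f\<close> pairs with \<open>v = N e\<close>, and \<open>f\<close> pairs with \<open>e\<close>; one of \<open>z\<close>, \<open>f\<close> and \<open>z + f\<close> pairs with both.\<close>
    have "\<exists>y\<in>carrier_vec d. form v y \<noteq> 0 \<and> form y e \<noteq> 0 \<and> (\<forall>g\<in>F. form y g = 0)"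
    proof (cases "form z e = 0 \<and> form v f = 0")
      case True
      have "form v (z + f) \<noteq> 0" using form_add_right[OF c(1) c(2) f] vz True by simp
      moreover have "form (z + f) e \<noteq> 0" using form_add_left[OF c(2) f e] True fe by simp
      moreover have "form (z + f) g = 0" if "g \<in> F" for g
        using form_add_left[OF c(2) f, of g] vF(2)[OF that] F[OF that] by simp
      ultimately show ?thesis using c f by (intro bexI[of _ "z + f"]) auto
    next
      case False
      then show ?thesis
      proof (cases "form z e = 0")
        case True
        then show ?thesis using False fe F f by (intro bexI[of _ f]) auto
      qed (use vz vF c in \<open>auto intro!: bexI[of _ z]\<close>)
    qed
    then obtain y where y: "y \<in> carrier_vec d" "form v y \<noteq> 0" "form y e \<noteq> 0" "\<And>g. g \<in> F \<Longrightarrow> form y g = 0"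
      by blast
    show ?thesis by (rule move_vector_via[OF c(1) y(1) e y(2,3)]) (use vF F y(4) in auto)
  qed
  then obtain T where T: "polynomially_joined d Sp T" "T *\<^sub>v v = e" "\<forall>g\<in>F. T *\<^sub>v g = g" by blast
  have TS: "T \<in> Sp" using polynomially_joined_mem[OF T(1)] .
  note cT = Sp_carrier[OF TS]
  define N' where "N' = T * N"
  have N': "N' \<in> Sp" unfolding N'_def by (rule Sp_mult[OF TS N])
  note cN' = Sp_carrier[OF N']
  have fixe: "N' *\<^sub>v e = e" using T(2) cT cN e by (simp add: N'_def v_def assoc_mult_mat_vec[of _ d d _ d])
  have fixF: "N' *\<^sub>v g = g" if "g \<in> F" for g
    using T(3) cT cN F[OF that] that by (simp add: N'_def assoc_mult_mat_vec[of _ d d _ d])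
  define w where "w = N' *\<^sub>v f"
  have w: "w \<in> carrier_vec d" using cN' f by (simp add: w_def)
  have we: "form w e = - 1" using Sp_form[OF N' f e] fe fixe by (simp add: w_def)
  have wF: "form w g = 0" if "g \<in> F" for g using Sp_form[OF N' f, of g] F[OF that] fixF[OF that] by (simp add: w_def)
  have "\<exists>T. polynomially_joined d Sp T \<and> T *\<^sub>v w = f \<and> (\<forall>g\<in>insert e F. T *\<^sub>v g = g)"
  proof (cases "form w f = 0")
    case False
    show ?thesis by (rule move_vector[OF w f False]) (use we fe wF F e in auto)
  next
    case True
    \<comment> \<open>Here \<open>w + e\<close> serves as the intermediate vector, as \<open>\<omega>(w,e) = - 1\<close> and \<open>\<omega>(e,f) = 1\<close>.\<close>
    have we': "w + e \<in> carrier_vec d" using w e by simp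
    show ?thesis
    proof (rule move_vector_via[OF w we' f])
      show "form w (w + e) \<noteq> 0" using form_add_right[OF w w e] form_self[OF w] we by simp
      show "form (w + e) f \<noteq> 0" using form_add_left[OF w e f] True ef by simp
      fix g assume "g \<in> insert e F"
      then show "g \<in> carrier_vec d \<and> form w g = form f g \<and> form (w + e) g = form f g"
        using form_add_left[OF w e, of g] we fe wF F e form_self[OF e] by auto
    qed
  qed
  then obtain T' where T': "polynomially_joined d Sp T'" "T' *\<^sub>v w = f" "\<forall>g\<in>insert e F. T' *\<^sub>v g = g" by blast
  note cT' = Sp_carrier[OF polynomially_joined_mem[OF T'(1)]]
  have joined: "polynomially_joined d Sp (T' * T)"
    using polynomially_joined_mult[OF Sp_mult T'(1) T(1)] .
  have "(T' * T * N) *\<^sub>v g = T' *\<^sub>v (N' *\<^sub>v g)" if "g \<in> carrier_vec d" for g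
    using that cT cT' cN by (simp add: N'_def assoc_mult_mat_vec[of _ d d _ d])
  then have "(T' * T * N) *\<^sub>v g = g" if "g \<in> F \<union> {e, f}" for g
    using that F fixF fixe T'(2,3) e f by (auto simp: w_def)
  with joined show ?thesis by blast
qed

end

lemma symplectic_form_entry:
  assumes "i < 2 * m" "j < 2 * m"
  shows "symplectic_form m $$ (i,j) =
     (if i < m then of_bool (j = i + m) else - of_bool (i = j + m))"
  using assms by (auto simp: symplectic_form_def)

lemma symplectic_form_carrier: "symplectic_form m \<in> carrier_mat (2 * m) (2 * m)"
  unfolding symplectic_form_def mult_2 by (rule four_block_carrier_mat) auto

lemma symplectic_space_standard: "symplectic_space (2 * m) (symplectic_form m)"
proof
  show "symplectic_form m \<in> carrier_mat (2 * m) (2 * m)" by (rule symplectic_form_carrier)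
  show "transpose_mat (symplectic_form m) = - symplectic_form m"
  proof (rule eq_matI)
    fix i j assume "i < dim_row (- symplectic_form m)" "j < dim_col (- symplectic_form m)"
    then have ij: "i < 2 * m" "j < 2 * m" using symplectic_form_carrier[of m] by auto
    then show "transpose_mat (symplectic_form m) $$ (i,j) = (- symplectic_form m) $$ (i,j)"
      using symplectic_form_carrier[of m] symplectic_form_entry[OF ij] symplectic_form_entry[OF ij(2,1)]
      by auto
  qed (use symplectic_form_carrier[of m] in auto)
qed

lemma symplectic_eq_Sp: "symplectic (2 * m) = symplectic_space.Sp (2 * m) (symplectic_form m)"
proof -
  interpret symplectic_space "2 * m" "symplectic_form m" by (rule symplectic_space_standard)
  show ?thesis by (auto simp: symplectic_def Sp_def)
qed

text \<open>The pairs \<open>e\<^sub>k, e\<^sub>k\<^sub>+\<^sub>m\<close> of the standard basis are fixed one after the other. All matrices keep the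
size \<open>2 m\<close>: the part already treated is fixed pointwise instead of being split off.\<close>

lemma symplectic_reduction:
  assumes M: "M \<in> symplectic (2 * m)"
  shows "\<exists>T. polynomially_joined (2 * m) (symplectic (2 * m)) T \<and> T * M = 1\<^sub>m (2 * m)"
proof -
  interpret symplectic_space "2 * m" "symplectic_form m" by (rule symplectic_space_standard)
  let ?e = "\<lambda>i. unit_vec (2 * m) i :: real vec"
  have MS: "M \<in> Sp" using M by (simp add: symplectic_eq_Sp)
  note cM = Sp_carrier[OF MS]
  have form_e: "form (?e i) (?e j) = symplectic_form m $$ (i,j)" if "i < 2 * m" "j < 2 * m" for i j
    using that symplectic_form_carrier[of m]
    by (simp add: form_def mult_mat_vec_unit[of _ "2 * m" "2 * m"])
  have "\<exists>T. polynomially_joined (2 * m) Sp T \<and>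
          (\<forall>i<k. (T * M) *\<^sub>v ?e i = ?e i \<and> (T * M) *\<^sub>v ?e (i + m) = ?e (i + m))" if "k \<le> m" for k
    using that
  proof (induction k)
    case 0
    show ?case using polynomially_joined_one[OF Sp_one] by blast
  next
    case (Suc k)
    then obtain T where T: "polynomially_joined (2 * m) Sp T"
      "\<And>i. i < k \<Longrightarrow> (T * M) *\<^sub>v ?e i = ?e i" "\<And>i. i < k \<Longrightarrow> (T * M) *\<^sub>v ?e (i + m) = ?e (i + m)" by auto
    have TS: "T \<in> Sp" by (rule polynomially_joined_mem[OF T(1)])
    note cT = Sp_carrier[OF TS]
    define F where "F = ?e ` {..<k} \<union> (\<lambda>i. ?e (i + m)) ` {..<k}"
    have "\<exists>T'. polynomially_joined (2 * m) Sp T' \<and>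
        (\<forall>g\<in>F \<union> {?e k, ?e (k + m)}. (T' * (T * M)) *\<^sub>v g = g)"
    proof (rule fix_hyperbolic_pair)
      show "T * M \<in> Sp" by (rule Sp_mult[OF TS MS])
      show "form (?e k) (?e (k + m)) = 1" using Suc.prems by (simp add: form_e symplectic_form_entry)
      fix g assume "g \<in> F"
      then obtain i where i: "i < k" "g = ?e i \<or> g = ?e (i + m)" by (auto simp: F_def)
      then show "g \<in> carrier_vec (2 * m) \<and> (T * M) *\<^sub>v g = g \<and> form (?e k) g = 0 \<and> form (?e (k + m)) g = 0"
        using Suc.prems T(2,3)[OF i(1)] by (auto simp: form_e symplectic_form_entry)
    qed auto
    then obtain T' where T': "polynomially_joined (2 * m) Sp T'"
      "\<And>g. g \<in> F \<union> {?e k, ?e (k + m)} \<Longrightarrow> (T' * (T * M)) *\<^sub>v g = g" by blast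
    note cT' = Sp_carrier[OF polynomially_joined_mem[OF T'(1)]]
    have "polynomially_joined (2 * m) Sp (T' * T)"
      using polynomially_joined_mult[OF Sp_mult T'(1) T(1)] .
    moreover have "T' * T * M = T' * (T * M)" using cT cT' cM by simp
    moreover have "?e i \<in> F \<union> {?e k, ?e (k + m)} \<and> ?e (i + m) \<in> F \<union> {?e k, ?e (k + m)}" if "i < Suc k" for i
      using that by (auto simp: F_def less_Suc_eq)
    ultimately show ?case using T'(2) by (intro exI[of _ "T' * T"]) auto
  qed
  then obtain T where T: "polynomially_joined (2 * m) Sp T"
    "\<And>i. i < m \<Longrightarrow> (T * M) *\<^sub>v ?e i = ?e i" "\<And>i. i < m \<Longrightarrow> (T * M) *\<^sub>v ?e (i + m) = ?e (i + m)" by blast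
  have c: "T * M \<in> carrier_mat (2 * m) (2 * m)"
    using Sp_carrier[OF polynomially_joined_mem[OF T(1)]] cM by simp
  have "(T * M) *\<^sub>v ?e j = ?e j" if "j < 2 * m" for j
  proof (cases "j < m")
    case False
    then show ?thesis using T(3)[of "j - m"] that by simp
  qed (rule T(2))
  then have col: "col (T * M) j = ?e j" if "j < 2 * m" for j
    using that mult_mat_vec_unit[OF c that] by simp
  have "T * M = 1\<^sub>m (2 * m)"
  proof (rule eq_matI)
    fix i j assume "i < dim_row (1\<^sub>m (2 * m) :: real mat)" "j < dim_col (1\<^sub>m (2 * m) :: real mat)"
    then have ij: "i < 2 * m" "j < 2 * m" by auto
    have "(T * M) $$ (i,j) = col (T * M) j $ i" using ij c by (intro index_col[symmetric]) auto
    then show "(T * M) $$ (i,j) = 1\<^sub>m (2 * m) $$ (i,j)"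
      unfolding col[OF ij(2)] using ij by (simp add: unit_vec_def)
  qed (use c in auto)
  with T(1) show ?thesis by (auto simp: symplectic_eq_Sp)
qed

section \<open>Simple spectrum along polynomial paths\<close>

text \<open>Distinct numbers \<open>2, 3, \<dots>\<close> followed by their inverses: the diagonal of a symplectic matrix with simple
spectrum.\<close>

definition hyperbolic_entry :: "nat \<Rightarrow> nat \<Rightarrow> real" where
  "hyperbolic_entry m i = (if i < m then real i + 2 else inverse (real (i - m) + 2))"

lemma hyperbolic_entry_pos: "hyperbolic_entry m i > 0"
  by (simp add: hyperbolic_entry_def)

lemma inj_hyperbolic_entry: "inj_on (hyperbolic_entry m) {..<2 * m}"
proof (rule inj_onI)
  fix i j assume eq: "hyperbolic_entry m i = hyperbolic_entry m j" and "i \<in> {..<2 * m}" "j \<in> {..<2 * m}"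
  have big: "hyperbolic_entry m i > 1 \<longleftrightarrow> i < m" for i
    by (auto simp: hyperbolic_entry_def inverse_eq_divide)
  from big[of i] big[of j] have "i < m \<longleftrightarrow> j < m" unfolding eq by simp
  with eq show "i = j" by (auto simp: hyperbolic_entry_def split: if_splits)
qed

lemma mat_diag_symplectic:
  assumes "\<And>i. i < m \<Longrightarrow> f i * f (i + m) = 1"
  shows "mat_diag (2 * m) f \<in> symplectic (2 * m)"
proof -
  let ?J = "symplectic_form m" and ?D = "mat_diag (2 * m) f"
  note cJ = symplectic_form_carrier[of m]
  have tD: "transpose_mat ?D = ?D" by (intro eq_matI) (auto simp: mat_diag_def)
  have "?D * ?J * ?D = ?J"
  proof (rule eq_matI)
    fix i j assume "i < dim_row ?J" "j < dim_col ?J"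
    then have ij: "i < 2 * m" "j < 2 * m" using cJ by auto
    have "(?D * ?J * ?D) $$ (i,j) = f i * ?J $$ (i,j) * f j"
      using ij cJ mat_diag_mult_left[OF cJ, of f] by (simp add: mat_diag_mult_right[of _ "2 * m"] del: assoc_mult_mat)
    also have "\<dots> = ?J $$ (i,j)"
      using assms[of i] assms[of j] ij by (auto simp: symplectic_form_entry algebra_simps)
    finally show "(?D * ?J * ?D) $$ (i,j) = ?J $$ (i,j)" .
  qed (use cJ in \<open>auto simp: mat_diag_def\<close>)
  then show ?thesis by (simp add: symplectic_def tD)
qed

definition hyperbolic_mat :: "nat \<Rightarrow> real mat" where
  "hyperbolic_mat m = mat_diag (2 * m) (hyperbolic_entry m)"

text \<open>With \<open>K\<close> the diagonal matrix, reducing \<open>M K\<^sup>-\<^sup>1\<close> to the identity reduces \<open>M\<close> to \<open>K\<close>.\<close>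

lemma symplectic_joined_to_hyperbolic:
  assumes M: "M \<in> symplectic (2 * m)"
  shows "\<exists>T. polynomially_joined (2 * m) (symplectic (2 * m)) T \<and> T * M = hyperbolic_mat m"
proof -
  let ?K = "hyperbolic_mat m" and ?L = "mat_diag (2 * m) (\<lambda>i. inverse (hyperbolic_entry m i))"
  interpret symplectic_space "2 * m" "symplectic_form m" by (rule symplectic_space_standard)
  have "inverse (hyperbolic_entry m i) * hyperbolic_entry m i = 1" for i
    using hyperbolic_entry_pos[of m i] by simp
  then have LK: "?L * ?K = 1\<^sub>m (2 * m)" by (simp add: hyperbolic_mat_def)
  have L: "?L \<in> symplectic (2 * m)"
    by (rule mat_diag_symplectic) (auto simp: hyperbolic_entry_def)
  have "M * ?L \<in> symplectic (2 * m)" using M L Sp_mult by (simp add: symplectic_eq_Sp)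
  then obtain T where T: "polynomially_joined (2 * m) (symplectic (2 * m)) T" "T * (M * ?L) = 1\<^sub>m (2 * m)"
    using symplectic_reduction by blast
  have cT: "T \<in> carrier_mat (2 * m) (2 * m)" and cM: "M \<in> carrier_mat (2 * m) (2 * m)"
    and cL: "?L \<in> carrier_mat (2 * m) (2 * m)" and cK: "?K \<in> carrier_mat (2 * m) (2 * m)"
    using polynomially_joined_mem[OF T(1)] M by (auto simp: symplectic_def hyperbolic_mat_def)
  have "T * M = T * (M * (?L * ?K))" unfolding LK using cM by simp
  also have "\<dots> = (T * (M * ?L)) * ?K"
    using assoc_mult_mat[OF cM cL cK] assoc_mult_mat[OF cT mult_carrier_mat[OF cM cL] cK] by simp
  also have "\<dots> = ?K" unfolding T(2) using cK by simp
  finally show ?thesis using T(1) by blast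
qed

lemma common_root_iff_resultant:
  fixes f g :: "complex poly"
  assumes "f \<noteq> 0"
  shows "resultant f g = 0 \<longleftrightarrow> (\<exists>z. poly f z = 0 \<and> poly g z = 0)"
proof
  assume "resultant f g = 0"
  then have "degree (gcd f g) \<noteq> 0" by (simp add: resultant_0_gcd)
  then obtain z where "poly (gcd f g) z = 0"
    using fundamental_theorem_of_algebra_alt[of "gcd f g"] by (metis degree_pCons_0)
  then have "[:- z, 1:] dvd gcd f g" by (simp add: poly_eq_0_iff_dvd)
  then show "\<exists>z. poly f z = 0 \<and> poly g z = 0" by (auto simp: poly_eq_0_iff_dvd)
next
  assume "\<exists>z. poly f z = 0 \<and> poly g z = 0"
  then obtain z where "[:- z, 1:] dvd gcd f g" by (auto simp: poly_eq_0_iff_dvd)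
  moreover have "gcd f g \<noteq> 0" using assms by simp
  ultimately have "degree [:- z, 1:] \<le> degree (gcd f g)" by (rule dvd_imp_degree_le)
  then show "resultant f g = 0" by (simp add: resultant_0_gcd)
qed

lemma card_roots_eq_degree_of_resultant:
  fixes f :: "complex poly"
  assumes f: "f \<noteq> 0" and res: "resultant f (pderiv f) \<noteq> 0"
  shows "card {z. poly f z = 0} = degree f"
proof -
  have "rsquarefree f" using common_root_iff_resultant[OF f] res by (auto simp: rsquarefree_roots)
  then have ord: "order z f = 1" if "poly f z = 0" for z
    using that f by (simp add: rsquarefree_root_order)
  have "degree f = size (proots f)" by (simp add: size_proots_complex)
  also have "\<dots> = (\<Sum>z\<in>{z. poly f z = 0}. order z f)"
    using f by (simp add: size_multiset_overloaded_eq)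
  also have "\<dots> = card {z. poly f z = 0}" using ord by simp
  finally show ?thesis ..
qed

lemma resultant_linear_factors:
  fixes k :: "nat \<Rightarrow> complex"
  assumes inj: "inj_on k {..<n}"
  shows "resultant (\<Prod>i<n. [:- k i, 1:]) (pderiv (\<Prod>i<n. [:- k i, 1:])) \<noteq> 0"
proof -
  define f where "f = (\<Prod>i<n. [:- k i, 1:])"
  have f: "f \<noteq> 0"
  proof
    assume "f = 0"
    then obtain i where "[:- k i, 1:] = 0"
      using prod_zero_iff[OF finite_lessThan, of "\<lambda>i. [:- k i, 1:]" n] by (auto simp only: f_def)
    then show False by (metis one_neq_zero pCons_eq_0_iff)
  qed
  have "proots f = (\<Sum>i<n. proots [:- k i, 1:])"
    unfolding f_def by (rule proots_prod) (metis one_neq_zero pCons_eq_0_iff)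
  then have "proots f = (\<Sum>i<n. {#k i#})" by (simp only: proots_linear_factor minus_minus)
  then have pr: "proots f = mset_set (k ` {..<n})"
    using image_mset_mset_set[OF inj] by (simp add: sum_unfold_sum_mset)
  have "order z f \<le> 1" for z
  proof -
    have "order z f = count (mset_set (k ` {..<n})) z" using f by (simp flip: pr)
    also have "\<dots> \<le> 1" by (cases "z \<in> k ` {..<n}") auto
    finally show ?thesis .
  qed
  then have "rsquarefree f" using f by (auto simp: rsquarefree_def le_Suc_eq)
  then show ?thesis using common_root_iff_resultant[OF f] by (auto simp: rsquarefree_roots f_def)
qed

text \<open>The resultant of the characteristic polynomial and its derivative is a polynomial \<open>\<rho>\<close> in the path
parameter, because determinants commute with the evaluation of the parameter. It is nonzero at \<open>1\<close>, where the roots are the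
distinct numbers \<open>k i\<close>, so it has finitely many zeros.\<close>

lemma simple_spectrum_on_polynomial_path:
  assumes R: "R \<in> carrier_mat d d" and "inj_on k {..<d}"
    and R1: "map_mat (\<lambda>p. poly p 1) R = mat_diag d k"
  shows "finite {s. card (complex_eigenvalues (map_mat (\<lambda>p. poly p s) R)) \<noteq> d}"
proof -
  define \<chi> where "\<chi> = char_poly R"
  define \<rho> where "\<rho> = resultant \<chi> (pderiv \<chi>)"
  define h where "h s p = complex_of_real (poly p s)" for s p
  define f where "f s = map_poly (h s) \<chi>" for s
  have hom: "idom_hom (h s)" for s by unfold_locales (auto simp: h_def)
  have ch: "comm_ring_hom (h s)" for s using hom idom_hom.axioms(1) by blast
  have deg: "degree \<chi> = d" "monic \<chi>"
    using degree_monic_char_poly[OF R] by (auto simp: \<chi>_def)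
  have f: "char_poly (map_mat complex_of_real (map_mat (\<lambda>p. poly p s) R)) = f s" for s
  proof -
    have "map_mat complex_of_real (map_mat (\<lambda>p. poly p s) R) = map_mat (h s) R"
      by (intro eq_matI) (auto simp: h_def)
    then show ?thesis using comm_ring_hom.char_poly_hom[OF ch R, of s] by (simp add: f_def \<chi>_def)
  qed
  have degf: "degree (f s) = d" "f s \<noteq> 0" for s
    using degree_monic_char_poly[of "map_mat complex_of_real (map_mat (\<lambda>p. poly p s) R)" d] R
    by (auto simp: f)
  have pd: "map_poly (h s) (pderiv \<chi>) = pderiv (f s)" for s
    unfolding f_def by (rule idom_hom.map_poly_pderiv[OF hom])
  have res: "resultant (f s) (pderiv (f s)) = h s \<rho>" for s
    unfolding \<rho>_def f_def
    using comm_ring_hom.resultant_map_poly[OF ch, of s \<chi> "pderiv \<chi>"] degf(1)[of s] deg pd[of s]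
    by (simp add: f_def degree_pderiv)
  have good: "card (complex_eigenvalues (map_mat (\<lambda>p. poly p s) R)) = d" if "poly \<rho> s \<noteq> 0" for s
  proof -
    have "complex_eigenvalues (map_mat (\<lambda>p. poly p s) R) = {z. poly (f s) z = 0}"
      unfolding complex_eigenvalues_def
      by (subst spectrum_root_char_poly[of _ d]) (use R f in auto)
    then show ?thesis
      using card_roots_eq_degree_of_resultant[OF degf(2), of s] degf(1)[of s] res[of s] that
      by (simp add: h_def)
  qed
  have "f 1 = (\<Prod>i<d. [:- complex_of_real (k i), 1:])"
  proof -
    have "map_mat complex_of_real (mat_diag d k) = mat_diag d (\<lambda>i. complex_of_real (k i))"
      by (intro eq_matI) (auto simp: mat_diag_def)
    then have "f 1 = char_poly (mat_diag d (\<lambda>i. complex_of_real (k i)))" using f[of 1] R1 by simp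
    also have "\<dots> = (\<Prod>a\<leftarrow>diag_mat (mat_diag d (\<lambda>i. complex_of_real (k i))). [:- a, 1:])"
      by (rule char_poly_upper_triangular[of _ d]) (auto simp: mat_diag_def)
    also have "\<dots> = (\<Prod>i<d. [:- complex_of_real (k i), 1:])"
      by (simp add: diag_mat_def mat_diag_def prod.list_conv_set_nth atLeast0LessThan)
    finally show ?thesis .
  qed
  then have "h 1 \<rho> \<noteq> 0"
    using resultant_linear_factors[of "\<lambda>i. complex_of_real (k i)" d] assms(2)
    by (simp add: inj_on_def flip: res)
  then have "\<rho> \<noteq> 0" by (auto simp: h_def)
  then have "finite {s. poly \<rho> s = 0}" by (rule poly_roots_finite)
  then show ?thesis by (rule rev_finite_subset) (use good in blast)
qed

lemma symplectic_deformable_to_simple_spectrum: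
  assumes M: "M \<in> symplectic (2 * m)" and e: "e > 0"
  shows "\<exists>N. deformable (2 * m) (symplectic (2 * m)) e M N \<and> card (complex_eigenvalues N) = 2 * m"
proof -
  let ?n = "2 * m"
  interpret symplectic_space ?n "symplectic_form m" by (rule symplectic_space_standard)
  have cM: "M \<in> carrier_mat ?n ?n" using M by (simp add: symplectic_def)
  obtain T where T: "polynomially_joined ?n (symplectic ?n) T" "T * M = hyperbolic_mat m"
    using symplectic_joined_to_hyperbolic[OF M] by blast
  from T(1) obtain R where R: "R \<in> carrier_mat ?n ?n" "\<And>s. map_mat (\<lambda>p. poly p s) R \<in> symplectic ?n"
    "map_mat (\<lambda>p. poly p 0) R = 1\<^sub>m ?n" "map_mat (\<lambda>p. poly p 1) R = T"
    unfolding polynomially_joined_def by blast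
  define C where "C = map_mat (\<lambda>a. [:a:]) M"
  have C: "C \<in> carrier_mat ?n ?n" "map_mat (\<lambda>p. poly p s) C = M" for s
    using cM by (auto simp: C_def)
  define \<Gamma> where "\<Gamma> s = map_mat (\<lambda>p. poly p s) (R * C)" for s :: real
  have \<Gamma>: "\<Gamma> s = map_mat (\<lambda>p. poly p s) R * M" for s
  proof -
    have "semiring_hom (\<lambda>p :: real poly. poly p s)" by unfold_locales auto
    from semiring_hom.mat_hom_mult[OF this R(1) C(1)] show ?thesis by (simp add: \<Gamma>_def C(2))
  qed
  have RC: "R * C \<in> carrier_mat ?n ?n" using R(1) C(1) by simp
  have \<Gamma>S: "\<Gamma> s \<in> symplectic ?n" for s
    unfolding \<Gamma> using R(2)[of s] M Sp_mult by (simp add: symplectic_eq_Sp)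
  have "\<exists>b\<in>{0<..1}. \<forall>s\<in>{0<..b}. deformable ?n (symplectic ?n) e M (\<Gamma> s)"
  proof (rule deformable_of_germ)
    fix i j assume "i < ?n" "j < ?n"
    then show "continuous_on {0..1} (\<lambda>s. \<Gamma> s $$ (i,j))"
      using RC by (auto simp: \<Gamma>_def simp del: index_mult_mat intro!: continuous_intros)
  qed (use e \<Gamma>S cM R(3) in \<open>auto simp: \<Gamma> symplectic_def\<close>)
  then obtain b where b: "b > 0" "\<And>s. s \<in> {0<..b} \<Longrightarrow> deformable ?n (symplectic ?n) e M (\<Gamma> s)" by auto
  have "finite {s. card (complex_eigenvalues (\<Gamma> s)) \<noteq> ?n}"
    unfolding \<Gamma>_def
    by (rule simple_spectrum_on_polynomial_path[OF RC inj_hyperbolic_entry])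
       (use \<Gamma>[of 1] R(4) T(2) in \<open>simp add: \<Gamma>_def hyperbolic_mat_def\<close>)
  moreover have "infinite {0<..b}" using b(1) by (simp add: infinite_Ioc)
  ultimately have "{0<..b} - {s. card (complex_eigenvalues (\<Gamma> s)) \<noteq> ?n} \<noteq> {}"
    by (metis Diff_infinite_finite finite.emptyI)
  then show ?thesis using b(2) by blast
qed

section \<open>The three groups\<close>

lemma general_linear_eq: "general_linear d = {A \<in> carrier_mat d d. det A \<noteq> 0}"
  by (auto simp: general_linear_def invertible_mat_iff_det[of _ d])

text \<open>The general and the special linear group are both cut out by the determinant lying in a multiplicative
group \<open>S\<close> of numbers, and a path with constant determinant stays inside either of them.\<close>

lemma group_closure_by_det:
  assumes S: "\<And>x y. x \<in> S \<Longrightarrow> y \<in> S \<Longrightarrow> x * y \<in> S" "1 \<in> S" "0 \<notin> S" "\<And>x. x \<in> S \<Longrightarrow> inverse x \<in> S"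
    and G: "G = {A \<in> carrier_mat d d. det A \<in> S}"
  shows "G \<subseteq> general_linear d" "1\<^sub>m d \<in> G" "X \<in> G \<Longrightarrow> Y \<in> G \<Longrightarrow> X * Y \<in> G"
    "X \<in> G \<Longrightarrow> inv_mat X \<in> G"
proof -
  have nz: "det X \<noteq> 0" if "X \<in> G" for X using that S(3) G by auto
  show "G \<subseteq> general_linear d"
    using nz G by (auto simp: general_linear_eq)
  show "1\<^sub>m d \<in> G" using S(2) by (simp add: G)
  show "X * Y \<in> G" if "X \<in> G" "Y \<in> G"
    using that S(1) by (auto simp: G det_mult[of _ d])
  show "inv_mat X \<in> G" if X: "X \<in> G"
  proof -
    have c: "X \<in> carrier_mat d d" using X by (simp add: G)
    note i = inv_mat_correct[OF c nz[OF X]]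
    have "det X * det (inv_mat X) = 1" using det_mult[OF c i(1)] i(2) by simp
    then have "det (inv_mat X) = inverse (det X)" using nz[OF X] by (simp add: field_simps)
    then show ?thesis using i(1) S(4)[of "det X"] X by (auto simp: G)
  qed
qed

text \<open>Invertibility comes from \<open>symplectic_reduction\<close>, which supplies a left inverse inside the group.\<close>

lemma symplectic_group:
  shows "symplectic (2 * m) \<subseteq> general_linear (2 * m)" "1\<^sub>m (2 * m) \<in> symplectic (2 * m)"
    "X \<in> symplectic (2 * m) \<Longrightarrow> Y \<in> symplectic (2 * m) \<Longrightarrow> X * Y \<in> symplectic (2 * m)"
    "X \<in> symplectic (2 * m) \<Longrightarrow> inv_mat X \<in> symplectic (2 * m)"
proof -
  interpret symplectic_space "2 * m" "symplectic_form m" by (rule symplectic_space_standard)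
  note eq = symplectic_eq_Sp[of m]
  have left: "\<exists>T \<in> symplectic (2 * m). T * X = 1\<^sub>m (2 * m)" if "X \<in> symplectic (2 * m)" for X
    using symplectic_reduction[OF that] polynomially_joined_mem by blast
  have car: "X \<in> carrier_mat (2 * m) (2 * m)" if "X \<in> symplectic (2 * m)" for X
    using that by (simp add: symplectic_def)
  have nz: "det X \<noteq> 0" if X: "X \<in> symplectic (2 * m)" for X
  proof -
    obtain T where T: "T \<in> symplectic (2 * m)" "T * X = 1\<^sub>m (2 * m)" using left[OF X] by blast
    have "det T * det X = 1" using det_mult[OF car[OF T(1)] car[OF X]] T(2) by simp
    then show ?thesis by auto
  qed
  show "symplectic (2 * m) \<subseteq> general_linear (2 * m)"
    using car nz by (auto simp: general_linear_eq)
  show "1\<^sub>m (2 * m) \<in> symplectic (2 * m)" unfolding eq by (rule Sp_one)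
  show "X * Y \<in> symplectic (2 * m)" if "X \<in> symplectic (2 * m)" "Y \<in> symplectic (2 * m)"
    using that unfolding eq by (rule Sp_mult)
  show "inv_mat X \<in> symplectic (2 * m)" if X: "X \<in> symplectic (2 * m)"
  proof -
    note i = inv_mat_correct[OF car[OF X] nz[OF X]]
    obtain T where T: "T \<in> symplectic (2 * m)" "T * X = 1\<^sub>m (2 * m)" using left[OF X] by blast
    have "T = T * (X * inv_mat X)" using car[OF T(1)] i by simp
    also have "\<dots> = inv_mat X" using assoc_mult_mat[OF car[OF T(1)] car[OF X] i(1)] T(2) i(1) by simp
    finally show ?thesis using T(1) by simp
  qed
qed

definition good_spectrum :: "nat \<Rightarrow> real mat \<Rightarrow> bool" where
  "good_spectrum d N \<longleftrightarrow> card (complex_eigenvalues N) = d \<and>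
     (\<forall>z\<in>complex_eigenvalues N. \<exists>q\<in>\<rat>. Arg z = pi * q)"

lemma deformable_to_good_spectrum_linear:
  assumes M: "M \<in> carrier_mat d d" "det M \<noteq> 0" and e: "e > 0"
  shows "\<exists>K. deformable d (same_moduli d M) e M K \<and> good_spectrum d K"
proof -
  obtain N where N: "deformable d (same_moduli d M) (e / 2) M N" "card (complex_eigenvalues N) = d"
    using deformable_to_simple_spectrum[OF M, of "e / 2"] e by auto
  have NM: "N \<in> same_moduli d M" using deformable_endpoint[OF N(1)] .
  then have Nc: "N \<in> carrier_mat d d" "det N \<noteq> 0" using M by (auto simp: same_moduli_def)
  obtain K where K: "deformable d (same_moduli d N) (e / 2) N K" "good_spectrum d K"
    using rotate_to_rational_arguments[OF Nc N(2), of "e / 2" "same_moduli d N"] e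
    by (auto simp: good_spectrum_def)
  have "deformable d (same_moduli d M) (e / 2 + e / 2) M K"
    by (rule deformable_trans[OF N(1) K(1)[unfolded same_moduli_eq[OF NM]]]) (auto simp: same_moduli_def)
  with K(2) show ?thesis by auto
qed

lemma deformable_to_good_spectrum_symplectic:
  assumes M: "M \<in> symplectic (2 * m)" and e: "e > 0"
  shows "\<exists>K. deformable (2 * m) (symplectic (2 * m)) e M K \<and> good_spectrum (2 * m) K"
proof -
  obtain N where N: "deformable (2 * m) (symplectic (2 * m)) (e / 2) M N"
      "card (complex_eigenvalues N) = 2 * m"
    using symplectic_deformable_to_simple_spectrum[OF M, of "e / 2"] e by auto
  have NS: "N \<in> symplectic (2 * m)" using deformable_endpoint[OF N(1)] .
  then have Nc: "N \<in> carrier_mat (2 * m) (2 * m)" "det N \<noteq> 0"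
    using symplectic_group(1)[of m] by (auto simp: general_linear_eq)
  have "\<exists>K. deformable (2 * m) (symplectic (2 * m)) (e / 2) N K \<and> card (complex_eigenvalues K) = 2 * m \<and>
      (\<forall>z\<in>complex_eigenvalues K. \<exists>q\<in>\<rat>. Arg z = pi * q)"
  proof (rule rotate_to_rational_arguments[OF Nc N(2)])
    fix X assume "X \<in> same_moduli (2 * m) N"
      and "\<And>J. J \<in> carrier_mat (2 * m) (2 * m) \<Longrightarrow> transpose_mat N * J * N = J \<Longrightarrow> transpose_mat X * J * X = J"
    then show "X \<in> symplectic (2 * m)"
      using NS symplectic_form_carrier[of m] by (simp add: symplectic_def same_moduli_def)
  qed (use e in simp)
  then obtain K where K: "deformable (2 * m) (symplectic (2 * m)) (e / 2) N K" "good_spectrum (2 * m) K"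
    by (auto simp: good_spectrum_def)
  have "deformable (2 * m) (symplectic (2 * m)) (e / 2 + e / 2) M K"
    by (rule deformable_trans[OF N(1) K(1)]) (auto simp: symplectic_def)
  with K(2) show ?thesis by auto
qed

theorem proposition4p1:
  fixes d l :: nat and \<epsilon> :: real and G :: "real mat set" and A :: "int \<Rightarrow> real mat"
  assumes "d \<ge> 1"
    and "\<epsilon> > 0"
    and "G = general_linear d \<or> G = special_linear d \<or> (even d \<and> G = symplectic d)"
    and "periodic_cocycle G l A"
  shows "\<exists>P :: real \<Rightarrow> int \<Rightarrow> real mat.
    perturbation_path G l \<epsilon> A P \<and>
    card (complex_eigenvalues (cocycle_prod d (P 1) l)) = d \<and>
    (\<forall>z\<in>complex_eigenvalues (cocycle_prod d (P 1) l). \<exists>q\<in>\<rat>. Arg z = pi * q) \<and>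
    (G = general_linear d \<or> G = special_linear d \<longrightarrow>
      (\<forall>t\<in>{0..1}. eigenvalue_moduli (cocycle_prod d (P t) l)
                   = eigenvalue_moduli (cocycle_prod d (P 0) l)))"
proof -
  define M where "M = cocycle_prod d A l"
  have AG: "\<And>i. A i \<in> G" using assms(4) by (simp add: periodic_cocycle_def)
  show ?thesis
  proof (cases "G = general_linear d \<or> G = special_linear d")
    case True
    define S where "S = (if G = general_linear d then - {0} else {1::real})"
    have S: "\<And>x y. x \<in> S \<Longrightarrow> y \<in> S \<Longrightarrow> x * y \<in> S" "1 \<in> S" "0 \<notin> S" "\<And>x. x \<in> S \<Longrightarrow> inverse x \<in> S"
      by (auto simp: S_def split: if_splits)
    have GS: "G = {A \<in> carrier_mat d d. det A \<in> S}"
    proof (cases "G = general_linear d")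
      case True
      then have "S = - {0}" by (simp add: S_def)
      then show ?thesis unfolding True general_linear_eq by simp
    next
      case False
      then have "G = special_linear d" "S = {1}" using True by (simp_all add: S_def)
      then show ?thesis by (simp add: special_linear_def)
    qed
    note grp = group_closure_by_det[OF S GS]
    have MG: "M \<in> G" unfolding M_def by (rule cocycle_prod_mem[OF grp(3) AG grp(2)])
    then have Mc: "M \<in> carrier_mat d d" "det M \<noteq> 0" using S(3) by (auto simp: GS)
    have sub: "same_moduli d M \<subseteq> G" using MG by (auto simp: GS same_moduli_def)
    obtain P where P: "perturbation_path G l \<epsilon> A P" "good_spectrum d (cocycle_prod d (P 1) l)"
        "\<And>t. t \<in> {0..1} \<Longrightarrow> cocycle_prod d (P t) l \<in> same_moduli d M"
      using perturbation_path_of_deformation[OF grp assms(4,2) sub,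
          of "good_spectrum d"] deformable_to_good_spectrum_linear[OF Mc] by (auto simp: M_def)
    have "eigenvalue_moduli (cocycle_prod d (P t) l) = eigenvalue_moduli (cocycle_prod d (P 0) l)"
      if "t \<in> {0..1}" for t
      using P(3)[OF that] P(3)[of 0] by (simp add: same_moduli_def)
    with P(1,2) show ?thesis unfolding good_spectrum_def by blast
  next
    case False
    then obtain m where m: "d = 2 * m" and G: "G = symplectic (2 * m)" using assms(3) by blast
    have MG: "M \<in> symplectic (2 * m)"
      unfolding M_def using cocycle_prod_mem[OF symplectic_group(3) AG[unfolded G] symplectic_group(2)]
      by (simp add: m)
    obtain P where "perturbation_path G l \<epsilon> A P" "good_spectrum d (cocycle_prod d (P 1) l)"
      using perturbation_path_of_deformation[OF symplectic_group assms(4)[unfolded G] assms(2) subset_refl,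
          of "good_spectrum d"] deformable_to_good_spectrum_symplectic[OF MG] by (auto simp: M_def m G)
    with False show ?thesis unfolding good_spectrum_def by blast
  qed
qed

end
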